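(* The decision problem Bounded-Two-Stage$(\mathcal{X}_c,\mathcal{U}_d(x),\mathcal{Y}_d)$ is in $\Sigma_3^p$.
   Context: An instance consists of rational data encoded in binary: a bound $R\in\mathbb{Z}_+$, vectors $a\in\mathbb{Q}^{m_x}$, $b\in\mathbb{Q}^{m_u}$, matrices $A\in\mathbb{Q}^{m_x\times n_x}$, $W\in\mathbb{Q}^{m_y\times n_y}$, an $m_u\times n_u$ matrix $B(x)$ whose entries depend linearly on $x$ with rational coefficients, and an $m_y\times n_x$ matrix $T(u)$ whose entries depend linearly on $u$ with rational coefficients. Let $\mathcal{X}_c=\{x\in[0,R]^{n_x}: Ax\le a\}$, $\mathcal{U}_d(x)=\{u\in[0,R]^{n_u}\cap\mathbb{Z}^{n_u}: B(x)u\le b\}$, $\mathcal{Y}_d(x,u)=\{y\in[0,R]^{n_y}\cap\mathbb{Z}^{n_y}: T(u)x+Wy\le 0\}$. Bounded-Two-Stage$(\mathcal{X}_c,\mathcal{U}_d(x),\mathcal{Y}_d)$ is the decision problem $$\exists x\in\mathcal{X}_c\ \ \forall u\in\mathcal{U}_d(x)\ \ \exists y\in\mathcal{Y}_d(x,u)\,?$$ $\Sigma_3^p$ is the class of problems expressible as $\exists X\,\forall Y\,\exists Z: P(I,X,Y,Z)$, where $I$ is the instance, $X,Y,Z$ range over objects of encoding length polynomial in that of $I$, and $P$ is decidable in polynomial time. *)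

theory Defs
  imports
    Jordan_Normal_Form.Matrix
    "HOL-Computational_Algebra.Polynomial"
begin

section \<open>Deterministic multitape Turing machines\<close>

text \<open>States and tape symbols are initial segments of the natural numbers. State 0 is the start
  state, 1 accepts and 2 rejects; symbol 0 is the blank, and 1 and 2 are the input bits
  \<^term>\<open>False\<close> and \<^term>\<open>True\<close>. Further work symbols and states are at the machine's disposal.\<close>

datatype head_move = Move_Left | Stay | Move_Right

record tm =
  tm_tapes :: nat
  tm_states :: nat
  tm_symbols :: nat
  tm_trans :: "nat \<Rightarrow> nat list \<Rightarrow> nat \<times> (nat \<times> head_move) list"

definition wf_tm :: "tm \<Rightarrow> bool" where
  "wf_tm M \<longleftrightarrow> tm_tapes M \<ge> 1 \<and> tm_states M \<ge> 3 \<and> tm_symbols M \<ge> 3 \<and>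
     (\<forall>q < tm_states M. \<forall>ss. length ss = tm_tapes M \<and> set ss \<subseteq> {..<tm_symbols M} \<longrightarrow>
        fst (tm_trans M q ss) < tm_states M \<and>
        length (snd (tm_trans M q ss)) = tm_tapes M \<and>
        fst ` set (snd (tm_trans M q ss)) \<subseteq> {..<tm_symbols M})"

text \<open>A tape is infinite in both directions: its contents together with the head position.\<close>

type_synonym tape = "(int \<Rightarrow> nat) \<times> int"
type_synonym config = "nat \<times> tape list"

fun move_head :: "head_move \<Rightarrow> int \<Rightarrow> int" where
  "move_head Move_Left h = h - 1"
| "move_head Stay h = h"
| "move_head Move_Right h = h + 1"

definition read_tape :: "tape \<Rightarrow> nat" where
  "read_tape t = fst t (snd t)"

definition act_tape :: "tape \<Rightarrow> nat \<times> head_move \<Rightarrow> tape" where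
  "act_tape t a = ((fst t)(snd t := fst a), move_head (snd a) (snd t))"

definition tm_step :: "tm \<Rightarrow> config \<Rightarrow> config" where
  "tm_step M c = (case c of (q, ts) \<Rightarrow>
     if q = 1 \<or> q = 2 then (q, ts)
     else (case tm_trans M q (map read_tape ts) of (q', as) \<Rightarrow> (q', map2 act_tape ts as)))"

definition blank_tape :: tape where
  "blank_tape = (\<lambda>_. 0, 0)"

definition input_tape :: "bool list \<Rightarrow> tape" where
  "input_tape w =
     (\<lambda>i. if 0 \<le> i \<and> i < int (length w) then (if w ! nat i then 2 else 1) else 0, 0)"

definition tm_init :: "tm \<Rightarrow> bool list \<Rightarrow> config" where
  "tm_init M w = (0, input_tape w # replicate (tm_tapes M - 1) blank_tape)"

definition tm_decides_within :: "tm \<Rightarrow> bool list set \<Rightarrow> (nat \<Rightarrow> nat) \<Rightarrow> bool" where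
  "tm_decides_within M L T \<longleftrightarrow>
     (\<forall>w. \<exists>t \<le> T (length w). fst ((tm_step M ^^ t) (tm_init M w)) = (if w \<in> L then 1 else 2))"

section \<open>The complexity classes\<close>

definition ptime :: "bool list set set" where
  "ptime = {L. \<exists>M (p :: nat poly). wf_tm M \<and> tm_decides_within M L (poly p)}"

text \<open>A self-delimiting code for words: each bit is preceded by \<^term>\<open>True\<close>, and \<^term>\<open>False\<close>
  marks the end.\<close>

definition code_word :: "bool list \<Rightarrow> bool list" where
  "code_word w = concat (map (\<lambda>b. [True, b]) w) @ [False]"

definition code_tuple :: "bool list list \<Rightarrow> bool list" where
  "code_tuple ws = concat (map code_word ws)"

definition Sigma3p :: "bool list set set" where
  "Sigma3p = {L. \<exists>P \<in> ptime. \<exists>p :: nat poly. \<forall>I. I \<in> L \<longleftrightarrow>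
     (\<exists>X. length X \<le> poly p (length I) \<and>
       (\<forall>Y. length Y \<le> poly p (length I) \<longrightarrow>
         (\<exists>Z. length Z \<le> poly p (length I) \<and> code_tuple [I, X, Y, Z] \<in> P)))}"

section \<open>The problem Bounded-Two-Stage\<close>

text \<open>The linearly varying matrices are given by their coefficient matrices:
  \<open>B(x) = (\<Sum>k. x\<^sub>k B\<^sub>k)\<close> and \<open>T(u) = (\<Sum>k. u\<^sub>k T\<^sub>k)\<close>.\<close>

record inst =
  dim_mx :: nat
  dim_mu :: nat
  dim_my :: nat
  dim_nx :: nat
  dim_nu :: nat
  dim_ny :: nat
  bnd_R :: nat
  vec_a :: "rat vec"
  vec_b :: "rat vec"
  mat_A :: "rat mat"
  mat_W :: "rat mat"
  mats_B :: "rat mat list"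
  mats_T :: "rat mat list"

definition wf_inst :: "inst \<Rightarrow> bool" where
  "wf_inst I \<longleftrightarrow>
     vec_a I \<in> carrier_vec (dim_mx I) \<and>
     vec_b I \<in> carrier_vec (dim_mu I) \<and>
     mat_A I \<in> carrier_mat (dim_mx I) (dim_nx I) \<and>
     mat_W I \<in> carrier_mat (dim_my I) (dim_ny I) \<and>
     length (mats_B I) = dim_nx I \<and> set (mats_B I) \<subseteq> carrier_mat (dim_mu I) (dim_nu I) \<and>
     length (mats_T I) = dim_nu I \<and> set (mats_T I) \<subseteq> carrier_mat (dim_my I) (dim_nx I)"

abbreviation real_vec :: "rat vec \<Rightarrow> real vec" where
  "real_vec \<equiv> map_vec real_of_rat"

abbreviation real_mat :: "rat mat \<Rightarrow> real mat" where
  "real_mat \<equiv> map_mat real_of_rat"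

definition lin_mat :: "nat \<Rightarrow> nat \<Rightarrow> rat mat list \<Rightarrow> real vec \<Rightarrow> real mat" where
  "lin_mat m n Cs v = mat m n (\<lambda>(i, j). \<Sum>k < length Cs. v $ k * real_of_rat ((Cs ! k) $$ (i, j)))"

definition B_of :: "inst \<Rightarrow> real vec \<Rightarrow> real mat" where
  "B_of I x = lin_mat (dim_mu I) (dim_nu I) (mats_B I) x"

definition T_of :: "inst \<Rightarrow> real vec \<Rightarrow> real mat" where
  "T_of I u = lin_mat (dim_my I) (dim_nx I) (mats_T I) u"

definition box :: "nat \<Rightarrow> nat \<Rightarrow> real vec set" where
  "box n R = {v \<in> carrier_vec n. \<forall>i < n. 0 \<le> v $ i \<and> v $ i \<le> real R}"

definition int_vecs :: "nat \<Rightarrow> real vec set" where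
  "int_vecs n = {v \<in> carrier_vec n. \<forall>i < n. v $ i \<in> \<int>}"

definition X_c :: "inst \<Rightarrow> real vec set" where
  "X_c I = {x \<in> box (dim_nx I) (bnd_R I). real_mat (mat_A I) *\<^sub>v x \<le> real_vec (vec_a I)}"

definition U_d :: "inst \<Rightarrow> real vec \<Rightarrow> real vec set" where
  "U_d I x = {u \<in> box (dim_nu I) (bnd_R I) \<inter> int_vecs (dim_nu I).
     B_of I x *\<^sub>v u \<le> real_vec (vec_b I)}"

definition Y_d :: "inst \<Rightarrow> real vec \<Rightarrow> real vec \<Rightarrow> real vec set" where
  "Y_d I x u = {y \<in> box (dim_ny I) (bnd_R I) \<inter> int_vecs (dim_ny I).
     T_of I u *\<^sub>v x + real_mat (mat_W I) *\<^sub>v y \<le> 0\<^sub>v (dim_my I)}"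

definition bounded_two_stage :: "inst \<Rightarrow> bool" where
  "bounded_two_stage I \<longleftrightarrow> (\<exists>x \<in> X_c I. \<forall>u \<in> U_d I x. \<exists>y. y \<in> Y_d I x u)"

section \<open>Binary encoding of instances\<close>

text \<open>Numbers are written in binary, least significant bit first and without leading zeros, and a
  rational as its reduced fraction. The dimensions are written in unary: they do not exceed the
  number of entries of the data except in degenerate cases (such as a matrix with columns but no
  rows), where unary notation keeps the vectors over which \<open>x\<close>, \<open>u\<close>, \<open>y\<close> range from having
  exponentially many entries.\<close>

fun nat_bits :: "nat \<Rightarrow> bool list" where
  "nat_bits n = (if n = 0 then [] else odd n # nat_bits (n div 2))"

declare nat_bits.simps [simp del]

definition code_dim :: "nat \<Rightarrow> bool list" where
  "code_dim n = replicate n True @ [False]"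

definition code_nat :: "nat \<Rightarrow> bool list" where
  "code_nat n = code_word (nat_bits n)"

definition code_int :: "int \<Rightarrow> bool list" where
  "code_int z = (z < 0) # code_nat (nat \<bar>z\<bar>)"

definition code_rat :: "rat \<Rightarrow> bool list" where
  "code_rat r = code_int (fst (quotient_of r)) @ code_int (snd (quotient_of r))"

definition code_vec :: "rat vec \<Rightarrow> bool list" where
  "code_vec v = concat (map code_rat (list_of_vec v))"

definition code_mat :: "rat mat \<Rightarrow> bool list" where
  "code_mat A = concat (map (\<lambda>i. code_vec (row A i)) [0..<dim_row A])"

definition code_inst :: "inst \<Rightarrow> bool list" where
  "code_inst I =
     code_dim (dim_mx I) @ code_dim (dim_mu I) @ code_dim (dim_my I) @
     code_dim (dim_nx I) @ code_dim (dim_nu I) @ code_dim (dim_ny I) @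
     code_nat (bnd_R I) @ code_vec (vec_a I) @ code_vec (vec_b I) @
     code_mat (mat_A I) @ code_mat (mat_W I) @
     concat (map code_mat (mats_B I)) @ concat (map code_mat (mats_T I))"

definition Bounded_Two_Stage :: "bool list set" where
  "Bounded_Two_Stage = {code_inst I | I. wf_inst I \<and> bounded_two_stage I}"

subsection \<open>The encoding is injective\<close>

lemma code_word_simps: "code_word [] = [False]" "code_word (b # w) = True # b # code_word w"
  by (simp_all add: code_word_def)

lemma code_word_append_eq: "code_word v @ r = code_word w @ s \<longleftrightarrow> v = w \<and> r = s"
proof (induction v arbitrary: w)
  case Nil then show ?case by (cases w) (auto simp: code_word_simps)
next
  case (Cons a v) then show ?case by (cases w) (auto simp: code_word_simps)
qed

lemma nat_bits_inj: "nat_bits m = nat_bits n \<longleftrightarrow> m = n"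
proof (induction m arbitrary: n rule: less_induct)
  case (less m)
  show ?case
  proof (cases "m = 0 \<or> n = 0")
    case True then show ?thesis by (subst (1 2) nat_bits.simps) auto
  next
    case False
    have "nat_bits m = nat_bits n \<longleftrightarrow> (odd m = odd n \<and> m div 2 = n div 2)"
      using False less[of "m div 2" "n div 2"] by (subst (1 2) nat_bits.simps) auto
    also have "\<dots> \<longleftrightarrow> m = n" by presburger
    finally show ?thesis .
  qed
qed

lemma code_dim_append_eq: "code_dim m @ r = code_dim n @ s \<longleftrightarrow> m = n \<and> r = s"
proof (induction m arbitrary: n)
  case 0 then show ?case by (cases n) (auto simp: code_dim_def)
next
  case (Suc m) then show ?case by (cases n) (auto simp: code_dim_def)
qed

lemma code_nat_append_eq: "code_nat m @ r = code_nat n @ s \<longleftrightarrow> m = n \<and> r = s"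
  by (simp add: code_nat_def code_word_append_eq nat_bits_inj)

lemma code_int_append_eq: "code_int m @ r = code_int n @ s \<longleftrightarrow> m = n \<and> r = s"
  by (auto simp: code_int_def code_nat_append_eq nat_eq_iff)

lemma code_rat_append_eq: "code_rat p @ r = code_rat q @ s \<longleftrightarrow> p = q \<and> r = s"
  using quotient_of_inject[OF prod_eqI, of p q] by (auto simp: code_rat_def code_int_append_eq)

lemma concat_append_eq:
  assumes "\<And>x y r s. x \<in> C \<Longrightarrow> y \<in> C \<Longrightarrow> f x @ r = f y @ s \<Longrightarrow> x = y \<and> r = s"
    and "set xs \<subseteq> C" "set ys \<subseteq> C" "length xs = length ys"
    and "concat (map f xs) @ r = concat (map f ys) @ s"
  shows "xs = ys \<and> r = s"
  using assms(2-)
proof (induction xs arbitrary: ys)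
  case Nil
  then show ?case by simp
next
  case (Cons x xs zs)
  then obtain y ys where zs: "zs = y # ys" by (cases zs) simp_all
  have "f x @ (concat (map f xs) @ r) = f y @ (concat (map f ys) @ s)"
    using Cons.prems(4) unfolding zs by simp
  then have "x = y \<and> concat (map f xs) @ r = concat (map f ys) @ s"
    by (rule assms(1)[rotated 2]) (use Cons.prems(1,2) zs in simp_all)
  then show ?case using Cons.IH[of ys] Cons.prems(1-3) zs by simp
qed

lemma code_vec_append_eq:
  assumes "dim_vec v = dim_vec w" "code_vec v @ r = code_vec w @ s"
  shows "v = w \<and> r = s"
proof -
  have "list_of_vec v = list_of_vec w \<and> r = s"
    by (rule concat_append_eq[of UNIV code_rat])
      (use assms in \<open>simp_all add: code_rat_append_eq code_vec_def\<close>)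
  then show ?thesis by (metis vec_list)
qed

lemma code_mat_append_eq:
  assumes "A \<in> carrier_mat m n" "B \<in> carrier_mat m n" "code_mat A @ r = code_mat B @ s"
  shows "A = B \<and> r = s"
proof -
  have e: "code_mat M = concat (map code_vec (rows M))" for M
    by (simp add: code_mat_def rows_def comp_def)
  have "rows A = rows B \<and> r = s"
  proof (rule concat_append_eq[of "carrier_vec n" code_vec])
    fix v w r s assume "v \<in> carrier_vec n" "w \<in> carrier_vec n" "code_vec v @ r = code_vec w @ s"
    then show "v = w \<and> r = s" by (intro code_vec_append_eq) simp_all
  next
    show "set (rows A) \<subseteq> carrier_vec n" "set (rows B) \<subseteq> carrier_vec n"
      using assms(1,2) rows_carrier by blast+
  qed (use assms e in simp_all)
  then show ?thesis using assms(1,2) mat_of_rows_rows[of A] mat_of_rows_rows[of B]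
    by (metis carrier_matD(2))
qed

lemma code_mats_append_eq:
  assumes "set As \<subseteq> carrier_mat m n" "set Bs \<subseteq> carrier_mat m n" "length As = length Bs"
    "concat (map code_mat As) @ r = concat (map code_mat Bs) @ s"
  shows "As = Bs \<and> r = s"
  by (rule concat_append_eq[OF code_mat_append_eq assms])

lemma code_inst_inj: "inj_on code_inst {I. wf_inst I}"
proof (rule inj_onI)
  fix I J assume "I \<in> {I. wf_inst I}" "J \<in> {I. wf_inst I}" and eq: "code_inst I = code_inst J"
  then have wf: "wf_inst I" "wf_inst J" by simp_all
  have dims: "dim_mx J = dim_mx I" "dim_mu J = dim_mu I" "dim_my J = dim_my I"
      "dim_nx J = dim_nx I" "dim_nu J = dim_nu I" "dim_ny J = dim_ny I" "bnd_R J = bnd_R I"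
    and 1: "code_vec (vec_a I) @ code_vec (vec_b I) @ code_mat (mat_A I) @ code_mat (mat_W I) @
      concat (map code_mat (mats_B I)) @ concat (map code_mat (mats_T I)) =
      code_vec (vec_a J) @ code_vec (vec_b J) @ code_mat (mat_A J) @ code_mat (mat_W J) @
      concat (map code_mat (mats_B J)) @ concat (map code_mat (mats_T J))"
    using eq unfolding code_inst_def code_dim_append_eq code_nat_append_eq by simp_all
  have wI: "vec_a I \<in> carrier_vec (dim_mx I)" "vec_b I \<in> carrier_vec (dim_mu I)"
      "mat_A I \<in> carrier_mat (dim_mx I) (dim_nx I)" "mat_W I \<in> carrier_mat (dim_my I) (dim_ny I)"
      "set (mats_B I) \<subseteq> carrier_mat (dim_mu I) (dim_nu I)" "length (mats_B I) = dim_nx I"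
      "set (mats_T I) \<subseteq> carrier_mat (dim_my I) (dim_nx I)" "length (mats_T I) = dim_nu I"
    using wf(1) unfolding wf_inst_def by simp_all
  have wJ: "vec_a J \<in> carrier_vec (dim_mx I)" "vec_b J \<in> carrier_vec (dim_mu I)"
      "mat_A J \<in> carrier_mat (dim_mx I) (dim_nx I)" "mat_W J \<in> carrier_mat (dim_my I) (dim_ny I)"
      "set (mats_B J) \<subseteq> carrier_mat (dim_mu I) (dim_nu I)" "length (mats_B J) = dim_nx I"
      "set (mats_T J) \<subseteq> carrier_mat (dim_my I) (dim_nx I)" "length (mats_T J) = dim_nu I"
    using wf(2) unfolding wf_inst_def dims by simp_all
  have a: "vec_a I = vec_a J \<and> code_vec (vec_b I) @ code_mat (mat_A I) @ code_mat (mat_W I) @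
      concat (map code_mat (mats_B I)) @ concat (map code_mat (mats_T I)) =
      code_vec (vec_b J) @ code_mat (mat_A J) @ code_mat (mat_W J) @
      concat (map code_mat (mats_B J)) @ concat (map code_mat (mats_T J))"
    by (rule code_vec_append_eq[OF _ 1]) (simp add: carrier_vecD[OF wI(1)] carrier_vecD[OF wJ(1)])
  have b: "vec_b I = vec_b J \<and> code_mat (mat_A I) @ code_mat (mat_W I) @
      concat (map code_mat (mats_B I)) @ concat (map code_mat (mats_T I)) =
      code_mat (mat_A J) @ code_mat (mat_W J) @
      concat (map code_mat (mats_B J)) @ concat (map code_mat (mats_T J))"
    by (rule code_vec_append_eq[OF _ conjunct2[OF a]])
      (simp add: carrier_vecD[OF wI(2)] carrier_vecD[OF wJ(2)])
  have A: "mat_A I = mat_A J \<and> code_mat (mat_W I) @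
      concat (map code_mat (mats_B I)) @ concat (map code_mat (mats_T I)) =
      code_mat (mat_W J) @ concat (map code_mat (mats_B J)) @ concat (map code_mat (mats_T J))"
    by (rule code_mat_append_eq[OF wI(3) wJ(3) conjunct2[OF b]])
  have W: "mat_W I = mat_W J \<and>
      concat (map code_mat (mats_B I)) @ concat (map code_mat (mats_T I)) =
      concat (map code_mat (mats_B J)) @ concat (map code_mat (mats_T J))"
    by (rule code_mat_append_eq[OF wI(4) wJ(4) conjunct2[OF A]])
  have B: "mats_B I = mats_B J \<and> concat (map code_mat (mats_T I)) = concat (map code_mat (mats_T J))"
    by (rule code_mats_append_eq[OF wI(5) wJ(5) _ conjunct2[OF W]]) (simp add: wI(6) wJ(6))
  have T: "mats_T I = mats_T J"
    by (rule code_mats_append_eq[OF wI(7) wJ(7), where r = "[]" and s = "[]", THEN conjunct1])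
      (simp_all add: wI(8) wJ(8) conjunct2[OF B])
  show "I = J"
    by (rule inst.equality, (rule dims[symmetric] conjunct1[OF a] conjunct1[OF b] conjunct1[OF A] conjunct1[OF W]
        conjunct1[OF B] T)+, simp)
qed

end

(* The point is that a feasible x can be chosen of polynomial size. A real feasible x satisfies a
   finite system of linear inequalities: the bounds and A x \<le> a; for every u \<in> U(x), the constraints
   T(u) x + W y \<le> 0 for a fixed response y; and for every other integer u in the box, the strict
   negation of a violated row of B(x) u \<le> b. Conversely every solution of the system is feasible.
   The system is exponentially long, but its coefficients have polynomial size, so by Cramer's rule
   at a vertex it has a solution of polynomial size.

   The words X and Y encode x and u, while Z provides y together with a preparsed form of the
   instance, scaled to integers. Thus the verifier does not parse the instance but computes its code
   from Z and compares. That this takes polynomial time follows from closure properties of the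
   functions computed by programs on stacks, which are compiled to multitape machines. *)

theory Submission
  imports Defs Jordan_Normal_Form.Determinant "HOL-Number_Theory.Cong"
begin

section \<open>Stack programs and their compilation to Turing machines\<close>

text \<open>The obstacle is that the set of second-stage vectors moves with x: replacing a real x by
  a rational one might admit a new u without any response. Only the strict inequalities prevent
  this, and since the set they cut out need not be closed, it is homogenised before Cramer's rule is
  applied. Both u and y range over finite boxes of integers, so one response per u can be frozen and
  the system stays finite and linear in x.

  On the machine side everything reduces to bounded recursion: recursion of polynomial unary depth
  stays in polynomial time once all intermediate results are polynomially long. The checks are
  arranged so that addition, multiplication and comparison suffice: a Bezout identity witnesses that
  a fraction is reduced, and a division is replaced by checking a product. Since the encoding is
  injective, certificates supplied for different u necessarily describe the same instance.\<close>

datatype com =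
    Push nat bool
  | Pop nat
  | Seq com com (infixr ";;" 60)
  | If nat com com
  | While nat com

type_synonym store = "nat \<Rightarrow> bool list"

text \<open>\<open>If\<close> tests whether the top of a stack is \<^term>\<open>True\<close>, and \<open>While\<close> whether the stack is
  nonempty. The third argument is the exact number of steps that the compiled program takes.\<close>

inductive exec :: "com \<Rightarrow> store \<Rightarrow> nat \<Rightarrow> store \<Rightarrow> bool" where
  Push: "exec (Push r b) s 2 (s(r := b # s r))"
| Pop: "exec (Pop r) s 1 (s(r := tl (s r)))"
| Seq: "exec c s t s' \<Longrightarrow> exec d s' u s'' \<Longrightarrow> exec (c ;; d) s (t + u) s''"
| IfT: "s r = True # w \<Longrightarrow> exec c s t s' \<Longrightarrow> exec (If r c d) s (t + 2) s'"
| IfF: "\<nexists>w. s r = True # w \<Longrightarrow> exec d s t s' \<Longrightarrow> exec (If r c d) s (t + 1) s'"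
| WhileF: "s r = [] \<Longrightarrow> exec (While r c) s 1 s"
| WhileT: "s r \<noteq> [] \<Longrightarrow> exec c s t s' \<Longrightarrow> exec (While r c) s' u s'' \<Longrightarrow>
    exec (While r c) s (t + u + 2) s''"

fun num_regs :: "com \<Rightarrow> nat" where
  "num_regs (Push r b) = Suc r"
| "num_regs (Pop r) = Suc r"
| "num_regs (c ;; d) = max (num_regs c) (num_regs d)"
| "num_regs (If r c d) = max (Suc r) (max (num_regs c) (num_regs d))"
| "num_regs (While r c) = max (Suc r) (num_regs c)"

text \<open>An instruction acts on a single tape: the symbol read determines the symbol written, the
  move and the next state. A stack occupies the cells from the head to the right, so that the
  input tape initially is the input word as a stack; the cells left of the head are arbitrary.\<close>

type_synonym instr = "nat \<times> (nat \<Rightarrow> nat \<times> head_move \<times> nat)"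

text \<open>Jump targets are absolute, so \<open>compile\<close> must know the lengths of
  subprograms in advance; unlike the code itself, they do not depend on its address.\<close>

fun code_len :: "com \<Rightarrow> nat" where
  "code_len (Push r b) = 2"
| "code_len (Pop r) = 1"
| "code_len (c ;; d) = code_len c + code_len d"
| "code_len (If r c d) = code_len c + code_len d + 2"
| "code_len (While r c) = code_len c + 2"

text \<open>A push takes two steps: the first rewrites the old top and moves left, the second fills
  the cell reached. Finished code falls through to address \<open>p + code_len c\<close>. The
  \<open>+ 2\<close> in the length of \<open>If\<close> and \<open>While\<close> is the test and the
  jump over the else branch or back to the test.\<close>

fun compile :: "nat \<Rightarrow> com \<Rightarrow> instr list" where
  "compile p (Push r b) =
     [(r, \<lambda>a. (a, Move_Left, p + 1)), (r, \<lambda>_. (if b then 2 else 1, Stay, p + 2))]"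
| "compile p (Pop r) = [(r, \<lambda>_. (0, Move_Right, p + 1))]"
| "compile p (c ;; d) = compile p c @ compile (p + code_len c) d"
| "compile p (If r c d) =
     (r, \<lambda>a. (a, Stay, if a = 2 then p + 1 else p + code_len c + 2)) # compile (p + 1) c @
     (r, \<lambda>a. (a, Stay, p + code_len c + code_len d + 2)) # compile (p + code_len c + 2) d"
| "compile p (While r c) =
     (r, \<lambda>a. (a, Stay, if a = 0 then p + code_len c + 2 else p + 1)) # compile (p + 1) c @
     [(r, \<lambda>a. (a, Stay, p))]"

lemma length_compile [simp]: "length (compile p c) = code_len c"
  by (induction c arbitrary: p) simp_all

lemma compile_wf:
  assumes "(r, \<delta>) \<in> set (compile p c)" "\<delta> a = (a', m, q)" "a < 3"
  shows "a' < 3 \<and> q \<le> p + code_len c \<and> r < num_regs c"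
  using assms by (induction c arbitrary: p) (force split: if_splits)+

section \<open>Simulation of stack programs by multitape machines\<close>

definition machine :: "instr list \<Rightarrow> nat \<Rightarrow> tm" where
  "machine is k = \<lparr>tm_tapes = k, tm_states = length is, tm_symbols = 3,
     tm_trans = \<lambda>q ss. case is ! q of (r, \<delta>) \<Rightarrow> case \<delta> (ss ! r) of (a, m, q') \<Rightarrow>
       (q', (map (\<lambda>a. (a, Stay)) ss)[r := (a, m)])\<rparr>"

lemma step_machine:
  assumes "q \<noteq> 1" "q \<noteq> 2" "is ! q = (r, \<delta>)" "length ts = k"
    "\<delta> (read_tape (ts ! r)) = (a, m, q')" "r < k"
  shows "tm_step (machine is k) (q, ts) = (q', ts[r := act_tape (ts ! r) (a, m)])"
proof -
  have "map2 act_tape ts ((map (\<lambda>a. (a, Stay)) (map read_tape ts))[r := (a, m)]) =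
      ts[r := act_tape (ts ! r) (a, m)]"
    by (rule nth_equalityI)
      (use assms in \<open>auto simp: nth_list_update act_tape_def read_tape_def\<close>)
  then show ?thesis using assms by (simp add: tm_step_def machine_def)
qed

definition holds_stack :: "tape \<Rightarrow> bool list \<Rightarrow> bool" where
  "holds_stack t w \<longleftrightarrow> (\<forall>i. fst t (snd t + int i) = (if i < length w then if w ! i then 2 else 1 else 0))"

definition holds_store :: "tape list \<Rightarrow> nat \<Rightarrow> store \<Rightarrow> bool" where
  "holds_store ts k s \<longleftrightarrow> length ts = k \<and> (\<forall>r<k. holds_stack (ts ! r) (s r))"

lemma holds_stack_read:
  assumes "holds_stack t w"
  shows "read_tape t = (case w of [] \<Rightarrow> 0 | b # _ \<Rightarrow> if b then 2 else 1)"
  using assms unfolding holds_stack_def read_tape_def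
  by (auto dest: spec[of _ 0] split: list.splits)

lemma holds_stack_stay: "holds_stack t w \<Longrightarrow> holds_stack (act_tape t (read_tape t, Stay)) w"
  by (simp add: holds_stack_def act_tape_def read_tape_def)

text \<open>The empty stack is included: only blanks lie to the right, so it stays empty, in
  agreement with \<open>tl [] = []\<close>. The symbol left behind is arbitrary because cells left
  of the head are never inspected as part of the stack.\<close>

lemma holds_stack_pop: "holds_stack t w \<Longrightarrow> holds_stack (act_tape t (a, Move_Right)) (tl w)"
  unfolding holds_stack_def act_tape_def
proof (intro allI)
  fix i
  assume "\<forall>i. fst t (snd t + int i) = (if i < length w then if w ! i then 2 else 1 else 0)"
  from spec[OF this, of "Suc i"]
  show "fst ((fst t)(snd t := fst (a, Move_Right)), move_head (snd (a, Move_Right)) (snd t))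
      (snd ((fst t)(snd t := fst (a, Move_Right)), move_head (snd (a, Move_Right)) (snd t)) + int i) =
      (if i < length (tl w) then if tl w ! i then 2 else 1 else 0)"
    by (auto simp: add.assoc nth_tl)
qed

lemma holds_stack_push:
  assumes "holds_stack t w"
  shows "holds_stack (act_tape (act_tape t (read_tape t, Move_Left)) (if b then 2 else 1, Stay)) (b # w)"
  unfolding holds_stack_def
proof
  fix i
  have "fst t (snd t + int j) = (if j < length w then if w ! j then 2 else 1 else 0)" for j
    using assms by (simp add: holds_stack_def)
  from this[of "i - 1"] show "fst (act_tape (act_tape t (read_tape t, Move_Left)) (if b then 2 else 1, Stay))
      (snd (act_tape (act_tape t (read_tape t, Move_Left)) (if b then 2 else 1, Stay)) + int i) =
      (if i < length (b # w) then if (b # w) ! i then 2 else 1 else 0)"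
    by (cases i) (auto simp: act_tape_def read_tape_def algebra_simps)
qed

lemma holds_store_update:
  "holds_store ts k s \<Longrightarrow> holds_stack t w \<Longrightarrow> holds_store (ts[r := t]) k (s(r := w))"
  by (auto simp: holds_store_def nth_list_update)

lemma holds_store_stay:
  "holds_store ts k s \<Longrightarrow> r < k \<Longrightarrow> holds_store (ts[r := act_tape (ts ! r) (read_tape (ts ! r), Stay)]) k s"
  by (auto simp: holds_store_def nth_list_update holds_stack_stay)

text \<open>The condition \<open>3 \<le> p\<close> keeps code away from the start state and from the
  halting states 1 and 2, in which \<open>tm_step\<close> does nothing.\<close>

definition code_at :: "instr list \<Rightarrow> nat \<Rightarrow> instr list \<Rightarrow> bool" where
  "code_at is p cs \<longleftrightarrow> 3 \<le> p \<and> (\<forall>i < length cs. is ! (p + i) = cs ! i)"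

lemma code_at_Cons: "code_at is p (x # cs) \<longleftrightarrow> 3 \<le> p \<and> is ! p = x \<and> code_at is (p + 1) cs"
  unfolding code_at_def by (auto simp: nth_Cons split: nat.splits)

lemma code_at_append:
  "code_at is p (cs @ ds) \<longleftrightarrow> code_at is p cs \<and> code_at is (p + length cs) ds"
proof
  assume *: "code_at is p (cs @ ds)"
  have "is ! (p + i) = (cs @ ds) ! i" if "i < length cs + length ds" for i
    using * that by (simp add: code_at_def)
  note this[of i for i] this[of "length cs + i" for i]
  then show "code_at is p cs \<and> code_at is (p + length cs) ds"
    using * by (simp add: code_at_def nth_append add.assoc)
next
  assume *: "code_at is p cs \<and> code_at is (p + length cs) ds"
  show "code_at is p (cs @ ds)" unfolding code_at_def
  proof (intro conjI allI impI)
    fix i assume i: "i < length (cs @ ds)"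
    show "is ! (p + i) = (cs @ ds) ! i"
    proof (cases "i < length cs")
      case False
      then show ?thesis using * i conjunct2[OF iffD1[OF code_at_def conjunct2[OF *]], rule_format, of "i - length cs"]
        by (simp add: nth_append add.assoc)
    qed (use * in \<open>simp add: code_at_def nth_append\<close>)
  qed (use * in \<open>simp add: code_at_def\<close>)
qed

text \<open>Exact step counts allow runs to be concatenated by adding exponents of
  \<open>tm_step\<close>. The induction is on the execution and not on the program, since a loop is
  executed again as the same program.\<close>

lemma compile_correct:
  assumes "exec c s t s'" "code_at is p (compile p c)" "num_regs c \<le> k" "holds_store ts k s"
  shows "\<exists>ts'. (tm_step (machine is k) ^^ t) (p, ts) = (p + code_len c, ts') \<and> holds_store ts' k s'"
  using assms
proof (induction arbitrary: p ts rule: exec.induct)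
  case (Push r b s)
  then have c: "3 \<le> p" "r < k" "length ts = k" "holds_stack (ts ! r) (s r)"
      "is ! p = (r, \<lambda>a. (a, Move_Left, p + 1))" "is ! (p + 1) = (r, \<lambda>_. (if b then 2 else 1, Stay, p + 2))"
    by (auto simp: code_at_Cons holds_store_def)
  let ?t = "act_tape (ts ! r) (read_tape (ts ! r), Move_Left)"
  have "(tm_step (machine is k) ^^ 2) (p, ts) =
      (p + 2, ts[r := act_tape ?t (if b then 2 else 1, Stay)])"
    using step_machine[of p "is" r _ ts k, OF _ _ c(5,3) refl c(2)] c
      step_machine[of "p + 1" "is" r _ "ts[r := ?t]" k, OF _ _ c(6) _ refl c(2)]
    by (simp add: numeral_2_eq_2)
  then show ?case
    using holds_store_update[OF Push(3) holds_stack_push[OF c(4), of b], of r]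
    by (simp del: fun_upd_apply)
next
  case (Pop r s)
  then have c: "3 \<le> p" "r < k" "length ts = k" "holds_stack (ts ! r) (s r)"
      "is ! p = (r, \<lambda>_. (0, Move_Right, p + 1))"
    by (auto simp: code_at_Cons holds_store_def)
  show ?case
    using step_machine[of p "is" r _ ts k, OF _ _ c(5,3) refl c(2)] c
      holds_store_update[OF Pop(3) holds_stack_pop[OF c(4), of 0], of r]
    by (simp del: fun_upd_apply)
next
  case (Seq c s t s' d u s'')
  have 1: "code_at is p (compile p c)" "num_regs c \<le> k"
    and 2: "code_at is (p + code_len c) (compile (p + code_len c) d)" "num_regs d \<le> k"
    using Seq.prems by (auto simp: code_at_append)
  obtain ts' where 3: "(tm_step (machine is k) ^^ t) (p, ts) = (p + code_len c, ts')" "holds_store ts' k s'"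
    using Seq.IH(1)[OF 1 Seq.prems(3)] by blast
  then show ?case using Seq.IH(2)[OF 2 3(2)]
    by (auto simp: funpow_add add.commute[of t] add.assoc)
next
  case (IfT s r w c t s' d)
  have c: "p \<noteq> 1" "p \<noteq> 2" "r < k" "length ts = k" "holds_stack (ts ! r) (s r)"
      "is ! p = (r, \<lambda>a. (a, Stay, if a = 2 then p + 1 else p + code_len c + 2))"
      "code_at is (p + 1) (compile (p + 1) c)" "num_regs c \<le> k"
      "is ! (p + 1 + code_len c) = (r, \<lambda>a. (a, Stay, p + code_len c + code_len d + 2))"
    using IfT.prems by (auto simp: code_at_Cons holds_store_def code_at_append)
  have r: "read_tape (ts ! r) = 2" using holds_stack_read[OF c(5)] IfT(1) by simp
  define ts1 where "ts1 = ts[r := act_tape (ts ! r) (read_tape (ts ! r), Stay)]"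
  have 1: "tm_step (machine is k) (p, ts) = (p + 1, ts1)" "holds_store ts1 k s"
    using step_machine[OF c(1,2,6,4) refl c(3)] r holds_store_stay[OF IfT.prems(3) c(3)]
    unfolding ts1_def by auto
  obtain ts2 where 2: "(tm_step (machine is k) ^^ t) (p + 1, ts1) = (p + 1 + code_len c, ts2)" "holds_store ts2 k s'"
    using IfT.IH[OF c(7,8) 1(2)] by blast
  have l: "length ts2 = k" using 2(2) by (simp add: holds_store_def)
  have 3: "tm_step (machine is k) (p + 1 + code_len c, ts2) =
     (p + code_len c + code_len d + 2, ts2[r := act_tape (ts2 ! r) (read_tape (ts2 ! r), Stay)])"
    by (rule step_machine[OF _ _ c(9) l _ c(3)]) (use IfT.prems in \<open>auto simp: code_at_def\<close>)
  have "(tm_step (machine is k) ^^ (t + 2)) (p, ts) = 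
     (p + code_len c + code_len d + 2, ts2[r := act_tape (ts2 ! r) (read_tape (ts2 ! r), Stay)])"
    using 1(1) 2(1) 3 by (simp add: funpow_swap1 numeral_2_eq_2)
  then show ?case using holds_store_stay[OF 2(2) c(3)] by (auto simp: algebra_simps)
next
  case (IfF s r d t s' c)
  have c: "p \<noteq> 1" "p \<noteq> 2" "r < k" "length ts = k" "holds_stack (ts ! r) (s r)"
      "is ! p = (r, \<lambda>a. (a, Stay, if a = 2 then p + 1 else p + code_len c + 2))"
      "code_at is (p + code_len c + 2) (compile (p + code_len c + 2) d)" "num_regs d \<le> k"
    using IfF.prems by (auto simp: code_at_Cons holds_store_def code_at_append)
  have r: "read_tape (ts ! r) \<noteq> 2"
    using holds_stack_read[OF c(5)] IfF(1) by (auto split: list.splits)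
  define ts1 where "ts1 = ts[r := act_tape (ts ! r) (read_tape (ts ! r), Stay)]"
  have 1: "tm_step (machine is k) (p, ts) = (p + code_len c + 2, ts1)" "holds_store ts1 k s"
    using step_machine[OF c(1,2,6,4) refl c(3)] r holds_store_stay[OF IfF.prems(3) c(3)]
    unfolding ts1_def by auto
  show ?case using IfF.IH[OF c(7,8) 1(2)] 1(1) by (auto simp: funpow_swap1 algebra_simps)
next
  case (WhileF s r c)
  have c: "p \<noteq> 1" "p \<noteq> 2" "r < k" "length ts = k" "holds_stack (ts ! r) (s r)"
      "is ! p = (r, \<lambda>a. (a, Stay, if a = 0 then p + code_len c + 2 else p + 1))"
    using WhileF.prems by (auto simp: code_at_Cons holds_store_def code_at_append)
  have r: "read_tape (ts ! r) = 0"
    using holds_stack_read[OF c(5)] WhileF(1) by simp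
  show ?case
    using step_machine[OF c(1,2,6,4) refl c(3)] r holds_store_stay[OF WhileF.prems(3) c(3)] by auto
next
  case (WhileT s r c t s' u s'')
  have c: "p \<noteq> 1" "p \<noteq> 2" "r < k" "length ts = k" "holds_stack (ts ! r) (s r)"
      "is ! p = (r, \<lambda>a. (a, Stay, if a = 0 then p + code_len c + 2 else p + 1))"
      "code_at is (p + 1) (compile (p + 1) c)" "num_regs c \<le> k"
      "is ! (p + 1 + code_len c) = (r, \<lambda>a. (a, Stay, p))"
    using WhileT.prems by (auto simp: code_at_Cons holds_store_def code_at_append)
  have r: "read_tape (ts ! r) \<noteq> 0"
    using holds_stack_read[OF c(5)] WhileT(1) by (auto split: list.splits)
  define ts1 where "ts1 = ts[r := act_tape (ts ! r) (read_tape (ts ! r), Stay)]"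
  have 1: "tm_step (machine is k) (p, ts) = (p + 1, ts1)" "holds_store ts1 k s"
    using step_machine[OF c(1,2,6,4) refl c(3)] r holds_store_stay[OF WhileT.prems(3) c(3)]
    unfolding ts1_def by auto
  obtain ts2 where 2: "(tm_step (machine is k) ^^ t) (p + 1, ts1) = (p + 1 + code_len c, ts2)" "holds_store ts2 k s'"
    using WhileT.IH(1)[OF c(7,8) 1(2)] by blast
  have l: "length ts2 = k" using 2(2) by (simp add: holds_store_def)
  define ts3 where "ts3 = ts2[r := act_tape (ts2 ! r) (read_tape (ts2 ! r), Stay)]"
  have 3: "tm_step (machine is k) (p + 1 + code_len c, ts2) = (p, ts3)" unfolding ts3_def
    by (rule step_machine[OF _ _ c(9) l _ c(3)]) (use WhileT.prems in \<open>auto simp: code_at_def\<close>)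
  have 4: "holds_store ts3 k s'" unfolding ts3_def by (rule holds_store_stay[OF 2(2) c(3)])
  obtain ts4 where 5: "(tm_step (machine is k) ^^ u) (p, ts3) = (p + code_len (While r c), ts4)" "holds_store ts4 k s''"
    using WhileT.IH(2)[OF WhileT.prems(1,2) 4] by blast
  have "(tm_step (machine is k) ^^ (u + Suc (t + Suc 0))) (p, ts) = (p + code_len (While r c), ts4)"
    using 1(1) 2(1) 3 5(1) by (simp only: funpow_add funpow.simps o_apply id_apply)
  then show ?case using 5(2) by (auto simp: add.commute add.left_commute)
qed

text \<open>The three leading instructions fill the addresses of the reserved states; only the first
  is ever executed and enters the program at address 3. The last one turns the top symbol of
  register 0 into acceptance or rejection.\<close>

definition run_program :: "com \<Rightarrow> instr list" where
  "run_program c = replicate 3 (0, \<lambda>a. (a, Stay, 3)) @ compile 3 c @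
     [(0, \<lambda>a. (a, Stay, if a = 2 then 1 else 2))]"

lemma wf_run_program:
  assumes "1 \<le> k" "num_regs c \<le> k"
  shows "wf_tm (machine (run_program c) k)"
  unfolding wf_tm_def
proof (intro conjI allI impI)
  fix q ss assume q: "q < tm_states (machine (run_program c) k)"
    and ss: "length ss = tm_tapes (machine (run_program c) k) \<and>
      set ss \<subseteq> {..<tm_symbols (machine (run_program c) k)}"
  obtain r \<delta> where i: "run_program c ! q = (r, \<delta>)" by fastforce
  obtain a m q' where d: "\<delta> (ss ! r) = (a, m, q')" using prod_cases3 by blast
  have mem: "(r, \<delta>) \<in> set (run_program c)"
    using q i nth_mem[of q "run_program c"] by (simp add: machine_def del: nth_mem)
  have r: "r < k"
    using mem assms compile_wf[of r \<delta> 3 c 0] prod_cases3[of "\<delta> 0" thesis for thesis]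
    unfolding run_program_def by (cases "\<delta> 0") fastforce
  have s: "ss ! r < 3" using ss r nth_mem[of r ss] by (auto simp: machine_def simp del: nth_mem)
  have *: "a < 3 \<and> q' < length (run_program c)"
    using mem compile_wf[of r \<delta> 3 c, OF _ d s] s d by (auto simp: run_program_def split: if_splits)
  have "fst ` set ((map (\<lambda>a. (a, Stay)) ss)[r := (a, m)]) \<subseteq> {..<3}"
    using set_update_subset_insert[of "map (\<lambda>a. (a, Stay)) ss" r "(a, m)"] * ss
    by (fastforce simp: machine_def)
  then show "fst (tm_trans (machine (run_program c) k) q ss) < tm_states (machine (run_program c) k)"
    "length (snd (tm_trans (machine (run_program c) k) q ss)) = tm_tapes (machine (run_program c) k)"
    "fst ` set (snd (tm_trans (machine (run_program c) k) q ss)) \<subseteq> {..<tm_symbols (machine (run_program c) k)}"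
    using * i d ss by (auto simp: machine_def)
qed (use assms in \<open>auto simp: machine_def run_program_def\<close>)

text \<open>The two additional steps are the jump out of the start state and the final test.\<close>

lemma run_program_correct:
  assumes "exec c ((\<lambda>_. [])(0 := w)) t s" "num_regs c \<le> k" "1 \<le> k"
  shows "fst ((tm_step (machine (run_program c) k) ^^ (t + 2)) (tm_init (machine (run_program c) k) w)) =
    (if \<exists>v. s 0 = True # v then 1 else 2)"
proof -
  let ?M = "machine (run_program c) k"
  define ts where "ts = snd (tm_init ?M w)"
  have init: "tm_init ?M w = (0, ts)" by (simp add: ts_def tm_init_def)
  have "holds_stack (input_tape w) w" "holds_stack blank_tape []"
    by (auto simp: holds_stack_def input_tape_def blank_tape_def)
  then have h: "holds_store ts k ((\<lambda>_. [])(0 := w))" using assms(3)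
    unfolding holds_store_def ts_def tm_init_def by (auto simp: nth_Cons machine_def split: nat.splits)
  then have len: "length ts = k" by (simp add: holds_store_def)
  have i0: "run_program c ! 0 = (0, \<lambda>a. (a, Stay, 3))" by (simp add: run_program_def nth_append)
  define ts1 where "ts1 = ts[0 := act_tape (ts ! 0) (read_tape (ts ! 0), Stay)]"
  have 1: "tm_step ?M (0, ts) = (3, ts1)" unfolding ts1_def
    by (rule step_machine[OF _ _ i0 len]) (use assms(3) in auto)
  have h1: "holds_store ts1 k ((\<lambda>_. [])(0 := w))" unfolding ts1_def
    by (rule holds_store_stay[OF h]) (use assms(3) in auto)
  have "code_at (run_program c) 3 (compile 3 c)"
    by (auto simp: code_at_def run_program_def nth_append)
  then obtain ts2 where 2: "(tm_step ?M ^^ t) (3, ts1) = (3 + code_len c, ts2)" "holds_store ts2 k s"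
    using compile_correct[OF assms(1) _ assms(2) h1] by blast
  have i2: "run_program c ! (3 + code_len c) = (0, \<lambda>a. (a, Stay, if a = 2 then 1 else 2))"
    by (simp add: run_program_def nth_append)
  have r: "read_tape (ts2 ! 0) = 2 \<longleftrightarrow> (\<exists>v. s 0 = True # v)"
    using 2(2) assms(3) holds_stack_read[of "ts2 ! 0" "s 0"]
    by (auto simp: holds_store_def split: list.splits)
  have "\<exists>ts3. tm_step ?M (3 + code_len c, ts2) = (if \<exists>v. s 0 = True # v then 1 else 2, ts3)"
    using step_machine[OF _ _ i2 _ refl, of ts2 k] 2(2) assms(3) r by (auto simp: holds_store_def)
  then obtain ts3 where 3: "tm_step ?M (3 + code_len c, ts2) = (if \<exists>v. s 0 = True # v then 1 else 2, ts3)" ..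
  have "(tm_step ?M ^^ (Suc (t + Suc 0))) (0, ts) = (if \<exists>v. s 0 = True # v then 1 else 2, ts3)"
    using 1 2(1) 3 by (simp only: funpow_add funpow.simps o_apply id_apply)
  then show ?thesis using init by simp
qed

section \<open>Polynomial-time functions on words\<close>

definition poly_bounded :: "(nat \<Rightarrow> nat) \<Rightarrow> bool" where
  "poly_bounded T \<longleftrightarrow> (\<exists>p :: nat poly. \<forall>n. T n \<le> poly p n)"

named_theorems pb_intros

lemma poly_bounded_poly [pb_intros]: "poly_bounded (poly p)"
  by (auto simp: poly_bounded_def)

lemma poly_bounded_const [pb_intros]: "poly_bounded (\<lambda>_. c)"
  unfolding poly_bounded_def by (rule exI[of _ "[:c:]"]) simp

lemma poly_bounded_id [pb_intros]: "poly_bounded (\<lambda>n. n)"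
  unfolding poly_bounded_def by (rule exI[of _ "[:0, 1:]"]) simp

lemma poly_bounded_add [pb_intros]:
  assumes "poly_bounded f" "poly_bounded g"
  shows "poly_bounded (\<lambda>n. f n + g n)"
proof -
  obtain p q where "\<And>n. f n \<le> poly p n" "\<And>n. g n \<le> poly q n"
    using assms by (auto simp: poly_bounded_def)
  then show ?thesis unfolding poly_bounded_def
    by (intro exI[of _ "p + q"]) (simp add: add_mono)
qed

lemma poly_bounded_mult [pb_intros]:
  assumes "poly_bounded f" "poly_bounded g"
  shows "poly_bounded (\<lambda>n. f n * g n)"
proof -
  obtain p q where "\<And>n. f n \<le> poly p n" "\<And>n. g n \<le> poly q n"
    using assms by (auto simp: poly_bounded_def)
  then show ?thesis unfolding poly_bounded_def
    by (intro exI[of _ "p * q"]) (simp add: mult_mono)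
qed

lemma poly_bounded_poly_comp [pb_intros]:
  fixes p :: "nat poly"
  assumes "poly_bounded f"
  shows "poly_bounded (\<lambda>n. poly p (f n))"
  by (induction p) (auto intro!: pb_intros assms)

text \<open>Natural coefficients make polynomials monotone, so a length bound may be substituted
  into a time bound.\<close>

lemma poly_mono_nat: "m \<le> n \<Longrightarrow> poly (p :: nat poly) m \<le> poly p n"
  by (induction p) (auto intro!: mult_mono)

section \<open>Upper time bounds and elementary register operations\<close>

definition runs :: "com \<Rightarrow> store \<Rightarrow> nat \<Rightarrow> store \<Rightarrow> bool" where
  "runs c s T s' \<longleftrightarrow> (\<exists>t\<le>T. exec c s t s')"

lemma runs_mono: "runs c s T s' \<Longrightarrow> T \<le> U \<Longrightarrow> runs c s U s'"
  unfolding runs_def using le_trans by blast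

lemma runs_cong: "runs c s T s1 \<Longrightarrow> s1 = s' \<Longrightarrow> T \<le> U \<Longrightarrow> runs c s U s'"
  using runs_mono by blast

lemma runs_Push: "s' = s(r := b # s r) \<Longrightarrow> runs (Push r b) s 2 s'"
  unfolding runs_def using exec.Push by blast

lemma runs_Pop: "s' = s(r := tl (s r)) \<Longrightarrow> runs (Pop r) s 1 s'"
  unfolding runs_def using exec.Pop by blast

lemma runs_Seq: "runs c s T s' \<Longrightarrow> runs d s' U s'' \<Longrightarrow> runs (c ;; d) s (T + U) s''"
  unfolding runs_def using exec.Seq add_mono by blast

lemma runs_IfT: "s r = True # w \<Longrightarrow> runs c s T s' \<Longrightarrow> runs (If r c d) s (T + 2) s'"
  unfolding runs_def by (meson add_le_mono1 exec.IfT)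

lemma runs_IfF: "\<nexists>w. s r = True # w \<Longrightarrow> runs d s T s' \<Longrightarrow> runs (If r c d) s (T + 1) s'"
  unfolding runs_def by (meson add_le_mono1 exec.IfF)

lemma runs_WhileF: "s r = [] \<Longrightarrow> s' = s \<Longrightarrow> runs (While r c) s 1 s'"
  unfolding runs_def using exec.WhileF by blast

lemma runs_WhileT:
  assumes "s r \<noteq> []" "runs c s T s'" "runs (While r c) s' U s''"
  shows "runs (While r c) s (T + U + 2) s''"
proof -
  obtain t u where "t \<le> T" "u \<le> U" "exec c s t s'" "exec (While r c) s' u s''"
    using assms(2,3) unfolding runs_def by blast
  with exec.WhileT[of s r, OF assms(1)] show ?thesis unfolding runs_def
    by (intro exI[of _ "t + u + 2"]) auto
qed

text \<open>Time bounds space: a push is the only growth and adds one symbol. This is where all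
  length bounds for polynomial-time functions come from.\<close>

lemma exec_length: "exec c s t s' \<Longrightarrow> length (s' r) \<le> length (s r) + t"
  by (induction rule: exec.induct) auto

text \<open>A stack can be read only by popping it, so a transfer reverses the word; a second
  transfer restores it.\<close>

definition move :: "nat \<Rightarrow> nat \<Rightarrow> com" where
  "move a b = While a (If a (Pop a ;; Push b True) (Pop a ;; Push b False))"

lemma runs_move:
  assumes "a \<noteq> b" "s' = s(a := [], b := rev (s a) @ s b)"
  shows "runs (move a b) s (7 * length (s a) + 1) s'"
proof -
  have "runs (move a b) s (7 * length w + 1) (s(a := [], b := rev w @ s b))" if "s a = w" for w
    using that
  proof (induction w arbitrary: s)
    case Nil
    then show ?case unfolding move_def by (auto intro!: runs_mono[OF runs_WhileF])
  next
    case (Cons x w)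
    let ?s = "s(a := w, b := x # s b)"
    have "runs (Pop a ;; Push b x) s (1 + 2) ?s"
      by (rule runs_Seq, rule runs_Pop, rule refl, rule runs_Push)
        (use assms(1) Cons.prems in auto)
    then have *: "runs (If a (Pop a ;; Push b True) (Pop a ;; Push b False)) s 5 ?s"
      using Cons.prems by (cases x) (auto intro: runs_mono[OF runs_IfT] runs_mono[OF runs_IfF])
    show ?case unfolding move_def
      by (rule runs_cong[OF runs_WhileT[OF _ * Cons.IH[of ?s, unfolded move_def]]]) (use Cons.prems assms(1) in \<open>auto simp: fun_eq_iff\<close>)
  qed
  then show ?thesis using assms(2) by simp
qed

definition copy :: "nat \<Rightarrow> nat \<Rightarrow> nat \<Rightarrow> com" where
  "copy a b c = While a (If a (Pop a ;; Push b True ;; Push c True) (Pop a ;; Push b False ;; Push c False))"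

lemma runs_copy:
  assumes "a \<noteq> b" "a \<noteq> c" "b \<noteq> c" "s' = s(a := [], b := rev (s a) @ s b, c := rev (s a) @ s c)"
  shows "runs (copy a b c) s (9 * length (s a) + 1) s'"
proof -
  have "runs (copy a b c) s (9 * length w + 1) (s(a := [], b := rev w @ s b, c := rev w @ s c))"
    if "s a = w" for w
    using that
  proof (induction w arbitrary: s)
    case Nil
    then show ?case unfolding copy_def by (auto intro!: runs_mono[OF runs_WhileF])
  next
    case (Cons x w)
    let ?s = "s(a := w, b := x # s b, c := x # s c)"
    have "runs (Pop a ;; Push b x ;; Push c x) s (1 + (2 + 2)) ?s"
      by (rule runs_Seq, rule runs_Pop, rule refl, rule runs_Seq, rule runs_Push, rule refl, rule runs_Push)
        (use assms(1-3) Cons.prems in auto)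
    then have *: "runs (If a (Pop a ;; Push b True ;; Push c True) (Pop a ;; Push b False ;; Push c False)) s 7 ?s"
      using Cons.prems by (cases x) (auto intro: runs_mono[OF runs_IfT] runs_mono[OF runs_IfF])
    show ?case unfolding copy_def
      by (rule runs_cong[OF runs_WhileT[OF _ * Cons.IH[of ?s, unfolded copy_def]]]) (use Cons.prems assms(1-3) in \<open>auto simp: fun_eq_iff\<close>)
  qed
  then show ?thesis using assms(4) by simp
qed

definition clear :: "nat \<Rightarrow> com" where
  "clear a = While a (Pop a)"

lemma runs_clear:
  assumes "s' = s(a := [])"
  shows "runs (clear a) s (3 * length (s a) + 1) s'"
proof -
  have "runs (clear a) s (3 * length w + 1) (s(a := []))" if "s a = w" for w
    using that
  proof (induction w arbitrary: s)
    case Nil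
    then show ?case unfolding clear_def by (auto intro!: runs_mono[OF runs_WhileF])
  next
    case (Cons x w)
    have *: "runs (Pop a) s 1 (s(a := w))" by (rule runs_Pop) (use Cons.prems in auto)
    show ?case unfolding clear_def
      by (rule runs_cong[OF runs_WhileT[OF _ * Cons.IH[of "s(a := w)", unfolded clear_def]]]) (use Cons.prems in \<open>auto simp: fun_eq_iff\<close>)
  qed
  then show ?thesis using assms by simp
qed

subsection \<open>Relocatable programs\<close>

text \<open>The calling convention: registers below \<open>n\<close> belong to the caller and are
  preserved, while those above \<open>n\<close> are scratch space, received and returned empty. This
  makes programs composable without renaming registers.\<close>

definition computes :: "(nat \<Rightarrow> com) \<Rightarrow> (nat \<Rightarrow> nat) \<Rightarrow> (bool list \<Rightarrow> bool list) \<Rightarrow> bool" where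
  "computes c T f \<longleftrightarrow> (\<forall>n s. (\<forall>m>n. s m = []) \<longrightarrow> runs (c n) s (T (length (s n))) (s(n := f (s n))))"

definition FP :: "(bool list \<Rightarrow> bool list) \<Rightarrow> bool" where
  "FP f \<longleftrightarrow> (\<exists>c p. computes c (poly p) f)"

lemma FPI: "poly_bounded T \<Longrightarrow> computes c T f \<Longrightarrow> FP f"
  unfolding FP_def computes_def poly_bounded_def by (meson runs_mono)

lemma computesD:
  "computes c T f \<Longrightarrow> (\<And>m. m > n \<Longrightarrow> s m = []) \<Longrightarrow> s n = x \<Longrightarrow> s' = s(n := f x) \<Longrightarrow>
    runs (c n) s (T (length x)) s'"
  unfolding computes_def by (drule spec[of _ n], drule spec[of _ s]) simp

lemma computes_length:
  assumes "computes c T f"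
  shows "length (f x) \<le> length x + T (length x)"
proof -
  have "runs (c 0) ((\<lambda>_. [])(0 := x)) (T (length x)) ((\<lambda>_. [])(0 := f x))"
    by (rule computesD[OF assms]) auto
  then obtain t where t: "t \<le> T (length x)" "exec (c 0) ((\<lambda>_. [])(0 := x)) t ((\<lambda>_. [])(0 := f x))"
    unfolding runs_def by blast
  from exec_length[OF this(2), of 0] t(1) show ?thesis by simp
qed

lemma FP_length:
  assumes "FP f"
  obtains p :: "nat poly" where "\<And>x. length (f x) \<le> poly p (length x)"
proof -
  obtain c p where "computes c (poly p) f" using assms by (auto simp: FP_def)
  from computes_length[OF this] show ?thesis by (intro that[of "[:0, 1:] + p"]) simp
qed

lemma FP_comp:
  assumes "FP f" "FP g"
  shows "FP (\<lambda>x. f (g x))"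
proof -
  obtain c p d q r where c: "computes c (poly p) f" and d: "computes d (poly q) g"
    and r: "\<And>x. length (g x) \<le> poly r (length x)"
    using assms FP_length[OF assms(2)] unfolding FP_def by metis
  show ?thesis
  proof (rule FPI)
    show "computes (\<lambda>n. d n ;; c n) (\<lambda>l. poly q l + poly p (poly r l)) (\<lambda>x. f (g x))"
      unfolding computes_def
    proof (intro allI impI)
      fix n and s :: store assume s: "\<forall>m>n. s m = []"
      show "runs (d n ;; c n) s (poly q (length (s n)) + poly p (poly r (length (s n)))) (s(n := f (g (s n))))"
        by (rule runs_mono[OF runs_Seq[OF computesD[OF d _ refl refl] computesD[OF c _ refl]]])
          (use s poly_mono_nat[OF r] in auto)
    qed
  qed (intro pb_intros)
qed

text \<open>From \<open>x\<close> in register \<open>n\<close>, compute \<open>g x\<close> in register \<open>n + 1\<close> and \<open>k x\<close> in register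
  \<open>n + 2\<close>.\<close>

definition prep :: "(nat \<Rightarrow> com) \<Rightarrow> (nat \<Rightarrow> com) \<Rightarrow> nat \<Rightarrow> com" where
  "prep c d n = move n (n + 2) ;; copy (n + 2) n (n + 1) ;; c (n + 1) ;; move n (n + 3) ;;
     move (n + 3) (n + 2) ;; d (n + 2)"

lemma runs_prep:
  assumes c: "computes c T g" and d: "computes d U k"
    and s: "\<And>m. m > n \<Longrightarrow> s m = []" "s n = x" "s' = s(n := [], n + 1 := g x, n + 2 := k x)"
  shows "runs (prep c d n) s (30 * length x + 5 + T (length x) + U (length x)) s'"
proof -
  have e: "s (n + 1) = []" "s (n + 2) = []" "s (n + 3) = []"
    "\<And>m. m > n \<Longrightarrow> s m = []" using s(1) by simp_all
  note [simp] = e(1-3)[simplified]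
  have 1: "runs (move n (n + 2)) s (7 * length x + 1) (s(n := [], n + 2 := rev x))"
    using runs_move[of n "n + 2" "s(n := [], n + 2 := rev x)" s] s(2) by simp
  have 2: "runs (copy (n + 2) n (n + 1)) (s(n := [], n + 2 := rev x)) (9 * length x + 1)
      (s(n := x, n + 1 := x))"
    using runs_copy[of "n + 2" n "n + 1" "s(n := x, n + 1 := x)" "s(n := [], n + 2 := rev x)"]
    by (simp add: fun_eq_iff)
  have 3: "runs (c (n + 1)) (s(n := x, n + 1 := x)) (T (length x)) (s(n := x, n + 1 := g x))"
    by (rule computesD[OF c]) (auto simp: e(4))
  have 4: "runs (move n (n + 3)) (s(n := x, n + 1 := g x)) (7 * length x + 1)
      (s(n := [], n + 1 := g x, n + 3 := rev x))"
    using runs_move[of n "n + 3" "s(n := [], n + 1 := g x, n + 3 := rev x)" "s(n := x, n + 1 := g x)"]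
    by (simp add: fun_eq_iff)
  have 5: "runs (move (n + 3) (n + 2)) (s(n := [], n + 1 := g x, n + 3 := rev x)) (7 * length x + 1)
      (s(n := [], n + 1 := g x, n + 2 := x))"
    using runs_move[of "n + 3" "n + 2" "s(n := [], n + 1 := g x, n + 2 := x)"
      "s(n := [], n + 1 := g x, n + 3 := rev x)"]
    by (simp add: fun_eq_iff)
  have 6: "runs (d (n + 2)) (s(n := [], n + 1 := g x, n + 2 := x)) (U (length x)) s'"
    by (rule computesD[OF d]) (auto simp: e(4) s(3))
  show ?thesis unfolding prep_def
    by (rule runs_mono[OF runs_Seq[OF 1 runs_Seq[OF 2 runs_Seq[OF 3 runs_Seq[OF 4 runs_Seq[OF 5 6]]]]]]) simp
qed

definition finish :: "nat \<Rightarrow> com" where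
  "finish n = move (n + 2) (n + 1) ;; move (n + 1) n"

lemma runs_finish:
  assumes "s (n + 1) = []" "s n = []" "s' = s(n := s (n + 2), n + 2 := [])"
  shows "runs (finish n) s (14 * length (s (n + 2)) + 2) s'"
proof -
  have 1: "runs (move (n + 2) (n + 1)) s (7 * length (s (n + 2)) + 1)
      (s(n + 2 := [], n + 1 := rev (s (n + 2))))"
    by (rule runs_move) (use assms in simp_all)
  have 2: "runs (move (n + 1) n) (s(n + 2 := [], n + 1 := rev (s (n + 2)))) (7 * length (s (n + 2)) + 1) s'"
    by (rule runs_mono[OF runs_move]) (use assms in \<open>auto simp: fun_eq_iff\<close>)
  show ?thesis unfolding finish_def by (rule runs_mono[OF runs_Seq[OF 1 2]]) simp
qed

text \<open>The language has no empty program, so a push is undone at once.\<close>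

lemma FP_id: "FP (\<lambda>x. x)"
proof (rule FPI)
  have "runs (Push n True ;; Pop n) s (2 + 1) s" for n s
    by (rule runs_Seq, rule runs_Push, rule refl, rule runs_Pop) simp
  then show "computes (\<lambda>n. Push n True ;; Pop n) (\<lambda>_. 3) (\<lambda>x. x)"
    by (simp add: computes_def)
qed (intro pb_intros)

lemma FP_Cons: assumes "FP f" shows "FP (\<lambda>x. b # f x)"
proof -
  have "FP (\<lambda>x. b # x)"
  proof (rule FPI)
    show "computes (\<lambda>n. Push n b) (\<lambda>_. 2) (\<lambda>x. b # x)"
      by (auto simp: computes_def intro: runs_Push)
  qed (intro pb_intros)
  from FP_comp[OF this assms] show ?thesis .
qed

lemma FP_tl: assumes "FP f" shows "FP (\<lambda>x. tl (f x))"
proof -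
  have "FP tl"
  proof (rule FPI)
    show "computes Pop (\<lambda>_. 1) tl" unfolding computes_def by (blast intro: runs_Pop)
  qed (intro pb_intros)
  from FP_comp[OF this assms] show ?thesis .
qed

lemma FP_const: "FP (\<lambda>_. w)"
proof (induction w)
  case Nil
  show ?case
  proof (rule FPI)
    show "computes clear (\<lambda>l. 3 * l + 1) (\<lambda>_. [])" by (auto simp: computes_def intro!: runs_mono[OF runs_clear])
  qed (intro pb_intros)
qed (rule FP_Cons)

section \<open>Pairs of words\<close>

definition pr :: "bool list \<Rightarrow> bool list \<Rightarrow> bool list" where
  "pr x y = code_word x @ y"

text \<open>On words that are not pairs, the values of \<open>fs\<close> and \<open>sn\<close> are
  simply what \<open>split_pair\<close> produces: a lone trailing \<open>True\<close> announces a
  bit, and the empty stack then reads as \<open>False\<close>.\<close>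

fun fs :: "bool list \<Rightarrow> bool list" where
  "fs (True # b # w) = b # fs w"
| "fs [True] = [False]"
| "fs (False # w) = []"
| "fs [] = []"

fun sn :: "bool list \<Rightarrow> bool list" where
  "sn (True # b # w) = sn w"
| "sn [True] = []"
| "sn (False # w) = w"
| "sn [] = []"

lemma fs_pr [simp]: "fs (pr x y) = x"
  by (induction x) (simp_all add: pr_def code_word_simps)

lemma sn_pr [simp]: "sn (pr x y) = y"
  by (induction x) (simp_all add: pr_def code_word_simps)

lemma length_pr [simp]: "length (pr x y) = 2 * length x + 1 + length y"
  by (induction x) (simp_all add: pr_def code_word_simps)

lemma length_fs: "length (fs x) \<le> length x"
  by (induction x rule: fs.induct) simp_all

lemma length_sn: "length (sn x) \<le> length x"
  by (induction x rule: sn.induct) simp_all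

text \<open>Register \<open>n + 1\<close> is a loop flag, removed when the end marker or the end of
  the word is reached. The first component accumulates in reverse in register \<open>n + 2\<close>,
  and the rest remains in \<open>n\<close>.\<close>

definition split_pair :: "nat \<Rightarrow> com" where
  "split_pair n = While (n + 1) (If n
     (Pop n ;; If n (Pop n ;; Push (n + 2) True) (Pop n ;; Push (n + 2) False))
     (Pop n ;; Pop (n + 1)))"

lemma runs_split_pair:
  assumes "s n = x" "s (n + 1) = [True]" "s' = s(n := sn x, n + 1 := [], n + 2 := rev (fs x) @ s (n + 2))"
  shows "runs (split_pair n) s (10 * length x + 10) s'"
proof -
  let ?body = "If n (Pop n ;; If n (Pop n ;; Push (n + 2) True) (Pop n ;; Push (n + 2) False))
     (Pop n ;; Pop (n + 1))"
  have stop: "runs (split_pair n) s 10 (s(n := tl x, n + 1 := []))"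
    if "s n = x" "s (n + 1) = [True]" "\<nexists>w. x = True # w" for s x
  proof -
    have "runs (Pop n ;; Pop (n + 1)) s (1 + 1) (s(n := tl x, n + 1 := []))"
      by (rule runs_Seq, rule runs_Pop, rule refl, rule runs_Pop) (use that in auto)
    then have *: "runs ?body s (1 + 1 + 1) (s(n := tl x, n + 1 := []))"
      by (intro runs_IfF) (use that in auto)
    show ?thesis unfolding split_pair_def
      by (rule runs_cong[OF runs_WhileT[of s "n + 1", OF _ * runs_WhileF[OF _ refl]]]) (use that(2) in \<open>auto simp: fun_eq_iff\<close>)
  qed
  have step: "runs ?body s 8 (s(n := w, n + 2 := b # s (n + 2)))"
    if "s n = True # v" "s (n + 1) = [True]" "v = b # w \<or> v = [] \<and> b = False \<and> w = []" for s b v w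
  proof -
    have "runs (Pop n ;; Push (n + 2) b) (s(n := v)) (1 + 2) (s(n := w, n + 2 := b # s (n + 2)))"
      by (rule runs_Seq, rule runs_Pop, rule refl, rule runs_Push) (use that in auto)
    then have "runs (If n (Pop n ;; Push (n + 2) True) (Pop n ;; Push (n + 2) False)) (s(n := v)) 5
      (s(n := w, n + 2 := b # s (n + 2)))"
      using that by (cases b) (auto intro: runs_mono[OF runs_IfT] runs_mono[OF runs_IfF])
    then have "runs (Pop n ;; If n (Pop n ;; Push (n + 2) True) (Pop n ;; Push (n + 2) False)) s 6
      (s(n := w, n + 2 := b # s (n + 2)))"
      by (intro runs_cong[OF runs_Seq[OF runs_Pop[OF refl]]]) (use that(1) in auto)
    from runs_IfT[of s n, OF that(1) this] show ?thesis by simp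
  qed
  have "runs (split_pair n) s (10 * length x + 10)
      (s(n := sn x, n + 1 := [], n + 2 := rev (fs x) @ s (n + 2)))"
    if "s n = x" "s (n + 1) = [True]" for s
    using that
  proof (induction x arbitrary: s rule: fs.induct)
    case (1 b w)
    let ?s = "s(n := w, n + 2 := b # s (n + 2))"
    have *: "runs (split_pair n) ?s (10 * length w + 10) (s(n := sn w, n + 1 := [], n + 2 := rev (fs w) @ b # s (n + 2)))"
      by (rule runs_cong[OF 1(1)[of ?s]]) (use 1(2-) in \<open>auto simp: fun_eq_iff\<close>)
    show ?case unfolding split_pair_def
      by (rule runs_cong[OF runs_WhileT[OF _ step[OF 1(2,3)] *[unfolded split_pair_def]]]) (use 1(2-) in \<open>auto simp: fun_eq_iff\<close>)
  next
    case 2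
    let ?s = "s(n := [], n + 2 := False # s (n + 2))"
    have *: "runs (split_pair n) ?s 10 (s(n := [], n + 1 := [], n + 2 := False # s (n + 2)))"
      by (rule runs_cong[OF stop[of ?s "[]"]]) (use 2 in \<open>auto simp: fun_eq_iff\<close>)
    show ?case unfolding split_pair_def
      by (rule runs_cong[OF runs_WhileT[OF _ step[OF 2] *[unfolded split_pair_def]]]) (use 2 in \<open>auto simp: fun_eq_iff\<close>)
  next
    case (3 w)
    show ?case by (rule runs_cong[OF stop[OF 3]]) (auto simp: fun_eq_iff 3)
  next
    case 4
    show ?case by (rule runs_cong[OF stop[OF 4]]) (auto simp: fun_eq_iff 4)
  qed
  then show ?thesis using assms by blast
qed

lemma FP_fs: assumes "FP f" shows "FP (\<lambda>x. fs (f x))"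
proof -
  have "FP fs"
  proof (rule FPI)
    show "computes (\<lambda>n. Push (n + 1) True ;; split_pair n ;; clear n ;; move (n + 2) n)
        (\<lambda>l. 20 * l + 14) fs" unfolding computes_def
    proof (intro allI impI)
      fix n and s :: store assume "\<forall>m>n. s m = []"
      then have s: "s (n + 1) = []" "s (n + 2) = []" by simp_all
      let ?x = "s n"
      have 1: "runs (Push (n + 1) True) s 2 (s(n + 1 := [True]))"
        by (rule runs_Push) (use s in simp)
      have 2: "runs (split_pair n) (s(n + 1 := [True])) (10 * length ?x + 10) (s(n := sn ?x, n + 2 := rev (fs ?x)))"
        by (rule runs_split_pair) (use s in \<open>auto simp: fun_eq_iff\<close>)
      have 3: "runs (clear n) (s(n := sn ?x, n + 2 := rev (fs ?x))) (3 * length ?x + 1) (s(n := [], n + 2 := rev (fs ?x)))"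
        by (rule runs_mono[OF runs_clear]) (use length_sn[of ?x] in \<open>auto simp: fun_eq_iff\<close>)
      have 4: "runs (move (n + 2) n) (s(n := [], n + 2 := rev (fs ?x))) (7 * length ?x + 1) (s(n := fs ?x))"
        by (rule runs_mono[OF runs_move]) (use length_fs[of ?x] s in \<open>auto simp: fun_eq_iff\<close>)
      show "runs (Push (n + 1) True ;; split_pair n ;; clear n ;; move (n + 2) n) s (20 * length (s n) + 14) (s(n := fs (s n)))"
        by (rule runs_mono[OF runs_Seq[OF 1 runs_Seq[OF 2 runs_Seq[OF 3 4]]]]) simp
    qed
  qed (intro pb_intros)
  from FP_comp[OF this assms] show ?thesis .
qed

lemma FP_sn: assumes "FP f" shows "FP (\<lambda>x. sn (f x))"
proof -
  have "FP sn"
  proof (rule FPI)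
    show "computes (\<lambda>n. Push (n + 1) True ;; split_pair n ;; clear (n + 2))
        (\<lambda>l. 20 * l + 14) sn" unfolding computes_def
    proof (intro allI impI)
      fix n and s :: store assume "\<forall>m>n. s m = []"
      then have s: "s (n + 1) = []" "s (n + 2) = []" by simp_all
      let ?x = "s n"
      have 1: "runs (Push (n + 1) True) s 2 (s(n + 1 := [True]))"
        by (rule runs_Push) (use s in simp)
      have 2: "runs (split_pair n) (s(n + 1 := [True])) (10 * length ?x + 10) (s(n := sn ?x, n + 2 := rev (fs ?x)))"
        by (rule runs_split_pair) (use s in \<open>auto simp: fun_eq_iff\<close>)
      have 3: "runs (clear (n + 2)) (s(n := sn ?x, n + 2 := rev (fs ?x))) (3 * length ?x + 1) (s(n := sn ?x))"
        by (rule runs_mono[OF runs_clear]) (use length_fs[of ?x] s in \<open>auto simp: fun_eq_iff\<close>)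
      show "runs (Push (n + 1) True ;; split_pair n ;; clear (n + 2)) s (20 * length (s n) + 14) (s(n := sn (s n)))"
        by (rule runs_mono[OF runs_Seq[OF 1 runs_Seq[OF 2 3]]]) simp
    qed
  qed (intro pb_intros)
  from FP_comp[OF this assms] show ?thesis .
qed

definition encode :: "nat \<Rightarrow> nat \<Rightarrow> com" where
  "encode a b = While a (If a (Pop a ;; Push b True ;; Push b True) (Pop a ;; Push b False ;; Push b True))"

lemma runs_encode:
  assumes "a \<noteq> b" "s' = s(a := [], b := concat (map (\<lambda>b. [True, b]) (rev (s a))) @ s b)"
  shows "runs (encode a b) s (9 * length (s a) + 1) s'"
proof -
  have "runs (encode a b) s (9 * length w + 1) (s(a := [], b := concat (map (\<lambda>b. [True, b]) (rev w)) @ s b))"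
    if "s a = w" for w
    using that
  proof (induction w arbitrary: s)
    case Nil
    then show ?case unfolding encode_def by (auto intro!: runs_mono[OF runs_WhileF])
  next
    case (Cons x w)
    let ?s = "s(a := w, b := True # x # s b)"
    have "runs (Pop a ;; Push b x ;; Push b True) s (1 + (2 + 2)) ?s"
      by (rule runs_Seq, rule runs_Pop, rule refl, rule runs_Seq, rule runs_Push, rule refl, rule runs_Push)
        (use assms(1) Cons.prems in auto)
    then have *: "runs (If a (Pop a ;; Push b True ;; Push b True) (Pop a ;; Push b False ;; Push b True)) s 7 ?s"
      using Cons.prems by (cases x) (auto intro: runs_mono[OF runs_IfT] runs_mono[OF runs_IfF])
    show ?case unfolding encode_def
      by (rule runs_cong[OF runs_WhileT[OF _ * Cons.IH[of ?s, unfolded encode_def]]]) (use Cons.prems assms(1) in \<open>auto simp: fun_eq_iff\<close>)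
  qed
  then show ?thesis using assms(2) by simp
qed

lemma FP_pr:
  assumes "FP f" "FP g"
  shows "FP (\<lambda>x. pr (f x) (g x))"
proof -
  obtain c p c' p' where c: "computes c (poly p) f" and c': "computes c' (poly p') g"
    using assms unfolding FP_def by metis
  obtain q q' where q: "\<And>x. length (f x) \<le> poly q (length x)" and q': "\<And>x. length (g x) \<le> poly q' (length x)"
    using FP_length[OF assms(1)] FP_length[OF assms(2)] by metis
  \<comment> \<open>The second component is placed in register \<open>n + 1\<close> first, because
    the code of the first component is pushed on top of it. The move reverses \<open>f x\<close>,
    and \<open>encode\<close> reverses it back.\<close>
  let ?c = "\<lambda>n. prep c' c n ;; move (n + 2) n ;; Push (n + 1) False ;; encode n (n + 1) ;;
      move (n + 1) (n + 2) ;; move (n + 2) n"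
  let ?T = "\<lambda>l. 30 * l + 5 + poly p' l + poly p l + (7 * poly q l + 1) + 2 + (9 * poly q l + 1) +
    14 * (2 * poly q l + 1 + poly q' l) + 2"
  show ?thesis
  proof (rule FPI)
    show "computes ?c ?T (\<lambda>x. pr (f x) (g x))" unfolding computes_def
    proof (intro allI impI)
      fix n and s :: store assume e: "\<forall>m>n. s m = []"
      then have s: "s (Suc n) = []" "s (Suc (Suc n)) = []" by simp_all
      define x where "x = s n"
      let ?w = "concat (map (\<lambda>b. [True, b]) (f x)) @ False # g x"
      have 1: "runs (prep c' c n) s (30 * length x + 5 + poly p' (length x) + poly p (length x)) (s(n := [], n + 1 := g x, n + 2 := f x))"
        by (rule runs_prep[OF c' c]) (use e in \<open>auto simp: x_def\<close>)
      have 2: "runs (move (n + 2) n) (s(n := [], n + 1 := g x, n + 2 := f x)) (7 * length (f x) + 1) (s(n := rev (f x), n + 1 := g x))"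
        by (rule runs_mono[OF runs_move]) (use s in \<open>auto simp: fun_eq_iff\<close>)
      have 3: "runs (Push (n + 1) False) (s(n := rev (f x), n + 1 := g x)) 2 (s(n := rev (f x), n + 1 := False # g x))"
        by (rule runs_Push) auto
      have 4: "runs (encode n (n + 1)) (s(n := rev (f x), n + 1 := False # g x)) (9 * length (f x) + 1) (s(n := [], n + 1 := ?w))"
        by (rule runs_mono[OF runs_encode]) (auto simp: fun_eq_iff)
      have w: "?w = pr (f x) (g x)" by (simp add: pr_def code_word_def)
      have 5: "runs (move (n + 1) (n + 2)) (s(n := [], n + 1 := ?w)) (7 * length (pr (f x) (g x)) + 1) (s(n := [], n + 2 := rev ?w))"
        unfolding w by (rule runs_mono[OF runs_move]) (use s in \<open>auto simp: fun_eq_iff\<close>)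
      have 6: "runs (move (n + 2) n) (s(n := [], n + 2 := rev ?w)) (7 * length (pr (f x) (g x)) + 1) (s(n := pr (f x) (g x)))"
        unfolding w by (rule runs_mono[OF runs_move]) (use s in \<open>auto simp: fun_eq_iff\<close>)
      show "runs (?c n) s (?T (length (s n))) (s(n := pr (f (s n)) (g (s n))))"
        unfolding x_def[symmetric]
        by (rule runs_mono[OF runs_Seq[OF 1 runs_Seq[OF 2 runs_Seq[OF 3 runs_Seq[OF 4 runs_Seq[OF 5 6]]]]]])
          (use q[of x] q'[of x] in simp)
    qed
  qed (intro pb_intros)
qed

subsection \<open>Conditionals and iteration\<close>

definition starts_True :: "bool list \<Rightarrow> bool" where
  "starts_True w \<longleftrightarrow> (\<exists>v. w = True # v)"

lemma FP_if_starts_True: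
  assumes "FP c" "FP f" "FP g"
  shows "FP (\<lambda>x. if starts_True (c x) then f x else g x)"
proof -
  obtain d p df pf dg pg di p0 where d: "computes d (poly p) c" and df: "computes df (poly pf) f"
    and dg: "computes dg (poly pg) g" and di: "computes di (poly p0) (\<lambda>x. x)"
    using assms FP_id unfolding FP_def by metis
  obtain q qf qg where q: "\<And>x. length (c x) \<le> poly q (length x)" and qf: "\<And>x. length (f x) \<le> poly qf (length x)"
      and qg: "\<And>x. length (g x) \<le> poly qg (length x)"
    using FP_length[OF assms(1)] FP_length[OF assms(2)] FP_length[OF assms(3)] by metis
  let ?c = "\<lambda>n. prep d di n ;; If (n + 1) (df (n + 2)) (dg (n + 2)) ;; clear (n + 1) ;; finish n"
  let ?T = "\<lambda>l. 30 * l + 5 + poly p l + poly p0 l + (poly pf l + poly pg l + 2) + (3 * poly q l + 1) +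
    (14 * (poly qf l + poly qg l) + 2)"
  let ?h = "\<lambda>x. if starts_True (c x) then f x else g x"
  show ?thesis
  proof (rule FPI)
    show "computes ?c ?T ?h" unfolding computes_def
    proof (intro allI impI)
      fix n and s :: store assume e: "\<forall>m>n. s m = []"
      then have s: "s (Suc n) = []" "s (Suc (Suc n)) = []" by simp_all
      define x where "x = s n"
      let ?l = "length x"
      have 1: "runs (prep d di n) s (30 * ?l + 5 + poly p ?l + poly p0 ?l) (s(n := [], n + 1 := c x, n + 2 := x))"
        by (rule runs_prep[OF d di]) (use e in \<open>auto simp: x_def\<close>)
      have f: "runs (df (n + 2)) (s(n := [], n + 1 := c x, n + 2 := x)) (poly pf ?l) (s(n := [], n + 1 := c x, n + 2 := f x))"
        by (rule computesD[OF df]) (use e in auto)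
      have g: "runs (dg (n + 2)) (s(n := [], n + 1 := c x, n + 2 := x)) (poly pg ?l) (s(n := [], n + 1 := c x, n + 2 := g x))"
        by (rule computesD[OF dg]) (use e in auto)
      have 2: "runs (If (n + 1) (df (n + 2)) (dg (n + 2))) (s(n := [], n + 1 := c x, n + 2 := x)) (poly pf ?l + poly pg ?l + 2)
         (s(n := [], n + 1 := c x, n + 2 := ?h x))"
      proof (cases "starts_True (c x)")
        case True
        then obtain v where "c x = True # v" by (auto simp: starts_True_def)
        then show ?thesis
          by (intro runs_cong[OF runs_IfT[where w = v, OF _ f]]) (use True in auto)
      next
        case False
        then show ?thesis
          by (intro runs_cong[OF runs_IfF[OF _ g]]) (auto simp: starts_True_def)
      qed
      have 3: "runs (clear (n + 1)) (s(n := [], n + 1 := c x, n + 2 := ?h x)) (3 * length (c x) + 1) (s(n := [], n + 2 := ?h x))"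
        by (rule runs_mono[OF runs_clear]) (use s in \<open>auto simp: fun_eq_iff\<close>)
      have 4: "runs (finish n) (s(n := [], n + 2 := ?h x)) (14 * (poly qf ?l + poly qg ?l) + 2) (s(n := ?h x))"
        by (rule runs_mono[OF runs_finish]) (use s qf[of x] qg[of x] in \<open>auto simp: fun_eq_iff\<close>)
      show "runs (?c n) s (?T (length (s n))) (s(n := ?h (s n)))" unfolding x_def[symmetric]
        by (rule runs_mono[OF runs_Seq[OF 1 runs_Seq[OF 2 runs_Seq[OF 3 4]]]]) (use q[of x] in simp)
    qed
  qed (intro pb_intros)
qed

text \<open>The bound \<open>B\<close> on all intermediate results is essential: iterating a
  polynomial-time function such as doubling of a word could otherwise produce exponentially long
  words.\<close>

lemma FP_iterate:
  fixes B :: "nat poly"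
  assumes "FP h" "FP g" "FP k"
    and B: "\<And>x i. i \<le> length (g x) \<Longrightarrow> length ((h ^^ i) (k x)) \<le> poly B (length x)"
  shows "FP (\<lambda>x. (h ^^ length (g x)) (k x))"
proof -
  obtain d p dg pg dk pk where d: "computes d (poly p) h" and dg: "computes dg (poly pg) g"
    and dk: "computes dk (poly pk) k"
    using assms unfolding FP_def by metis
  obtain q where q: "\<And>x. length (g x) \<le> poly q (length x)" using FP_length[OF assms(2)] by metis
  let ?loop = "\<lambda>n. While (n + 1) (Pop (n + 1) ;; d (n + 2))"
  let ?c = "\<lambda>n. prep dg dk n ;; ?loop n ;; finish n"
  let ?T = "\<lambda>l. 30 * l + 5 + poly pg l + poly pk l + (poly q l * (poly p (poly B l) + 3) + 1) + (14 * poly B l + 2)"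
  have loop: "runs (?loop n) s (length w * (poly p b + 3) + 1) (s(n + 1 := [], n + 2 := (h ^^ length w) z))"
    if "\<forall>m>n+2. s m = []" "s (n + 1) = w" "s (n + 2) = z" "\<And>i. i \<le> length w \<Longrightarrow> length ((h ^^ i) z) \<le> b" for s n w z b
    using that
  proof (induction w arbitrary: s z)
    case Nil
    then show ?case by (intro runs_cong[OF runs_WhileF[OF _ refl]]) (auto simp: fun_eq_iff)
  next
    case (Cons a w)
    let ?s = "s(n + 1 := w, n + 2 := h z)"
    have 1: "runs (Pop (n + 1)) s 1 (s(n + 1 := w))" by (rule runs_Pop) (use Cons.prems in auto)
    have 2: "runs (d (n + 2)) (s(n + 1 := w)) (poly p (length z)) ?s"
      by (rule computesD[OF d]) (use Cons.prems in auto)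
    have "length z \<le> b" using Cons.prems(4)[of 0] by simp
    then have 3: "runs (Pop (n + 1) ;; d (n + 2)) s (1 + poly p b) ?s"
      using poly_mono_nat[of "length z" b p] by (intro runs_mono[OF runs_Seq[OF 1 2]]) simp
    have 4: "runs (?loop n) ?s (length w * (poly p b + 3) + 1) (?s(n + 1 := [], n + 2 := (h ^^ length w) (h z)))"
    proof (rule Cons.IH)
      fix i assume "i \<le> length w"
      then show "length ((h ^^ i) (h z)) \<le> b" using Cons.prems(4)[of "Suc i"] by (simp add: funpow_swap1)
    qed (use Cons.prems in auto)
    show ?case
      by (rule runs_cong[OF runs_WhileT[OF _ 3 4]]) (use Cons.prems in \<open>auto simp: fun_eq_iff funpow_swap1\<close>)
  qed
  let ?h = "\<lambda>x. (h ^^ length (g x)) (k x)"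
  show ?thesis
  proof (rule FPI)
    show "computes ?c ?T ?h" unfolding computes_def
    proof (intro allI impI)
      fix n and s :: store assume e: "\<forall>m>n. s m = []"
      then have s: "s (Suc n) = []" "s (Suc (Suc n)) = []" by simp_all
      define x where "x = s n"
      let ?l = "length x"
      have 1: "runs (prep dg dk n) s (30 * ?l + 5 + poly pg ?l + poly pk ?l) (s(n := [], n + 1 := g x, n + 2 := k x))"
        by (rule runs_prep[OF dg dk]) (use e in \<open>auto simp: x_def\<close>)
      have 2: "runs (?loop n) (s(n := [], n + 1 := g x, n + 2 := k x)) (length (g x) * (poly p (poly B ?l) + 3) + 1)
          ((s(n := [], n + 1 := g x, n + 2 := k x))(n + 1 := [], n + 2 := ?h x))"
        by (rule loop) (use e B in auto)
      have 3: "runs (finish n) ((s(n := [], n + 1 := g x, n + 2 := k x))(n + 1 := [], n + 2 := ?h x)) (14 * length (?h x) + 2) (s(n := ?h x))"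
        by (rule runs_mono[OF runs_finish]) (use s in \<open>auto simp: fun_eq_iff\<close>)
      show "runs (?c n) s (?T (length (s n))) (s(n := ?h (s n)))" unfolding x_def[symmetric]
        by (rule runs_mono[OF runs_Seq[OF 1 runs_Seq[OF 2 3]]])
          (use q[of x] B[OF order_refl, of x] in \<open>simp add: add_mono mult_right_mono\<close>)
    qed
  qed (intro pb_intros)
qed

lemma ptime_if_FP:
  assumes "FP f"
  shows "{w. starts_True (f w)} \<in> ptime"
proof -
  obtain c p where c: "computes c (poly p) f" using assms by (auto simp: FP_def)
  define k where "k = max 1 (num_regs (c 0))"
  let ?M = "machine (run_program (c 0)) k"
  have "tm_decides_within ?M {w. starts_True (f w)} (poly (p + [:2:]))"
    unfolding tm_decides_within_def
  proof
    fix w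
    have "runs (c 0) ((\<lambda>_. [])(0 := w)) (poly p (length w)) ((\<lambda>_. [])(0 := f w))"
      by (rule computesD[OF c]) auto
    then obtain t where t: "t \<le> poly p (length w)" "exec (c 0) ((\<lambda>_. [])(0 := w)) t ((\<lambda>_. [])(0 := f w))"
      unfolding runs_def by blast
    have "fst ((tm_step ?M ^^ (t + 2)) (tm_init ?M w)) = (if starts_True (f w) then 1 else 2)"
      using run_program_correct[OF t(2), of k] by (simp add: k_def starts_True_def)
    then show "\<exists>t\<le>poly (p + [:2:]) (length w). fst ((tm_step ?M ^^ t) (tm_init ?M w)) =
        (if w \<in> {w. starts_True (f w)} then 1 else 2)"
      using t(1) by (intro exI[of _ "t + 2"]) simp
  qed
  moreover have "wf_tm ?M" by (rule wf_run_program) (simp_all add: k_def)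
  ultimately show ?thesis unfolding ptime_def by blast
qed

subsection \<open>Recursion over unary numbers\<close>

abbreviation un :: "nat \<Rightarrow> bool list" where
  "un n \<equiv> replicate n True"

text \<open>In the rules for sums, quantifiers and the like below, the body may depend on the argument \<open>x\<close>
  and on the index \<open>i\<close>; it is required to be a polynomial-time function of \<^term>\<open>pr x (un i)\<close>.\<close>

definition FU :: "(bool list \<Rightarrow> nat) \<Rightarrow> bool" where
  "FU m \<longleftrightarrow> FP (\<lambda>x. un (m x))"

definition FB :: "(bool list \<Rightarrow> bool) \<Rightarrow> bool" where
  "FB P \<longleftrightarrow> FP (\<lambda>x. [P x])"

named_theorems fp_intros

declare FP_id [fp_intros] FP_const [fp_intros] FP_Cons [fp_intros] FP_tl [fp_intros]
  FP_fs [fp_intros] FP_sn [fp_intros] FP_pr [fp_intros]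

text \<open>A binary operation is treated once, as a function of the pair, and then substituted
  into. This matters for recursions, whose parameters must be recoverable from a single
  word.\<close>

lemma FP2:
  assumes "FP (\<lambda>w. F (fs w) (sn w))" "FP f" "FP g"
  shows "FP (\<lambda>x. F (f x) (g x))"
  using FP_comp[OF assms(1) FP_pr[OF assms(2,3)]] by simp

lemma FB_comp: "FB m \<Longrightarrow> FP g \<Longrightarrow> FB (\<lambda>x. m (g x))"
  unfolding FB_def by (rule FP_comp)

lemma FB2:
  assumes "FB (\<lambda>w. F (fs w) (sn w))" "FP f" "FP g"
  shows "FB (\<lambda>x. F (f x) (g x))"
  using FB_comp[OF assms(1) FP_pr[OF assms(2,3)]] by simp

lemma FP_un [fp_intros]: "FU m \<Longrightarrow> FP (\<lambda>x. un (m x))"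
  by (simp add: FU_def)

lemma FU_length [fp_intros]:
  assumes "FP f" shows "FU (\<lambda>x. length (f x))"
proof -
  obtain p where p: "\<And>x. length (f x) \<le> poly p (length x)" using FP_length[OF assms] by blast
  have e: "((\<lambda>x. True # x) ^^ n) [] = un n" for n by (induction n) simp_all
  have "FP (\<lambda>x. ((\<lambda>x. True # x) ^^ length (f x)) [])"
  proof (rule FP_iterate[where B = p])
    fix x i assume "i \<le> length (f x)"
    then show "length (((\<lambda>x. True # x) ^^ i) []) \<le> poly p (length x)"
      using p[of x] unfolding e by simp
  qed (intro fp_intros assms)+
  then show ?thesis unfolding FU_def e .
qed

lemma FU_const [fp_intros]: "FU (\<lambda>_. n)"
  unfolding FU_def by (rule FP_const)

lemma FU_bound:
  assumes "FU m"
  obtains p :: "nat poly" where "\<And>x. m x \<le> poly p (length x)"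
  using FP_length[OF assms[unfolded FU_def]] by (metis length_replicate)

text \<open>Bounded recursion by iteration on triples of the argument, the counter in unary and the
  current value. The argument and the counter are carried along so that the step can consult
  them.\<close>

lemma FP_rec:
  assumes h: "FP (\<lambda>w. h (fs w) (length (fs (sn w))) (sn (sn w)))" and "FP k" and m: "FU m"
    and T: "poly_bounded T" "\<And>x i. i \<le> m x \<Longrightarrow> length (rec_nat (k x) (h x) i) \<le> T (length x)"
  shows "FP (\<lambda>x. rec_nat (k x) (h x) (m x))"
proof -
  define H where "H w = pr (fs w) (pr (True # fs (sn w)) (h (fs w) (length (fs (sn w))) (sn (sn w))))" for w
  define K where "K x = pr x (pr [] (k x))" for x
  have HK: "FP H" "FP K" unfolding H_def K_def by (intro fp_intros assms)+
  have inv: "(H ^^ i) (K x) = pr x (pr (un i) (rec_nat (k x) (h x) i))" for x i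
    by (induction i) (simp_all add: H_def K_def)
  obtain p where p: "\<And>x. m x \<le> poly p (length x)" using FU_bound[OF m] by blast
  obtain q where q: "\<And>l. T l \<le> poly q l" using T(1) by (auto simp: poly_bounded_def)
  have "FP (\<lambda>x. (H ^^ length (un (m x))) (K x))"
  \<comment> \<open>A state \<open>pr x (pr (un i) v)\<close> has length
    \<open>2 * length x + 2 * i + length v + 2\<close>.\<close>
  proof (rule FP_iterate[where B = "[:2, 2:] + 2 * p + q"])
    fix x i assume "i \<le> length (un (m x))"
    then show "length ((H ^^ i) (K x)) \<le> poly ([:2, 2:] + 2 * p + q) (length x)"
      using T(2)[of i x] p[of x] q[of "length x"] by (simp add: inv)
  qed (intro HK fp_intros m)+
  then have "FP (\<lambda>x. sn (sn ((H ^^ length (un (m x))) (K x))))" by (intro fp_intros)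
  then show ?thesis unfolding inv by simp
qed

text \<open>As the index is at most \<open>m x\<close>, the pair of argument and index has length
  polynomial in that of the argument; hence one bound serves all values of the body.\<close>

lemma FP_binder_length:
  assumes f: "FP (\<lambda>w. f (fs w) (length (sn w)))" and m: "FU m"
  obtains T where "poly_bounded T" "\<And>x i. i \<le> m x \<Longrightarrow> length (f x i) \<le> T (length x)"
proof -
  obtain p where p: "\<And>x. m x \<le> poly p (length x)" using FU_bound[OF m] by blast
  obtain q where q: "\<And>x. length (f (fs x) (length (sn x))) \<le> poly q (length x)" using FP_length[OF f] by metis
  show ?thesis
  proof
    fix x i assume "i \<le> m x"
    then have "poly q (length (pr x (un i))) \<le> poly q (2 * length x + 1 + poly p (length x))"
      using p[of x] by (intro poly_mono_nat) simp
    then show "length (f x i) \<le> poly q (2 * length x + 1 + poly p (length x))"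
      using q[of "pr x (un i)"] by simp
  qed (intro pb_intros)
qed

text \<open>Access is total: past the end of a tuple the empty word is read, which denotes the
  number 0.\<close>

definition item :: "bool list \<Rightarrow> nat \<Rightarrow> bool list" where
  "item w i = fs ((sn ^^ i) w)"

lemma FP_item [fp_intros]:
  assumes "FP f" "FU i" shows "FP (\<lambda>x. item (f x) (i x))"
proof -
  obtain p where p: "\<And>x. length (f x) \<le> poly p (length x)" using FP_length[OF assms(1)] by blast
  have e: "rec_nat w (\<lambda>_. sn) n = (sn ^^ n) w" for w n by (induction n) simp_all
  have "length ((sn ^^ n) w) \<le> length w" for w n
    by (induction n) (auto intro: le_trans[OF length_sn])
  then have "FP (\<lambda>x. rec_nat (f x) (\<lambda>_. sn) (i x))"
    by (intro FP_rec[where T = "poly p"] fp_intros pb_intros assms) (unfold e, meson le_trans p)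
  then show ?thesis unfolding item_def e by (intro fp_intros)
qed

lemma FP_drop [fp_intros]:
  assumes "FP f" "FU i" shows "FP (\<lambda>x. drop (i x) (f x))"
proof -
  obtain p where p: "\<And>x. length (f x) \<le> poly p (length x)" using FP_length[OF assms(1)] by blast
  have e: "rec_nat w (\<lambda>_. tl) n = drop n w" for w :: "bool list" and n
    by (induction n) (simp_all add: drop_Suc tl_drop)
  have "FP (\<lambda>x. rec_nat (f x) (\<lambda>_. tl) (i x))"
    by (intro FP_rec[where T = "poly p"] fp_intros pb_intros assms)
      (auto simp: e intro: le_trans[OF diff_le_self p])
  then show ?thesis unfolding e .
qed

subsection \<open>Predicates\<close>

lemma FB_starts_True [fp_intros]:
  assumes "FP f" shows "FB (\<lambda>x. starts_True (f x))"
proof -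
  have "FP (\<lambda>x. if starts_True (f x) then [True] else [False])"
    by (intro FP_if_starts_True assms fp_intros)
  also have "(\<lambda>x. if starts_True (f x) then [True] else [False]) = (\<lambda>x. [starts_True (f x)])" by auto
  finally show ?thesis unfolding FB_def .
qed

lemma FP_if [fp_intros]:
  assumes "FB P" "FP f" "FP g"
  shows "FP (\<lambda>x. if P x then f x else g x)"
  using FP_if_starts_True[OF assms(1)[unfolded FB_def] assms(2,3)] by (simp add: starts_True_def)

lemma FB_if:
  assumes "FB P" "FB f" "FB g"
  shows "FB (\<lambda>x. if P x then f x else g x)"
proof -
  have "(if P x then [f x] else [g x]) = [if P x then f x else g x]" for x by simp
  then show ?thesis using FP_if[OF assms(1) assms(2,3)[unfolded FB_def]] unfolding FB_def by simp
qed

lemma FP_bit: "FB P \<Longrightarrow> FP (\<lambda>x. [P x])"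
  by (simp add: FB_def)

lemma FP_Cons_bit [fp_intros]:
  assumes "FB P" "FP f" shows "FP (\<lambda>x. P x # f x)"
proof -
  have "FP (\<lambda>x. if P x then True # f x else False # f x)" by (intro fp_intros assms)
  also have "(\<lambda>x. if P x then True # f x else False # f x) = (\<lambda>x. P x # f x)" by auto
  finally show ?thesis .
qed

lemma FB_const [fp_intros]: "FB (\<lambda>_. b)"
  unfolding FB_def by (rule FP_const)

lemma FB_not [fp_intros]: "FB P \<Longrightarrow> FB (\<lambda>x. \<not> P x)"
proof -
  assume "FB P"
  then have "FB (\<lambda>x. if P x then False else True)" by (intro FB_if FB_const)
  also have "(\<lambda>x. if P x then False else True) = (\<lambda>x. \<not> P x)" by auto
  finally show ?thesis .
qed

lemma FB_conj [fp_intros]: "FB P \<Longrightarrow> FB Q \<Longrightarrow> FB (\<lambda>x. P x \<and> Q x)"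
proof -
  assume "FB P" "FB Q"
  then have "FB (\<lambda>x. if P x then Q x else False)" by (intro FB_if FB_const)
  also have "(\<lambda>x. if P x then Q x else False) = (\<lambda>x. P x \<and> Q x)" by auto
  finally show ?thesis .
qed

lemma FB_disj [fp_intros]: "FB P \<Longrightarrow> FB Q \<Longrightarrow> FB (\<lambda>x. P x \<or> Q x)"
  using FB_not[OF FB_conj[OF FB_not FB_not], of P Q] by simp

lemma FB_imp [fp_intros]: "FB P \<Longrightarrow> FB Q \<Longrightarrow> FB (\<lambda>x. P x \<longrightarrow> Q x)"
proof -
  assume "FB P" "FB Q"
  then have "FB (\<lambda>x. if P x then Q x else True)" by (intro FB_if FB_const)
  also have "(\<lambda>x. if P x then Q x else True) = (\<lambda>x. P x \<longrightarrow> Q x)" by auto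
  finally show ?thesis .
qed

lemma FB_iff [fp_intros]: "FB P \<Longrightarrow> FB Q \<Longrightarrow> FB (\<lambda>x. P x = Q x)"
proof -
  assume "FB P" "FB Q"
  then have "FB (\<lambda>x. if P x then Q x else \<not> Q x)" by (intro FB_if FB_not)
  also have "(\<lambda>x. if P x then Q x else \<not> Q x) = (\<lambda>x. P x = Q x)" by auto
  finally show ?thesis .
qed

lemma FB_rec:
  assumes h: "FB (\<lambda>w. h (fs w) (length (fs (sn w))) (starts_True (sn (sn w))))"
    and k: "FB k" and m: "FU m"
  shows "FB (\<lambda>x. rec_nat (k x) (h x) (m x))"
proof -
  have e: "rec_nat [k x] (\<lambda>i s. [h x i (starts_True s)]) n = [rec_nat (k x) (h x) n]" for x n
    by (induction n) (simp_all add: starts_True_def)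
  have "FP (\<lambda>x. rec_nat [k x] (\<lambda>i s. [h x i (starts_True s)]) (m x))"
    by (rule FP_rec[where T = "\<lambda>_. 1"]) (use assms in \<open>auto simp: FB_def e intro: pb_intros\<close>)
  then show ?thesis unfolding e FB_def .
qed

lemma FB_ball [fp_intros]:
  assumes P: "FB (\<lambda>w. P (fs w) (length (sn w)))" and m: "FU m"
  shows "FB (\<lambda>x. \<forall>i<m x. P x i)"
proof -
  have e: "rec_nat True (\<lambda>i b. b \<and> P x i) n \<longleftrightarrow> (\<forall>i<n. P x i)" for x n
    by (induction n) (auto simp: less_Suc_eq)
  \<comment> \<open>A recursion step sees argument, index and state; forgetting the state yields the
    pair to which the hypothesis on \<open>P\<close> applies.\<close>
  have "FB (\<lambda>w. P (fs (pr (fs w) (fs (sn w)))) (length (sn (pr (fs w) (fs (sn w))))))"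
    by (rule FB_comp[OF P]) (intro fp_intros)
  then have "FB (\<lambda>x. rec_nat True (\<lambda>i b. b \<and> P x i) (m x))"
    by (intro FB_rec m fp_intros) simp
  then show ?thesis unfolding e .
qed

text \<open>Reading \<open>False\<close> past the end amounts to implicit leading zeros, so numbers
  of different lengths need no alignment.\<close>

definition bit_at :: "bool list \<Rightarrow> nat \<Rightarrow> bool" where
  "bit_at w i \<longleftrightarrow> i < length w \<and> w ! i"

lemma bit_at_simps [simp]: "bit_at [] i = False" "bit_at (b # w) 0 = b"
    "bit_at (b # w) (Suc i) = bit_at w i"
  by (auto simp: bit_at_def)

lemma starts_True_drop: "starts_True (drop i w) = bit_at w i"
  unfolding starts_True_def bit_at_def
  by (cases "i < length w") (simp_all add: Cons_nth_drop_Suc[symmetric])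

lemma FB_bit_at [fp_intros]: "FP f \<Longrightarrow> FU i \<Longrightarrow> FB (\<lambda>x. bit_at (f x) (i x))"
  using FB_starts_True[OF FP_drop] unfolding starts_True_drop .

lemma FB_less_length [fp_intros]:
  assumes "FP f" "FU i" shows "FB (\<lambda>x. i x < length (f x))"
proof -
  have "FB (\<lambda>x. bit_at (un (length (f x))) (i x))" by (intro fp_intros assms)
  then show ?thesis by (simp add: bit_at_def cong: conj_cong)
qed

text \<open>Collecting bits at the front reverses the first word; concatenation is then obtained by
  reversing it beforehand.\<close>

lemma FP_rev_append:
  assumes "FP f" "FP g" shows "FP (\<lambda>x. rev (f x) @ g x)"
proof -
  have e: "rec_nat b (\<lambda>i s. bit_at a i # s) n = rev (take n a) @ b" if "n \<le> length a" for a b n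
    using that by (induction n) (auto simp: take_Suc_conv_app_nth bit_at_def)
  have "FP (\<lambda>w. rec_nat (sn w) (\<lambda>i s. bit_at (fs w) i # s) (length (fs w)))"
  proof (rule FP_rec[where T = "\<lambda>l. 2 * l"])
    fix x i assume "i \<le> length (fs x)"
    then show "length (rec_nat (sn x) (\<lambda>i s. bit_at (fs x) i # s) i) \<le> 2 * length x"
      using length_fs[of x] length_sn[of x] by (simp add: e)
  qed (intro fp_intros pb_intros)+
  then have "FP (\<lambda>w. rev (fs w) @ sn w)" by (simp add: e)
  then show ?thesis by (rule FP2[where F = "\<lambda>a b. rev a @ b", OF _ assms])
qed

lemma FP_rev [fp_intros]: "FP f \<Longrightarrow> FP (\<lambda>x. rev (f x))"
  using FP_rev_append[OF _ FP_const[of "[]"]] by simp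

lemma FP_append [fp_intros]: "FP f \<Longrightarrow> FP g \<Longrightarrow> FP (\<lambda>x. f x @ g x)"
  using FP_rev_append[OF FP_rev] by simp

lemma FP_concat [fp_intros]:
  assumes f: "FP (\<lambda>w. f (fs w) (length (sn w)))" and m: "FU m"
  shows "FP (\<lambda>x. concat (map (f x) [0..<m x]))"
proof -
  have e: "rec_nat [] (\<lambda>i s. s @ f x i) n = concat (map (f x) [0..<n])" for x n
    by (induction n) simp_all
  obtain T where T: "poly_bounded T" "\<And>x i. i \<le> m x \<Longrightarrow> length (f x i) \<le> T (length x)"
    using FP_binder_length[OF f m] by blast
  obtain p where p: "\<And>x. m x \<le> poly p (length x)" using FU_bound[OF m] by blast
  have "FP (\<lambda>w. f (fs (pr (fs w) (fs (sn w)))) (length (sn (pr (fs w) (fs (sn w))))))"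
    by (rule FP_comp[OF f]) (intro fp_intros)
  then have h: "FP (\<lambda>w. sn (sn w) @ f (fs w) (length (fs (sn w))))" by (intro fp_intros) simp
  have "FP (\<lambda>x. rec_nat [] (\<lambda>i s. s @ f x i) (m x))"
  proof (rule FP_rec[OF h _ m])
    show "poly_bounded (\<lambda>l. poly p l * T l)" by (intro pb_intros T)
    fix x i assume "i \<le> m x"
    moreover have "length (rec_nat [] (\<lambda>i s. s @ f x i) n) \<le> n * T (length x)" if "n \<le> m x" for n
      using that
    proof (induction n)
      case (Suc n)
      then show ?case using T(2)[of n x] by simp
    qed simp
    ultimately show "length (rec_nat [] (\<lambda>i s. s @ f x i) i) \<le> poly p (length x) * T (length x)"
      using p[of x] by (meson le_trans mult_le_mono1)
  qed (intro fp_intros)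
  then show ?thesis unfolding e .
qed

lemma FP_map_bits [fp_intros]:
  assumes "FB (\<lambda>w. P (fs w) (length (sn w)))" "FU m"
  shows "FP (\<lambda>x. map (P x) [0..<m x])"
proof -
  have "concat (map (\<lambda>i. [P x i]) [0..<n]) = map (P x) [0..<n]" for x n
    by (induction n) simp_all
  then show ?thesis using FP_concat[of "\<lambda>x i. [P x i]", OF FP_bit[OF assms(1)] assms(2)] by simp
qed

lemma FU_add [fp_intros]: "FU m \<Longrightarrow> FU n \<Longrightarrow> FU (\<lambda>x. m x + n x)"
  unfolding FU_def replicate_add by (rule FP_append)

text \<open>Comparing padded bits alone would identify words that differ by trailing
  \<open>False\<close> bits; comparing the index with both lengths rules this out. The sum of the
  lengths is a convenient bound covering both words.\<close>

lemma FB_eq [fp_intros]: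
  assumes "FP f" "FP g" shows "FB (\<lambda>x. f x = g x)"
proof -
  have "FB (\<lambda>w. \<forall>i < length (fs w) + length (sn w). bit_at (fs w) i = bit_at (sn w) i \<and>
      (i < length (fs w)) = (i < length (sn w)))" by (intro fp_intros)
  then have "FB (\<lambda>x. \<forall>i < length (f x) + length (g x). bit_at (f x) i = bit_at (g x) i \<and>
      (i < length (f x)) = (i < length (g x)))"
    by (rule FB2[of "\<lambda>a b. \<forall>i < length a + length b. bit_at a i = bit_at b i \<and> (i < length a) = (i < length b)", OF _ assms])
  moreover have "(\<forall>i < length a + length b. bit_at a i = bit_at b i \<and> (i < length a) = (i < length b)) \<longleftrightarrow> a = b" for a b
  proof
    assume *: "\<forall>i < length a + length b. bit_at a i = bit_at b i \<and> (i < length a) = (i < length b)"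
    have l: "length a = length b"
    proof (rule ccontr)
      assume "length a \<noteq> length b"
      then consider "length a < length b" | "length b < length a" by linarith
      then show False
        using *[rule_format, of "length a"] *[rule_format, of "length b"]
        by cases (cases a; cases b; simp)+
    qed
    show "a = b"
    proof (rule nth_equalityI[OF l])
      fix i assume "i < length a"
      then show "a ! i = b ! i" using *[rule_format, of i] l by (simp add: bit_at_def)
    qed
  qed simp
  ultimately show ?thesis by simp
qed

subsection \<open>Arithmetic\<close>

fun val :: "bool list \<Rightarrow> nat" where
  "val [] = 0"
| "val (b # w) = of_bool b + 2 * val w"

declare sum_of_bool_mult_eq [simp del] sum_mult_of_bool_eq [simp del]

lemma val_append: "val (v @ w) = val v + 2 ^ length v * val w"
  by (induction v) simp_all

lemma val_map_upt: "val (map P [0..<n]) = (\<Sum>i<n. of_bool (P i) * 2 ^ i)"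
  by (induction n) (simp_all add: val_append)

lemma val_bits: "length w \<le> n \<Longrightarrow> val w = (\<Sum>i<n. of_bool (bit_at w i) * 2 ^ i)"
proof (induction w arbitrary: n)
  case (Cons b w)
  then obtain k where "n = Suc k" "length w \<le> k" by (cases n) auto
  then show ?case using Cons.IH[of k]
    by (simp add: sum.lessThan_Suc_shift sum_distrib_left mult.left_commute del: sum.lessThan_Suc)
qed simp

lemma val_less: "val w < 2 ^ length w"
  by (induction w) (auto simp: of_bool_def)

lemma val_replicate_False: "val (replicate n False) = 0"
  by (induction n) simp_all

definition carry :: "bool list \<Rightarrow> bool list \<Rightarrow> nat \<Rightarrow> bool" where
  "carry x y = rec_nat False (\<lambda>i c. bit_at x i \<and> bit_at y i \<or> c \<and> (bit_at x i \<or> bit_at y i))"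

text \<open>The chain of equalities is the exclusive or of the two bits and the carry. One position
  beyond the two lengths makes room for the final carry.\<close>

definition add_bits :: "bool list \<Rightarrow> bool list \<Rightarrow> bool list" where
  "add_bits x y = map (\<lambda>i. bit_at x i = (bit_at y i = carry x y i)) [0..<length x + length y + 1]"

lemma val_add_bits: "val (add_bits x y) = val x + val y"
proof -
  define S where "S n = (\<Sum>i<n. of_bool (bit_at x i = (bit_at y i = carry x y i)) * 2 ^ i :: nat)" for n
  \<comment> \<open>The usual invariant of addition: the digits written so far plus the pending
    carry equal the sum of the truncated summands.\<close>
  have inv: "S n + of_bool (carry x y n) * 2 ^ n =
      (\<Sum>i<n. of_bool (bit_at x i) * 2 ^ i) + (\<Sum>i<n. of_bool (bit_at y i) * 2 ^ i)" for n
  proof (induction n)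
    case (Suc n)
    have "carry x y (Suc n) \<longleftrightarrow> bit_at x n \<and> bit_at y n \<or> carry x y n \<and> (bit_at x n \<or> bit_at y n)"
      by (simp add: carry_def)
    then show ?case using Suc
      by (cases "bit_at x n"; cases "bit_at y n"; cases "carry x y n") (simp_all add: S_def algebra_simps)
  qed (simp add: S_def carry_def)
  define n where "n = length x + length y + 1"
  have v: "S n + of_bool (carry x y n) * 2 ^ n = val x + val y"
    using val_bits[of x n] val_bits[of y n] inv[of n] by (simp add: n_def)
  \<comment> \<open>The sum fits into \<open>n\<close> digits, so the carry out of the last position
    is zero.\<close>
  have "val x < 2 ^ (n - 1)" "val y < 2 ^ (n - 1)"
    by (auto simp: n_def intro!: less_le_trans[OF val_less] power_increasing)
  then have "val x + val y < 2 ^ n" by (simp add: n_def)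
  then have "\<not> carry x y n" using v by (cases "carry x y n") auto
  then show ?thesis using v unfolding add_bits_def val_map_upt S_def n_def[symmetric] by simp
qed

lemma length_add_bits [simp]: "length (add_bits x y) = length x + length y + 1"
  by (simp add: add_bits_def)

lemma FP_add_bits [fp_intros]:
  assumes "FP f" "FP g" shows "FP (\<lambda>x. add_bits (f x) (g x))"
proof -
  have "FB (\<lambda>w. carry (fs (fs w)) (sn (fs w)) (length (sn w)))"
    unfolding carry_def by (intro FB_rec fp_intros)
  then have "FP (\<lambda>w. add_bits (fs w) (sn w))" unfolding add_bits_def by (intro fp_intros)
  then show ?thesis by (rule FP2[OF _ assms])
qed

text \<open>Any word of the right value will do; leading zeros are allowed, so arithmetic never has
  to normalise.\<close>

definition FN :: "(bool list \<Rightarrow> nat) \<Rightarrow> bool" where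
  "FN g \<longleftrightarrow> (\<exists>F. FP F \<and> (\<forall>x. val (F x) = g x))"

lemma FN_val [fp_intros]: "FP f \<Longrightarrow> FN (\<lambda>x. val (f x))"
  unfolding FN_def by blast

lemma FN_add [fp_intros]:
  assumes "FN f" "FN g" shows "FN (\<lambda>x. f x + g x)"
proof -
  obtain F G where "FP F" "FP G" "\<And>x. val (F x) = f x" "\<And>x. val (G x) = g x"
    using assms by (auto simp: FN_def)
  then show ?thesis using FN_val[OF FP_add_bits[of F G]] by (simp add: val_add_bits)
qed

lemma FN_comp: "FN f \<Longrightarrow> FP g \<Longrightarrow> FN (\<lambda>x. f (g x))"
  unfolding FN_def using FP_comp by blast

lemma FN_if [fp_intros]:
  assumes "FB P" "FN f" "FN g" shows "FN (\<lambda>x. if P x then f x else g x)"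
proof -
  obtain F G where "FP F" "FP G" "\<And>x. val (F x) = f x" "\<And>x. val (G x) = g x"
    using assms(2,3) by (auto simp: FN_def)
  then show ?thesis using FP_if[OF assms(1), of F G] unfolding FN_def
    by (intro exI[of _ "\<lambda>x. if P x then F x else G x"]) auto
qed

lemma FN_sum [fp_intros]:
  assumes g: "FN (\<lambda>w. g (fs w) (length (sn w)))" and m: "FU m"
  shows "FN (\<lambda>x. \<Sum>i<m x. g x i)"
proof -
  obtain F where F: "FP F" "\<And>w. val (F w) = g (fs w) (length (sn w))" using g by (auto simp: FN_def)
  define h where "h x i s = add_bits s (F (pr x (un i)))" for x i s
  have v: "val (rec_nat [] (h x) n) = (\<Sum>i<n. g x i)" for x n
    by (induction n) (simp_all add: h_def val_add_bits F(2))
  have "FP (\<lambda>w. F (pr (fs w) (un (length (sn w)))))" by (rule FP_comp[OF F(1)]) (intro fp_intros)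
  from FP_binder_length[OF this m] obtain T where T: "poly_bounded T"
    "\<And>x i. i \<le> m x \<Longrightarrow> length (F (pr x (un i))) \<le> T (length x)" by blast
  obtain p where p: "\<And>x. m x \<le> poly p (length x)" using FU_bound[OF m] by blast
  have "FP (\<lambda>x. rec_nat [] (h x) (m x))"
  proof (rule FP_rec[OF _ _ m])
    show "FP (\<lambda>w. h (fs w) (length (fs (sn w))) (sn (sn w)))"
      unfolding h_def by (intro fp_intros FP_comp[OF F(1)])
    \<comment> \<open>Each addition lengthens the accumulator by the length of the term plus one, so
      the growth is additive and not multiplicative.\<close>
    show "poly_bounded (\<lambda>l. poly p l * (T l + 1))" by (intro pb_intros T)
    fix x i assume "i \<le> m x"
    moreover have "length (rec_nat [] (h x) n) \<le> n * (T (length x) + 1)" if "n \<le> m x" for n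
      using that
    proof (induction n)
      case (Suc n)
      then show ?case using T(2)[of n x] by (simp add: h_def)
    qed simp
    ultimately show "length (rec_nat [] (h x) i) \<le> poly p (length x) * (T (length x) + 1)"
      using p[of x] by (meson le_trans mult_le_mono1)
  qed (intro fp_intros)
  then show ?thesis unfolding FN_def using v by blast
qed

text \<open>Schoolbook multiplication: with the least significant bit first, prefixing
  \<open>i\<close> zeros multiplies by \<open>2 ^ i\<close>, and the shifted copies are
  summed.\<close>

lemma FN_mult [fp_intros]:
  assumes "FN f" "FN g" shows "FN (\<lambda>x. f x * g x)"
proof -
  let ?t = "\<lambda>x y i. val (if bit_at x i then map (\<lambda>_. False) [0..<i] @ y else [])"
  have t: "(\<Sum>i<length x. ?t x y i) = val x * val y" for x y
    unfolding val_bits[of x "length x", OF order_refl] sum_distrib_right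
    by (intro sum.cong refl) (auto simp: val_append val_replicate_False map_replicate_const)
  obtain F G where "FP F" "FP G" "\<And>x. val (F x) = f x" "\<And>x. val (G x) = g x"
    using assms by (auto simp: FN_def)
  moreover have "FN (\<lambda>w. \<Sum>i<length (fs w). ?t (fs w) (sn w) i)" by (intro fp_intros)
  ultimately show ?thesis
    using FN_comp[of "\<lambda>w. \<Sum>i<length (fs w). ?t (fs w) (sn w) i" "\<lambda>x. pr (F x) (G x)"] FP_pr[of F G]
    by (simp add: t)
qed

lemma FN_const [fp_intros]: "FN (\<lambda>_. n)"
proof -
  have "val (nat_bits n) = n"
    by (induction n rule: nat_bits.induct) (subst nat_bits.simps, auto)
  then show ?thesis using FN_val[OF FP_const[of "nat_bits n"]] by simp
qed

text \<open>Bits are scanned upwards and every difference overrides the earlier verdict, so the most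
  significant difference decides.\<close>

lemma FB_le [fp_intros]:
  assumes "FN f" "FN g" shows "FB (\<lambda>x. f x \<le> g x)"
proof -
  let ?r = "\<lambda>x y. rec_nat True (\<lambda>i r. if bit_at x i = bit_at y i then r else bit_at y i)"
  have r: "?r x y (length x + length y) \<longleftrightarrow> val x \<le> val y" for x y
  proof -
    define X where "X n = (\<Sum>i<n. of_bool (bit_at x i) * 2 ^ i :: nat)" for n
    define Y where "Y n = (\<Sum>i<n. of_bool (bit_at y i) * 2 ^ i :: nat)" for n
    have b: "X n < 2 ^ n" "Y n < 2 ^ n" for n by (induction n) (auto simp: X_def Y_def)
    have "?r x y n \<longleftrightarrow> X n \<le> Y n" for n
    proof (induction n)
      case (Suc n)
      then show ?case using b[of n] by (cases "bit_at x n"; cases "bit_at y n") (simp_all add: X_def Y_def)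
    qed (simp add: X_def Y_def)
    then show ?thesis using val_bits[of x "length x + length y"] val_bits[of y "length x + length y"]
      by (simp add: X_def Y_def)
  qed
  obtain F G where "FP F" "FP G" "\<And>x. val (F x) = f x" "\<And>x. val (G x) = g x"
    using assms by (auto simp: FN_def)
  moreover have "FB (\<lambda>w. ?r (fs w) (sn w) (length (fs w) + length (sn w)))"
    by (intro FB_rec fp_intros FB_if)
  then have "FB (\<lambda>w. val (fs w) \<le> val (sn w))" by (simp add: r)
  ultimately show ?thesis
    using FB2[of "\<lambda>a b. val a \<le> val b" F G] by simp
qed

lemma FB_nat_eq [fp_intros]: "FN f \<Longrightarrow> FN g \<Longrightarrow> FB (\<lambda>x. f x = g x)"
  using FB_conj[OF FB_le FB_le, of f g g f] by (simp add: eq_iff)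

lemma FB_less [fp_intros]: "FN f \<Longrightarrow> FN g \<Longrightarrow> FB (\<lambda>x. f x < g x)"
  using FB_not[OF FB_le, of g f] by (simp add: not_le)

text \<open>Integers are kept as formal differences of naturals. Signs and subtraction disappear:
  products are expanded, and comparison becomes comparison of two sums of naturals.\<close>

definition FI :: "(bool list \<Rightarrow> int) \<Rightarrow> bool" where
  "FI g \<longleftrightarrow> (\<exists>f h. FN f \<and> FN h \<and> (\<forall>x. g x = int (f x) - int (h x)))"

lemma FI_I: "FN f \<Longrightarrow> FN h \<Longrightarrow> (\<And>x. g x = int (f x) - int (h x)) \<Longrightarrow> FI g"
  unfolding FI_def by blast

lemma FI_E:
  assumes "FI g" obtains f h where "FN f" "FN h" "g = (\<lambda>x. int (f x) - int (h x))"
  using assms unfolding FI_def by blast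

lemma FI_int [fp_intros]: "FN f \<Longrightarrow> FI (\<lambda>x. int (f x))"
  by (rule FI_I[OF _ FN_const[of 0]]) simp_all

lemma FI_uminus [fp_intros]: "FI f \<Longrightarrow> FI (\<lambda>x. - f x)"
  by (erule FI_E, rule FI_I) auto

lemma FI_mult [fp_intros]:
  assumes "FI f" "FI g" shows "FI (\<lambda>x. f x * g x)"
proof -
  obtain a b where f: "FN a" "FN b" "f = (\<lambda>x. int (a x) - int (b x))" by (rule FI_E[OF assms(1)])
  obtain c d where g: "FN c" "FN d" "g = (\<lambda>x. int (c x) - int (d x))" by (rule FI_E[OF assms(2)])
  show ?thesis unfolding f(3) g(3)
    by (rule FI_I[of "\<lambda>x. a x * c x + b x * d x" "\<lambda>x. a x * d x + b x * c x"], (intro fp_intros f g)+)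
      (simp add: algebra_simps)
qed

lemma FI_if [fp_intros]:
  assumes "FB P" "FI f" "FI g" shows "FI (\<lambda>x. if P x then f x else g x)"
proof -
  obtain a b where f: "FN a" "FN b" "f = (\<lambda>x. int (a x) - int (b x))" by (rule FI_E[OF assms(2)])
  obtain c d where g: "FN c" "FN d" "g = (\<lambda>x. int (c x) - int (d x))" by (rule FI_E[OF assms(3)])
  show ?thesis unfolding f(3) g(3)
    by (rule FI_I[of "\<lambda>x. if P x then a x else c x" "\<lambda>x. if P x then b x else d x"], (intro fp_intros assms f g)+)
      simp
qed

lemma FI_sum [fp_intros]:
  assumes g: "FI (\<lambda>w. g (fs w) (length (sn w)))" and m: "FU m"
  shows "FI (\<lambda>x. \<Sum>i<m x. g x i)"
proof -
  obtain a b where ab: "FN a" "FN b" and e: "(\<lambda>w. g (fs w) (length (sn w))) = (\<lambda>x. int (a x) - int (b x))"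
    by (rule FI_E[OF g])
  have g': "g x i = int (a (pr x (un i))) - int (b (pr x (un i)))" for x i
    using fun_cong[OF e, of "pr x (un i)"] by simp
  show ?thesis
  proof (rule FI_I)
    show "FN (\<lambda>x. \<Sum>i<m x. a (pr x (un i)))" "FN (\<lambda>x. \<Sum>i<m x. b (pr x (un i)))"
      by (intro fp_intros m FN_comp[OF ab(1)] FN_comp[OF ab(2)])+
  qed (simp add: g' sum_subtractf)
qed

lemma FB_int_le [fp_intros]:
  assumes "FI f" "FI g" shows "FB (\<lambda>x. f x \<le> g x)"
proof -
  obtain a b where f: "FN a" "FN b" "f = (\<lambda>x. int (a x) - int (b x))" by (rule FI_E[OF assms(1)])
  obtain c d where g: "FN c" "FN d" "g = (\<lambda>x. int (c x) - int (d x))" by (rule FI_E[OF assms(2)])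
  have "FB (\<lambda>x. a x + d x \<le> c x + b x)" by (intro fp_intros f g)
  also have "(\<lambda>x. a x + d x \<le> c x + b x) = (\<lambda>x. f x \<le> g x)"
    unfolding f(3) g(3) by auto
  finally show ?thesis .
qed

section \<open>Small solutions of systems of linear inequalities\<close>

definition feasible :: "nat \<Rightarrow> (real vec \<times> real) set \<Rightarrow> real vec \<Rightarrow> bool" where
  "feasible n C z \<longleftrightarrow> z \<in> carrier_vec n \<and> (\<forall>(a, b) \<in> C. a \<bullet> z \<le> b)"

text \<open>Moving along a direction \<open>d\<close> that is orthogonal to all rows of \<open>M\<close> but row \<open>r\<close>, one hits a
  new constraint, whose normal vector can replace row \<open>r\<close>.\<close>

lemma tighten:
  fixes C :: "(real vec \<times> real) set" and M :: "real mat"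
  assumes C: "finite C" "\<forall>(a, b)\<in>C. a \<in> carrier_vec n"
    and nonneg: "\<forall>i<n. (- unit_vec n i, 0) \<in> C"
    and z: "feasible n C z" and M: "M \<in> carrier_mat n n" "det M \<noteq> 0" and r: "r < n"
  shows "\<exists>z' M'. feasible n C z' \<and> M' \<in> carrier_mat n n \<and> det M' \<noteq> 0 \<and>
    (row M' r, row M' r \<bullet> z') \<in> C \<and> (\<forall>i<n. i \<noteq> r \<longrightarrow> row M' i = row M i \<and> row M' i \<bullet> z' = row M i \<bullet> z)"
proof -
  have C2: "a \<in> carrier_vec n" if "(a, b) \<in> C" for a b using C(2) that by blast
  \<comment> \<open>Column \<open>r\<close> of the adjugate: \<open>M\<close> maps it to
    \<open>det M\<close> times the unit vector, so it is orthogonal to all other rows.\<close>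
  define d0 where "d0 = adj_mat M *\<^sub>v unit_vec n r"
  note adj = adj_mat[OF M(1)]
  have d0: "d0 \<in> carrier_vec n" using adj(1) by (auto simp: d0_def)
  have "M *\<^sub>v d0 = (M * adj_mat M) *\<^sub>v unit_vec n r"
    unfolding d0_def by (rule assoc_mult_mat_vec[symmetric, OF M(1) adj(1)]) simp
  also have "\<dots> = det M \<cdot>\<^sub>v unit_vec n r"
    unfolding adj(2) by (intro eq_vecI) auto
  finally have Md0: "M *\<^sub>v d0 = det M \<cdot>\<^sub>v unit_vec n r" .
  have "d0 \<noteq> 0\<^sub>v n"
  proof
    assume "d0 = 0\<^sub>v n"
    then have "(M *\<^sub>v d0) $ r = 0" using r M(1) by simp
    then show False using Md0 r M(2) by simp
  qed
  then obtain j where j: "j < n" "d0 $ j \<noteq> 0" using d0 by (metis carrier_vecD eq_vecI index_zero_vec)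
  \<comment> \<open>The sign is chosen so that some coordinate decreases along the ray;
    nonnegativity of that coordinate then stops it.\<close>
  define \<sigma> :: real where "\<sigma> = (if d0 $ j < 0 then 1 else - 1)"
  define d where "d = \<sigma> \<cdot>\<^sub>v d0"
  have d: "d \<in> carrier_vec n" "d $ j < 0" using d0 j by (auto simp: d_def \<sigma>_def)
  have Md: "row M i \<bullet> d = (if i = r then \<sigma> * det M else 0)" if "i < n" for i
  proof -
    have "row M i \<bullet> d = \<sigma> * (M *\<^sub>v d0) $ i" using that M(1) d0 by (simp add: d_def)
    then show ?thesis using that r by (simp add: Md0)
  qed
  define S where "S = {c \<in> C. fst c \<bullet> d > 0}"
  \<comment> \<open>The ratio test of the simplex method: the longest step along \<open>d\<close>
    that violates no constraint.\<close>
  define \<tau> where "\<tau> = Min ((\<lambda>c. (snd c - fst c \<bullet> z) / (fst c \<bullet> d)) ` S)"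
  have S: "finite S" "S \<noteq> {}"
  proof -
    have "(- unit_vec n j, 0) \<in> S" using nonneg[rule_format, OF j(1)] d j(1) by (simp add: S_def)
    then show "S \<noteq> {}" by blast
  qed (use C(1) S_def in simp)
  have "\<tau> \<in> (\<lambda>c. (snd c - fst c \<bullet> z) / (fst c \<bullet> d)) ` S" unfolding \<tau>_def by (rule Min_in) (use S in auto)
  then obtain \<alpha> \<beta> where \<alpha>: "(\<alpha>, \<beta>) \<in> C" "\<alpha> \<bullet> d > 0" "\<tau> = (\<beta> - \<alpha> \<bullet> z) / (\<alpha> \<bullet> d)"
    by (auto simp: S_def)
  have zc: "z \<in> carrier_vec n" "\<And>a b. (a, b) \<in> C \<Longrightarrow> a \<bullet> z \<le> b" using z by (auto simp: feasible_def)
  have \<tau>0: "\<tau> \<ge> 0" using \<alpha> zc(2)[OF \<alpha>(1)] by simp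
  define z' where "z' = z + \<tau> \<cdot>\<^sub>v d"
  have z': "a \<bullet> z' = a \<bullet> z + \<tau> * (a \<bullet> d)" if "a \<in> carrier_vec n" for a
    using that zc(1) d(1) by (simp add: z'_def scalar_prod_add_distrib)
  have "a \<bullet> z' \<le> b" if ab: "(a, b) \<in> C" for a b
  proof (cases "a \<bullet> d > 0")
    case True
    then have "\<tau> \<le> (b - a \<bullet> z) / (a \<bullet> d)" unfolding \<tau>_def
      by (intro Min_le) (use S ab in \<open>auto simp: S_def intro!: rev_image_eqI[of "(a, b)"]\<close>)
    then show ?thesis using True z'[OF C2[OF ab]] by (simp add: pos_le_divide_eq algebra_simps)
  next
    case False
    then have "\<tau> * (a \<bullet> d) \<le> 0" using \<tau>0 by (simp add: mult_le_0_iff)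
    then show ?thesis using zc(2)[OF ab] z'[OF C2[OF ab]] by linarith
  qed
  then have f: "feasible n C z'" using zc(1) d(1) by (auto simp: feasible_def z'_def)
  have \<alpha>c: "\<alpha> \<in> carrier_vec n" using C2 \<alpha>(1) by blast
  define M' where "M' = mat n n (\<lambda>(i, k). if i = r then \<alpha> $ k else M $$ (i, k))"
  have M': "M' \<in> carrier_mat n n" by (simp add: M'_def)
  have row: "row M' i = (if i = r then \<alpha> else row M i)" if "i < n" for i
    using that M(1) \<alpha>c by (auto simp: M'_def intro!: eq_vecI)
  have "det M' \<noteq> 0"
  proof
    assume "det M' = 0"
    then obtain v where v: "v \<in> carrier_vec n" "v \<noteq> 0\<^sub>v n" "M' *\<^sub>v v = 0\<^sub>v n"
      using det_0_iff_vec_prod_zero[OF M'] by blast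
    have Mv: "row M' i \<bullet> v = 0" if "i < n" for i
      using arg_cong[OF v(3), of "\<lambda>w. w $ i"] that M' by simp
    define c where "c = row M r \<bullet> v"
    \<comment> \<open>This combination of a kernel vector \<open>v\<close> of \<open>M'\<close> with
      \<open>d\<close> cancels in row \<open>r\<close> as well, so it lies in the kernel of
      \<open>M\<close> and vanishes. Pairing it with \<open>\<alpha>\<close>, which is not
      orthogonal to \<open>d\<close>, forces \<open>c = 0\<close>, and so \<open>v\<close> itself is
      in the kernel of \<open>M\<close>.\<close>
    define u where "u = (\<sigma> * det M) \<cdot>\<^sub>v v + (- c) \<cdot>\<^sub>v d"
    have u: "u \<in> carrier_vec n" using v(1) d(1) by (simp add: u_def)
    have ru: "a \<bullet> u = \<sigma> * det M * (a \<bullet> v) - c * (a \<bullet> d)" if "a \<in> carrier_vec n" for a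
      using that v(1) d(1) by (simp add: u_def scalar_prod_add_distrib)
    have "M *\<^sub>v u = 0\<^sub>v n"
    proof (rule eq_vecI)
      fix i assume i: "i < dim_vec (0\<^sub>v n :: real vec)"
      then have "row M i \<bullet> u = 0"
        using ru[of "row M i"] M(1) Md[of i] Mv[of i] row[of i] by (auto simp: c_def)
      then show "(M *\<^sub>v u) $ i = 0\<^sub>v n $ i" using i M(1) by simp
    qed (use M(1) in simp)
    then have "u = 0\<^sub>v n" using det_0_iff_vec_prod_zero[OF M(1)] M(2) u by blast
    then have "\<alpha> \<bullet> u = 0" using \<alpha>c by simp
    then have "c * (\<alpha> \<bullet> d) = 0" using ru[OF \<alpha>c] Mv[OF r] row[OF r] by simp
    then have "c = 0" using \<alpha>(2) by simp
    then have "M *\<^sub>v v = 0\<^sub>v n"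
    proof (intro eq_vecI)
      fix i assume "i < dim_vec (0\<^sub>v n :: real vec)"
      then show "(M *\<^sub>v v) $ i = 0\<^sub>v n $ i"
        using Mv[of i] row[of i] M(1) \<open>c = 0\<close> by (cases "i = r") (simp_all add: c_def)
    qed (use M(1) in simp)
    then show False using det_0_iff_vec_prod_zero[OF M(1)] M(2) v by blast
  qed
  moreover have "(row M' r, row M' r \<bullet> z') \<in> C"
    using row[OF r] z'[OF \<alpha>c] \<alpha> by simp
  moreover have "row M' i = row M i \<and> row M' i \<bullet> z' = row M i \<bullet> z" if "i < n" "i \<noteq> r" for i
    using row[OF that(1)] z'[of "row M i"] Md[OF that(1)] M(1) that by simp
  ultimately show ?thesis using f M' by blast
qed

text \<open>The exchange starts from the identity matrix, whose rows need not be constraint normals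
  at all. Each application of \<open>tighten\<close> keeps the good rows good and makes one more
  good, so the number of bad rows decreases.\<close>

lemma vertex:
  fixes C :: "(real vec \<times> real) set"
  assumes C: "finite C" "\<forall>(a, b)\<in>C. a \<in> carrier_vec n"
    and nonneg: "\<forall>i<n. (- unit_vec n i, 0) \<in> C" and z: "feasible n C z"
  shows "\<exists>z (M :: real mat). feasible n C z \<and> M \<in> carrier_mat n n \<and> det M \<noteq> 0 \<and> (\<forall>i<n. (row M i, row M i \<bullet> z) \<in> C)"
proof -
  have "\<exists>z (M :: real mat). feasible n C z \<and> M \<in> carrier_mat n n \<and> det M \<noteq> 0 \<and> (\<forall>i<n. (row M i, row M i \<bullet> z) \<in> C)"
    if "feasible n C z" "M \<in> carrier_mat n n" "det M \<noteq> 0" for z and M :: "real mat"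
    using that
  proof (induction "card {i. i < n \<and> (row M i, row M i \<bullet> z) \<notin> C}" arbitrary: z M rule: less_induct)
    case less
    let ?N = "\<lambda>M z. {i. i < n \<and> (row M i, row M i \<bullet> z) \<notin> C}"
    show ?case
    proof (cases "?N M z = {}")
      case False
      then obtain r where r: "r < n" "(row M r, row M r \<bullet> z) \<notin> C" by blast
      obtain z' M' where *: "feasible n C z'" "M' \<in> carrier_mat n n" "det M' \<noteq> 0" "(row M' r, row M' r \<bullet> z') \<in> C"
        "\<And>i. i < n \<Longrightarrow> i \<noteq> r \<Longrightarrow> row M' i = row M i \<and> row M' i \<bullet> z' = row M i \<bullet> z"
        using tighten[OF C nonneg less.prems r(1)] by blast
      have "?N M' z' \<subset> ?N M z"
      proof
        show "?N M' z' \<subseteq> ?N M z" using *(4,5) by (auto, metis)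
        show "?N M' z' \<noteq> ?N M z" using *(4) r by blast
      qed
      then have "card (?N M' z') < card (?N M z)" by (intro psubset_card_mono) auto
      from less.hyps[OF this *(1-3)] show ?thesis .
    qed (use less.prems in blast)
  qed
  from this[OF z, of "1\<^sub>m n"] show ?thesis by simp
qed

text \<open>The Leibniz formula gives a crude bound, but its number of bits is polynomial, which
  suffices.\<close>

lemma abs_det_le:
  fixes A :: "real mat"
  assumes A: "A \<in> carrier_mat n n" "\<And>i j. i < n \<Longrightarrow> j < n \<Longrightarrow> \<bar>A $$ (i, j)\<bar> \<le> H"
  shows "\<bar>det A\<bar> \<le> fact n * H ^ n"
proof -
  have "\<bar>det A\<bar> \<le> (\<Sum>p | p permutes {0..<n}. \<bar>signof p * (\<Prod>i = 0..<n. A $$ (i, p i))\<bar>)"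
    unfolding det_def'[OF A(1)] by (rule sum_abs)
  also have "\<dots> \<le> (\<Sum>p | p permutes {0..<n}. H ^ n)"
  proof (rule sum_mono)
    fix p assume "p \<in> {p. p permutes {0..<n}}"
    then have p: "p i < n" if "i < n" for i using that permutes_in_image[of p "{0..<n}" i] by simp
    have "\<bar>signof p * (\<Prod>i = 0..<n. A $$ (i, p i))\<bar> = (\<Prod>i = 0..<n. \<bar>A $$ (i, p i)\<bar>)"
      by (simp add: abs_mult abs_prod sign_def)
    also have "\<dots> \<le> (\<Prod>i = 0..<n. H)" by (rule prod_mono) (use p A(2) in auto)
    finally show "\<bar>signof p * (\<Prod>i = 0..<n. A $$ (i, p i))\<bar> \<le> H ^ n" by simp
  qed
  also have "\<dots> = fact n * H ^ n" by (simp add: card_permutations[OF refl])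
  finally show ?thesis .
qed

lemma det_Ints:
  fixes A :: "real mat"
  assumes A: "A \<in> carrier_mat n n" "\<And>i j. i < n \<Longrightarrow> j < n \<Longrightarrow> A $$ (i, j) \<in> \<int>"
  shows "det A \<in> \<int>"
  unfolding det_def'[OF A(1)]
proof (intro Ints_sum Ints_mult Ints_prod)
  fix p i assume "p \<in> {p. p permutes {0..<n}}" "i \<in> {0..<n}"
  then show "A $$ (i, p i) \<in> \<int>" using A(2) permutes_in_image[of p "{0..<n}" i] by simp
qed (simp add: sign_def)

text \<open>By Cramer's rule all coordinates are quotients of integer determinants with common
  denominator \<open>det M\<close>; as the coordinates are nonnegative, absolute values may be
  taken. Only the numerators need a bound, since the denominator cancels in the homogenised system
  to which this is applied.\<close>

lemma small_vertex:
  fixes C :: "(real vec \<times> real) set" and H :: nat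
  assumes C: "finite C" "\<forall>(a, b)\<in>C. a \<in> carrier_vec n"
    and nonneg: "\<forall>i<n. (- unit_vec n i, 0) \<in> C" and z: "feasible n C z"
    and H: "\<And>a b i. (a, b) \<in> C \<Longrightarrow> i < n \<Longrightarrow> a $ i \<in> \<int> \<and> \<bar>a $ i\<bar> \<le> real H"
      "\<And>a b. (a, b) \<in> C \<Longrightarrow> b \<in> \<int> \<and> \<bar>b\<bar> \<le> real H"
  shows "\<exists>(p :: nat \<Rightarrow> nat) q. 0 < q \<and> feasible n C (vec n (\<lambda>i. real (p i) / real q)) \<and>
    (\<forall>i<n. p i \<le> fact n * H ^ n)"
proof -
  obtain z M where z: "feasible n C z" and M: "M \<in> carrier_mat n n" "det M \<noteq> 0"
    and row: "\<And>i. i < n \<Longrightarrow> (row M i, row M i \<bullet> z) \<in> C"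
    using vertex[OF C nonneg z] by blast
  have zc: "z \<in> carrier_vec n" using z by (simp add: feasible_def)
  have e: "M $$ (i, j) \<in> \<int> \<and> \<bar>M $$ (i, j)\<bar> \<le> real H" if "i < n" "j < n" for i j
    using H(1)[OF row[OF that(1)] that(2)] M(1) that by simp
  define q where "q = nat \<lfloor>\<bar>det M\<bar>\<rfloor>"
  have "det M \<in> \<int>" by (rule det_Ints[OF M(1)]) (use e in blast)
  then have q: "real q = \<bar>det M\<bar>" by (auto simp: q_def elim!: Ints_cases)
  define p where "p i = nat \<lfloor>\<bar>det (replace_col M (M *\<^sub>v z) i)\<bar>\<rfloor>" for i
  have p: "real (p i) = z $ i * real q \<and> real (p i) \<le> fact n * real H ^ n" if i: "i < n" for i
  proof -
    let ?R = "replace_col M (M *\<^sub>v z) i"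
    have R: "?R \<in> carrier_mat n n" using M(1) by (simp add: replace_col_def)
    have eR: "?R $$ (k, j) \<in> \<int> \<and> \<bar>?R $$ (k, j)\<bar> \<le> real H" if "k < n" "j < n" for k j
      using that e[OF that] H(2)[OF row[OF that(1)]] M(1) zc by (simp add: replace_col_def)
    have "det ?R \<in> \<int>" by (rule det_Ints[OF R]) (use eR in blast)
    then have pi: "real (p i) = \<bar>det ?R\<bar>" by (auto simp: p_def elim!: Ints_cases)
    have "- unit_vec n i \<bullet> z \<le> 0" using z nonneg[rule_format, OF i] by (auto simp: feasible_def)
    then have "z $ i \<ge> 0" using zc i by simp
    then have "\<bar>det ?R\<bar> = z $ i * real q" unfolding cramer_lemma_mat[OF M(1) zc i] q by (simp add: abs_mult)
    then show ?thesis using pi abs_det_le[OF R, of "real H"] eR by simp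
  qed
  have "vec n (\<lambda>i. real (p i) / real q) = z" using p M(2) q zc by (intro eq_vecI) auto
  moreover have "p i \<le> fact n * H ^ n" if "i < n" for i
    using p[OF that] by (metis of_nat_fact of_nat_le_iff of_nat_mult of_nat_power)
  ultimately show ?thesis using z M(2) q by (intro exI[of _ p] exI[of _ q]) auto
qed

text \<open>Homogenising with a further variable \<open>t\<close>, for which \<open>x = z / t\<close>, turns each strict inequality
  into a nonstrict one with slack \<open>1\<close>, so that a vertex of the resulting polyhedron is small.\<close>

lemma small_solution:
  fixes N S :: "((nat \<Rightarrow> int) \<times> int) set" and x :: "nat \<Rightarrow> real" and H :: nat
  assumes fin: "finite N" "finite S"
    and H: "\<And>a b i. (a, b) \<in> N \<union> S \<Longrightarrow> i < n \<Longrightarrow> \<bar>a i\<bar> \<le> int H" "\<And>a b. (a, b) \<in> N \<union> S \<Longrightarrow> \<bar>b\<bar> \<le> int H"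
      "1 \<le> H"
    and x: "\<And>i. i < n \<Longrightarrow> 0 \<le> x i"
      "\<And>a b. (a, b) \<in> N \<Longrightarrow> (\<Sum>i<n. real_of_int (a i) * x i) \<le> real_of_int b"
      "\<And>a b. (a, b) \<in> S \<Longrightarrow> (\<Sum>i<n. real_of_int (a i) * x i) < real_of_int b"
  shows "\<exists>(p :: nat \<Rightarrow> nat) q. 0 < q \<and> q \<le> fact (n + 1) * H ^ (n + 1) \<and>
    (\<forall>i<n. p i \<le> fact (n + 1) * H ^ (n + 1)) \<and>
    (\<forall>(a, b) \<in> N. (\<Sum>i<n. a i * int (p i)) \<le> b * int q) \<and>
    (\<forall>(a, b) \<in> S. (\<Sum>i<n. a i * int (p i)) < b * int q)"
proof -
  let ?n = "n + 1"
  define h where "h a b = vec ?n (\<lambda>i. if i < n then real_of_int (a i) else - real_of_int b)" for a b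
  \<comment> \<open>Coordinate \<open>n\<close> is the homogenising variable. Requiring it to be at
    least 1 makes it invertible, and nonnegativity of all coordinates guarantees a vertex.\<close>
  define C :: "(real vec \<times> real) set" where "C = (\<lambda>(a, b). (h a b, 0)) ` N \<union> (\<lambda>(a, b). (h a b, - 1)) ` S \<union>
    {(- unit_vec ?n n, - 1)} \<union> (\<lambda>i. (- unit_vec ?n i, 0)) ` {..<?n}"
  have h: "h a b \<bullet> vec ?n z = (\<Sum>i<n. real_of_int (a i) * z i) - real_of_int b * z n" for a b z
    by (simp add: h_def scalar_prod_def atLeast0LessThan)
  have u: "- unit_vec ?n i \<bullet> vec ?n z = - z i" if "i < ?n" for i and z :: "nat \<Rightarrow> real"
    using that by simp
  \<comment> \<open>Scaling by \<open>t\<close> must lift every strict slack to at least 1. The sum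
    of the reciprocal slacks dominates each of them, and the summand 1 covers the case without
    strict constraints.\<close>
  define t where "t = 1 + (\<Sum>(a, b)\<in>S. 1 / (real_of_int b - (\<Sum>i<n. real_of_int (a i) * x i)))"
  have pos: "1 / (real_of_int b - (\<Sum>i<n. real_of_int (a i) * x i)) > 0" if "(a, b) \<in> S" for a b
    using x(3)[OF that] by simp
  have t1: "t \<ge> 1" unfolding t_def using pos by (auto intro!: sum_nonneg simp: less_imp_le)
  define z where "z i = (if i < n then t * x i else t)" for i
  have zs: "(\<Sum>i<n. real_of_int (a i) * z i) = t * (\<Sum>i<n. real_of_int (a i) * x i)" for a
    by (simp add: z_def sum_distrib_left mult.left_commute)
  have "feasible ?n C (vec ?n z)"
    unfolding feasible_def
  proof (intro conjI ballI, simp, clarify)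
    fix a b assume "(a, b) \<in> C"
    then consider (N) a' b' where "(a', b') \<in> N" "a = h a' b'" "b = 0"
      | (S) a' b' where "(a', b') \<in> S" "a = h a' b'" "b = - 1"
      | (t) "a = - unit_vec ?n n" "b = - 1"
      | (u) i where "i < ?n" "a = - unit_vec ?n i" "b = 0"
      unfolding C_def by auto
    then show "a \<bullet> vec ?n z \<le> b"
    proof cases
      case N
      then show ?thesis using x(2)[OF N(1)] t1 unfolding N(2,3) h zs by (simp add: z_def mult.commute[of _ t])
    next
      case S
      let ?s = "real_of_int b' - (\<Sum>i<n. real_of_int (a' i) * x i)"
      have s: "?s > 0" using x(3)[OF S(1)] by simp
      have "1 / ?s \<le> (\<Sum>(a, b)\<in>S. 1 / (real_of_int b - (\<Sum>i<n. real_of_int (a i) * x i)))"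
        using member_le_sum[of "(a', b')" S "\<lambda>(a, b). 1 / (real_of_int b - (\<Sum>i<n. real_of_int (a i) * x i))"]
          fin(2) S(1) pos by (auto simp: less_imp_le)
      then have "1 / ?s \<le> t" by (simp add: t_def)
      then have "1 \<le> t * ?s" using s by (simp add: pos_divide_le_eq)
      then show ?thesis unfolding S(2,3) h zs by (simp add: z_def algebra_simps)
    next
      case t
      then show ?thesis using t1 u[of n z] by (simp add: z_def)
    next
      case u
      then show ?thesis using t1 x(1)[of i] \<open>\<And>z i. i < ?n \<Longrightarrow> - unit_vec ?n i \<bullet> vec ?n z = - z i\<close>[of i z]
        by (simp add: z_def)
    qed
  qed
  moreover have "finite C" using fin by (simp add: C_def)
  moreover have "\<forall>(a, b)\<in>C. a \<in> carrier_vec ?n"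
    by (auto simp: C_def h_def)
  moreover have "a $ i \<in> \<int> \<and> \<bar>a $ i\<bar> \<le> real H" if "(a, b) \<in> C" "i < ?n" for a b i
  proof -
    have *: "\<bar>real_of_int (a' i)\<bar> \<le> real H" if "(a', b') \<in> N \<union> S" "i < n" for a' b'
      using H(1)[OF that] by (metis of_int_abs of_int_le_iff of_int_of_nat_eq)
    have **: "\<bar>real_of_int b'\<bar> \<le> real H" if "(a', b') \<in> N \<union> S" for a' b'
      using H(2)[OF that] by (metis of_int_abs of_int_le_iff of_int_of_nat_eq)
    show ?thesis
      using that H(3) by (auto simp: C_def h_def unit_vec_def) (use * ** in blast)+
  qed
  moreover have "b \<in> \<int> \<and> \<bar>b\<bar> \<le> real H" if "(a, b) \<in> C" for a b
    using that H(3) by (auto simp: C_def)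
  moreover have "\<forall>i<?n. (- unit_vec ?n i, 0) \<in> C" by (simp add: C_def)
  ultimately obtain p :: "nat \<Rightarrow> nat" and q where q: "0 < q" and f: "feasible ?n C (vec ?n (\<lambda>i. real (p i) / real q))"
    and p: "\<forall>i<?n. p i \<le> fact ?n * H ^ ?n"
    using small_vertex[of C ?n "vec ?n z" H] by blast
  have f': "a \<bullet> vec ?n (\<lambda>i. real (p i) / real q) \<le> b" if "(a, b) \<in> C" for a b
    using f that by (auto simp: feasible_def)
  have pn: "0 < p n" using f'[of "- unit_vec ?n n" "- 1"] u[of n "\<lambda>i. real (p i) / real q"] q
    by (auto simp: C_def intro!: Nat.gr0I)
  have s: "h a b \<bullet> vec ?n (\<lambda>i. real (p i) / real q) = real_of_int ((\<Sum>i<n. a i * int (p i)) - b * int (p n)) / real q" for a b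
    unfolding h by (simp add: diff_divide_distrib sum_divide_distrib)
  show ?thesis
  \<comment> \<open>The numerator of the homogenising coordinate becomes the denominator of the
    solution, and the denominator of the vertex drops out.\<close>
  proof (intro exI[of _ p] exI[of _ "p n"] conjI)
    show "\<forall>(a, b)\<in>N. (\<Sum>i<n. a i * int (p i)) \<le> b * int (p n)"
    proof clarify
      fix a b assume "(a, b) \<in> N"
      then have "(h a b, 0) \<in> C" by (force simp: C_def)
      from f'[OF this] have "real_of_int ((\<Sum>i<n. a i * int (p i)) - b * int (p n)) \<le> 0"
        unfolding s using q by (simp add: divide_le_0_iff)
      then show "(\<Sum>i<n. a i * int (p i)) \<le> b * int (p n)" by linarith
    qed
    show "\<forall>(a, b)\<in>S. (\<Sum>i<n. a i * int (p i)) < b * int (p n)"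
    proof clarify
      fix a b assume "(a, b) \<in> S"
      then have "(h a b, - 1) \<in> C" by (force simp: C_def)
      from f'[OF this] have "real_of_int ((\<Sum>i<n. a i * int (p i)) - b * int (p n)) < 0"
        unfolding s using q by (smt (verit) divide_nonneg_pos of_nat_0_less_iff)
      then show "(\<Sum>i<n. a i * int (p i)) < b * int (p n)" by linarith
    qed
  qed (use p pn in auto)
qed

section \<open>Certificates for instances\<close>

text \<open>An entry \<open>e\<close> of a certificate describes a rational number by its sign, numerator and
  denominator, followed by its absolute value times the common denominator \<open>L\<close> and by two numbers
  that witness that the fraction is reduced.\<close>

definition canonical :: "bool list \<Rightarrow> bool" where
  "canonical w \<longleftrightarrow> w = [] \<or> starts_True (rev w)"

definition entry_ok :: "nat \<Rightarrow> bool list \<Rightarrow> bool" where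
  "entry_ok L e \<longleftrightarrow> canonical (item e 1) \<and> canonical (item e 2) \<and> 0 < val (item e 2) \<and>
     (starts_True (item e 0) \<longrightarrow> 0 < val (item e 1)) \<and>
     val (item e 3) * val (item e 2) = val (item e 1) * L \<and>
     val (item e 4) * val (item e 1) + 1 = val (item e 5) * val (item e 2)"

definition ratio :: "bool list \<Rightarrow> rat" where
  "ratio e = Rat.Fract (if starts_True (item e 0) then - int (val (item e 1)) else int (val (item e 1)))
     (int (val (item e 2)))"

definition coef :: "bool list \<Rightarrow> int" where
  "coef e = (if starts_True (item e 0) then - int (val (item e 3)) else int (val (item e 3)))"

text \<open>The second sign bit is constant because a reduced fraction has a positive denominator;
  \<open>pr w []\<close> is just \<open>code_word w\<close>.\<close>

definition entry_word :: "bool list \<Rightarrow> bool list" where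
  "entry_word e = starts_True (item e 0) # pr (item e 1) [] @ False # pr (item e 2) []"

lemma FB_canonical [fp_intros]: "FP w \<Longrightarrow> FB (\<lambda>x. canonical (w x))"
  unfolding canonical_def by (intro fp_intros)

lemma FB_entry_ok [fp_intros]: "FN l \<Longrightarrow> FP e \<Longrightarrow> FB (\<lambda>x. entry_ok (l x) (e x))"
  unfolding entry_ok_def by (intro fp_intros)

lemma FI_coef [fp_intros]: "FP e \<Longrightarrow> FI (\<lambda>x. coef (e x))"
  unfolding coef_def by (intro fp_intros)

lemma FP_entry_word [fp_intros]: "FP e \<Longrightarrow> FP (\<lambda>x. entry_word (e x))"
  unfolding entry_word_def by (intro fp_intros)

lemma nat_bits_0 [simp]: "nat_bits 0 = []"
  by (subst nat_bits.simps) simp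

lemma nat_bits_pos: "n > 0 \<Longrightarrow> nat_bits n = odd n # nat_bits (n div 2)"
  by (subst nat_bits.simps) simp

lemma val_nat_bits [simp]: "val (nat_bits n) = n"
  by (induction n rule: nat_bits.induct) (subst nat_bits.simps, auto)

lemma starts_True_Cons [simp]: "starts_True (b # w) = b"
  by (auto simp: starts_True_def)

lemma starts_True_append: "w \<noteq> [] \<Longrightarrow> starts_True (w @ v) = starts_True w"
  by (cases w) simp_all

lemma canonical_nat_bits: "canonical (nat_bits n)"
proof (induction n rule: nat_bits.induct)
  case (1 n)
  show ?case
  proof (cases "n div 2 = 0")
    case True
    then have "n = 0 \<or> n = 1" by auto
    then show ?thesis by (auto simp: canonical_def nat_bits_pos)
  next
    case False
    then have "n > 0" "nat_bits (n div 2) \<noteq> []" by (auto simp: nat_bits_pos[of "n div 2"])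
    then show ?thesis using 1 by (simp add: canonical_def nat_bits_pos starts_True_append)
  qed
qed

lemma nat_bits_val: "canonical w \<Longrightarrow> nat_bits (val w) = w"
proof (induction w)
  case (Cons b w)
  show ?case
  proof (cases "w = []")
    case True
    then show ?thesis using Cons.prems by (simp add: canonical_def nat_bits_pos)
  next
    case False
    then have "canonical w" using Cons.prems by (simp add: canonical_def starts_True_append)
    then have w: "nat_bits (val w) = w" by (rule Cons.IH)
    then have "val w > 0" using False by (auto intro!: Nat.gr0I)
    then show ?thesis using w by (simp add: nat_bits_pos of_bool_def)
  qed
qed simp

lemma code_nat_val: "canonical w \<Longrightarrow> code_nat (val w) = pr w []"
  by (simp add: code_nat_def nat_bits_val pr_def)

text \<open>The identity in the last two items forces numerator and denominator to be coprime, so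
  \<open>quotient_of\<close> returns them unchanged. A negative sign is allowed only for a nonzero
  numerator, so the sign bit agrees with that of \<open>code_int\<close>.\<close>

lemma entry_ok_ratio:
  assumes "entry_ok L e"
  shows "code_rat (ratio e) = entry_word e" "real L * real_of_rat (ratio e) = real_of_int (coef e)"
proof -
  define a b where "a = val (item e 1)" and "b = val (item e 2)"
  note ok = assms[unfolded entry_ok_def, folded a_def b_def]
  have "coprime a b"
  proof (rule coprimeI)
    fix d assume d: "d dvd a" "d dvd b"
    then have "d dvd val (item e 4) * a + 1" using ok by simp
    moreover have "d dvd val (item e 4) * a" using d(1) by simp
    ultimately show "is_unit d" by (metis dvd_add_right_iff)
  qed
  then have cop: "coprime (if starts_True (item e 0) then - int a else int a) (int b)" by simp
  have "quotient_of (ratio e) = (if starts_True (item e 0) then - int a else int a, int b)"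
    unfolding ratio_def a_def[symmetric] b_def[symmetric] quotient_of_Fract
    using ok cop by (simp add: normalize_def coprime_iff_gcd_eq_1 Let_def)
  then show "code_rat (ratio e) = entry_word e"
    using ok by (auto simp: code_rat_def code_int_def entry_word_def code_nat_val[symmetric] a_def b_def)
  have "real (val (item e 3)) * real b = real a * real L" using ok by (metis of_nat_mult)
  then show "real L * real_of_rat (ratio e) = real_of_int (coef e)"
    using ok unfolding ratio_def coef_def a_def[symmetric] b_def[symmetric]
    by (simp add: of_rat_rat divide_simps mult.commute)
qed

definition udim :: "bool list \<Rightarrow> nat \<Rightarrow> nat" where
  "udim C k = length (item C k)"

abbreviation item2 :: "bool list \<Rightarrow> nat \<Rightarrow> nat \<Rightarrow> bool list" where
  "item2 w i j \<equiv> item (item w i) j"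

abbreviation item3 :: "bool list \<Rightarrow> nat \<Rightarrow> nat \<Rightarrow> nat \<Rightarrow> bool list" where
  "item3 w i j k \<equiv> item (item (item w i) j) k"

abbreviation item4 :: "bool list \<Rightarrow> nat \<Rightarrow> nat \<Rightarrow> nat \<Rightarrow> nat \<Rightarrow> bool list" where
  "item4 w i j k l \<equiv> item (item (item (item w i) j) k) l"

text \<open>The components of a certificate \<open>C\<close> for an instance are the six dimensions in unary, \<open>R\<close>,
  the common denominator \<open>L\<close>, and the tables of entries for \<open>a\<close>, \<open>b\<close>, \<open>A\<close>, \<open>W\<close>, the \<open>B\<^sub>k\<close> and
  the \<open>T\<^sub>k\<close>.\<close>

definition inst_of :: "bool list \<Rightarrow> inst" where
  "inst_of C = \<lparr>dim_mx = udim C 0, dim_mu = udim C 1, dim_my = udim C 2, dim_nx = udim C 3,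
     dim_nu = udim C 4, dim_ny = udim C 5, bnd_R = val (item C 6),
     vec_a = vec (udim C 0) (\<lambda>i. ratio (item2 C 8 i)),
     vec_b = vec (udim C 1) (\<lambda>i. ratio (item2 C 9 i)),
     mat_A = mat (udim C 0) (udim C 3) (\<lambda>(i, j). ratio (item3 C 10 i j)),
     mat_W = mat (udim C 2) (udim C 5) (\<lambda>(i, j). ratio (item3 C 11 i j)),
     mats_B = map (\<lambda>k. mat (udim C 1) (udim C 4) (\<lambda>(i, j). ratio (item4 C 12 k i j))) [0..<udim C 3],
     mats_T = map (\<lambda>k. mat (udim C 2) (udim C 3) (\<lambda>(i, j). ratio (item4 C 13 k i j))) [0..<udim C 4]\<rparr>"

definition inst_ok :: "bool list \<Rightarrow> bool" where
  "inst_ok C \<longleftrightarrow> canonical (item C 6) \<and> 0 < val (item C 7) \<and>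
     (\<forall>i<udim C 0. entry_ok (val (item C 7)) (item2 C 8 i)) \<and>
     (\<forall>i<udim C 1. entry_ok (val (item C 7)) (item2 C 9 i)) \<and>
     (\<forall>i<udim C 0. \<forall>j<udim C 3. entry_ok (val (item C 7)) (item3 C 10 i j)) \<and>
     (\<forall>i<udim C 2. \<forall>j<udim C 5. entry_ok (val (item C 7)) (item3 C 11 i j)) \<and>
     (\<forall>k<udim C 3. \<forall>i<udim C 1. \<forall>j<udim C 4. entry_ok (val (item C 7)) (item4 C 12 k i j)) \<and>
     (\<forall>k<udim C 4. \<forall>i<udim C 2. \<forall>j<udim C 3. entry_ok (val (item C 7)) (item4 C 13 k i j))"

definition inst_word :: "bool list \<Rightarrow> bool list" where
  "inst_word C =
     un (udim C 0) @ False # un (udim C 1) @ False # un (udim C 2) @ False #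
     un (udim C 3) @ False # un (udim C 4) @ False # un (udim C 5) @ False # pr (item C 6) [] @
     concat (map (\<lambda>i. entry_word (item2 C 8 i)) [0..<udim C 0]) @
     concat (map (\<lambda>i. entry_word (item2 C 9 i)) [0..<udim C 1]) @
     concat (map (\<lambda>i. concat (map (\<lambda>j. entry_word (item3 C 10 i j)) [0..<udim C 3])) [0..<udim C 0]) @
     concat (map (\<lambda>i. concat (map (\<lambda>j. entry_word (item3 C 11 i j)) [0..<udim C 5])) [0..<udim C 2]) @
     concat (map (\<lambda>k. concat (map (\<lambda>i. concat (map (\<lambda>j. entry_word (item4 C 12 k i j)) [0..<udim C 4])) [0..<udim C 1])) [0..<udim C 3]) @
     concat (map (\<lambda>k. concat (map (\<lambda>i. concat (map (\<lambda>j. entry_word (item4 C 13 k i j)) [0..<udim C 3])) [0..<udim C 2])) [0..<udim C 4])"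

lemma wf_inst_of: "wf_inst (inst_of C)"
  by (auto simp: wf_inst_def inst_of_def)

lemma list_of_vec_vec: "list_of_vec (vec n f) = map f [0..<n]"
  by (rule nth_equalityI) simp_all

lemma code_vec_vec: "code_vec (vec n f) = concat (map (\<lambda>i. code_rat (f i)) [0..<n])"
  by (simp add: code_vec_def list_of_vec_vec comp_def)

lemma code_mat_mat: "code_mat (mat m n f) = concat (map (\<lambda>i. concat (map (\<lambda>j. code_rat (f (i, j))) [0..<n])) [0..<m])"
proof -
  have "row (mat m n f) i = vec n (\<lambda>j. f (i, j))" if "i < m" for i
    using that by (intro eq_vecI) simp_all
  then show ?thesis 
    by (auto simp: code_mat_def code_vec_vec intro!: arg_cong[of _ _ concat] map_cong)
qed

lemma concat_upt_cong:
  "(\<And>i. i < n \<Longrightarrow> f i = g i) \<Longrightarrow> concat (map f [0..<n]) = concat (map g [0..<n])"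
  by (metis (mono_tags, lifting) atLeastLessThan_iff map_eq_conv set_upt)

lemma code_inst_of:
  assumes "inst_ok C" shows "code_inst (inst_of C) = inst_word C"
proof -
  have e: "code_rat (ratio e) = entry_word e" if "entry_ok (val (item C 7)) e" for e
    using that by (rule entry_ok_ratio(1))
  have "code_inst (inst_of C) =
     un (udim C 0) @ False # un (udim C 1) @ False # un (udim C 2) @ False #
     un (udim C 3) @ False # un (udim C 4) @ False # un (udim C 5) @ False # code_nat (val (item C 6)) @
     concat (map (\<lambda>i. code_rat (ratio (item2 C 8 i))) [0..<udim C 0]) @
     concat (map (\<lambda>i. code_rat (ratio (item2 C 9 i))) [0..<udim C 1]) @
     concat (map (\<lambda>i. concat (map (\<lambda>j. code_rat (ratio (item3 C 10 i j))) [0..<udim C 3])) [0..<udim C 0]) @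
     concat (map (\<lambda>i. concat (map (\<lambda>j. code_rat (ratio (item3 C 11 i j))) [0..<udim C 5])) [0..<udim C 2]) @
     concat (map (\<lambda>k. concat (map (\<lambda>i. concat (map (\<lambda>j. code_rat (ratio (item4 C 12 k i j))) [0..<udim C 4])) [0..<udim C 1])) [0..<udim C 3]) @
     concat (map (\<lambda>k. concat (map (\<lambda>i. concat (map (\<lambda>j. code_rat (ratio (item4 C 13 k i j))) [0..<udim C 3])) [0..<udim C 2])) [0..<udim C 4])"
    by (simp add: code_inst_def inst_of_def code_dim_def code_vec_vec code_mat_mat comp_def)
  also have "\<dots> = inst_word C"
    unfolding inst_word_def
    by (intro arg_cong2[of _ _ _ _ "(@)"] arg_cong2[of _ _ _ _ "(#)"] concat_upt_cong refl e)
      (use assms in \<open>auto simp: inst_ok_def code_nat_val\<close>)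
  finally show ?thesis .
qed

subsection \<open>The constraints with integer coefficients\<close>

text \<open>The product of B(x) and u is bilinear. For fixed \<open>u\<close> its row
  \<open>i\<close> is a linear form in x, and this is the coefficient of coordinate
  \<open>k\<close>, scaled by the common denominator.\<close>

definition row_B :: "bool list \<Rightarrow> (nat \<Rightarrow> nat) \<Rightarrow> nat \<Rightarrow> nat \<Rightarrow> int" where
  "row_B C u i k = (\<Sum>j<udim C 4. coef (item4 C 12 k i j) * int (u j))"

definition row_T :: "bool list \<Rightarrow> (nat \<Rightarrow> nat) \<Rightarrow> nat \<Rightarrow> nat \<Rightarrow> int" where
  "row_T C u i k = (\<Sum>j<udim C 4. coef (item4 C 13 j i k) * int (u j))"

definition rhs_Y :: "bool list \<Rightarrow> (nat \<Rightarrow> nat) \<Rightarrow> nat \<Rightarrow> int" where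
  "rhs_Y C y i = - (\<Sum>j<udim C 5. coef (item3 C 11 i j) * int (y j))"

text \<open>The three families of constraints on \<open>x\<close>, where \<open>S c d\<close> stands for
  \<open>(\<Sum>k. c\<^sub>k x\<^sub>k) \<le> d\<close>.\<close>

definition sys_X :: "bool list \<Rightarrow> ((nat \<Rightarrow> int) \<Rightarrow> int \<Rightarrow> bool) \<Rightarrow> bool" where
  "sys_X C S \<longleftrightarrow> (\<forall>i<udim C 0. S (\<lambda>k. coef (item3 C 10 i k)) (coef (item2 C 8 i)))"

definition sys_U :: "bool list \<Rightarrow> (nat \<Rightarrow> nat) \<Rightarrow> ((nat \<Rightarrow> int) \<Rightarrow> int \<Rightarrow> bool) \<Rightarrow> bool" where
  "sys_U C u S \<longleftrightarrow> (\<forall>j<udim C 4. u j \<le> val (item C 6)) \<and>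
     (\<forall>i<udim C 1. S (row_B C u i) (coef (item2 C 9 i)))"

definition sys_Y :: "bool list \<Rightarrow> (nat \<Rightarrow> nat) \<Rightarrow> (nat \<Rightarrow> nat) \<Rightarrow> ((nat \<Rightarrow> int) \<Rightarrow> int \<Rightarrow> bool) \<Rightarrow> bool" where
  "sys_Y C u y S \<longleftrightarrow> (\<forall>j<udim C 5. y j \<le> val (item C 6)) \<and>
     (\<forall>i<udim C 2. S (row_T C u i) (rhs_Y C y i))"

text \<open>Together with \<open>frac_sat\<close> this instantiates the same systems twice: over the
  reals for the semantics, and with denominators cleared for the verifier.\<close>

definition real_sat :: "nat \<Rightarrow> real vec \<Rightarrow> (nat \<Rightarrow> int) \<Rightarrow> int \<Rightarrow> bool" where
  "real_sat n x c d \<longleftrightarrow> (\<Sum>k<n. real_of_int (c k) * x $ k) \<le> real_of_int d"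

definition frac_sat :: "nat \<Rightarrow> (nat \<Rightarrow> nat) \<Rightarrow> nat \<Rightarrow> (nat \<Rightarrow> int) \<Rightarrow> int \<Rightarrow> bool" where
  "frac_sat n p q c d \<longleftrightarrow> (\<Sum>k<n. c k * int (p k)) \<le> d * int q"

lemma real_sat_frac:
  assumes "0 < q"
  shows "real_sat n (vec n (\<lambda>k. real (p k) / real q)) c d \<longleftrightarrow> frac_sat n p q c d"
proof -
  have "(\<Sum>k<n. real_of_int (c k) * vec n (\<lambda>k. real (p k) / real q) $ k) =
      real_of_int (\<Sum>k<n. c k * int (p k)) / real q"
    by (simp add: sum_divide_distrib)
  then show ?thesis using assms unfolding real_sat_def frac_sat_def
    by (simp add: divide_le_eq flip: of_int_le_iff[where 'a = real])
qed

lemma scaled_le: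
  assumes "L > 0" "real L * a = a'" "real L * b = b'"
  shows "a \<le> b \<longleftrightarrow> a' \<le> b'"
  using assms by (metis mult_le_cancel_left_pos of_nat_0_less_iff)

lemma X_c_iff:
  assumes ok: "inst_ok C" and x: "x \<in> carrier_vec (udim C 3)"
  shows "x \<in> X_c (inst_of C) \<longleftrightarrow> (\<forall>k<udim C 3. 0 \<le> x $ k \<and> x $ k \<le> real (val (item C 6))) \<and>
    sys_X C (real_sat (udim C 3) x)"
proof -
  let ?L = "val (item C 7)"
  have L: "?L > 0" using ok by (simp add: inst_ok_def)
  have "(real_mat (mat_A (inst_of C)) *\<^sub>v x) $ i \<le> real_vec (vec_a (inst_of C)) $ i \<longleftrightarrow>
      real_sat (udim C 3) x (\<lambda>k. coef (item3 C 10 i k)) (coef (item2 C 8 i))" if i: "i < udim C 0" for i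
    unfolding real_sat_def
  proof (rule scaled_le[OF L])
    have e: "real ?L * real_of_rat (ratio (item3 C 10 i k)) = real_of_int (coef (item3 C 10 i k))"
      if "k < udim C 3" for k
      using ok i that by (intro entry_ok_ratio(2)) (auto simp: inst_ok_def)
    have "real ?L * (real_mat (mat_A (inst_of C)) *\<^sub>v x) $ i =
        (\<Sum>k<udim C 3. real ?L * real_of_rat (ratio (item3 C 10 i k)) * x $ k)"
      using i x by (simp add: inst_of_def scalar_prod_def sum_distrib_left atLeast0LessThan mult.assoc)
    then show "real ?L * (real_mat (mat_A (inst_of C)) *\<^sub>v x) $ i =
        (\<Sum>k<udim C 3. real_of_int (coef (item3 C 10 i k)) * x $ k)" using e by simp
    show "real ?L * real_vec (vec_a (inst_of C)) $ i = real_of_int (coef (item2 C 8 i))"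
      using ok i by (auto simp: inst_of_def inst_ok_def intro: entry_ok_ratio(2))
  qed
  then show ?thesis using x
    by (auto simp: X_c_def box_def sys_X_def less_eq_vec_def inst_of_def)
qed

lemma box_int_vecsE:
  assumes "v \<in> box n R \<inter> int_vecs n"
  obtains u where "v = vec n (\<lambda>j. real (u j))" "\<And>j. j < n \<Longrightarrow> u j \<le> R"
proof -
  have v: "v \<in> carrier_vec n" "\<And>j. j < n \<Longrightarrow> 0 \<le> v $ j \<and> v $ j \<le> real R \<and> v $ j \<in> \<int>"
    using assms by (auto simp: box_def int_vecs_def)
  have e: "real (nat \<lfloor>v $ j\<rfloor>) = v $ j" if "j < n" for j
    using v(2)[OF that] by (auto elim!: Ints_cases)
  show ?thesis
  proof (rule that[of "\<lambda>j. nat \<lfloor>v $ j\<rfloor>"])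
    show "v = vec n (\<lambda>j. real (nat \<lfloor>v $ j\<rfloor>))" using e v(1) by (intro eq_vecI) auto
    fix j assume "j < n"
    then show "nat \<lfloor>v $ j\<rfloor> \<le> R" using e[of j] v(2)[of j] by (metis of_nat_le_iff)
  qed
qed

lemma U_d_iff:
  assumes ok: "inst_ok C" and x: "x \<in> carrier_vec (udim C 3)"
  shows "vec (udim C 4) (\<lambda>j. real (u j)) \<in> U_d (inst_of C) x \<longleftrightarrow> sys_U C u (real_sat (udim C 3) x)"
proof -
  let ?L = "val (item C 7)" and ?u = "vec (udim C 4) (\<lambda>j. real (u j))"
  have L: "?L > 0" using ok by (simp add: inst_ok_def)
  have "(B_of (inst_of C) x *\<^sub>v ?u) $ i \<le> real_vec (vec_b (inst_of C)) $ i \<longleftrightarrow>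
      real_sat (udim C 3) x (row_B C u i) (coef (item2 C 9 i))" if i: "i < udim C 1" for i
    unfolding real_sat_def
  proof (rule scaled_le[OF L])
    have e: "real ?L * real_of_rat (ratio (item4 C 12 k i j)) = real_of_int (coef (item4 C 12 k i j))"
      if "k < udim C 3" "j < udim C 4" for k j
      using ok i that by (intro entry_ok_ratio(2)) (auto simp: inst_ok_def)
    have "real ?L * (B_of (inst_of C) x *\<^sub>v ?u) $ i =
        (\<Sum>j<udim C 4. \<Sum>k<udim C 3. (real ?L * real_of_rat (ratio (item4 C 12 k i j))) * (x $ k * real (u j)))"
      using i by (simp add: B_of_def lin_mat_def inst_of_def scalar_prod_def sum_distrib_left sum_distrib_right
          atLeast0LessThan ac_simps)
    \<comment> \<open>The bilinear form is regrouped by the coordinates of x.\<close>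
    also have "\<dots> = (\<Sum>k<udim C 3. \<Sum>j<udim C 4. (real ?L * real_of_rat (ratio (item4 C 12 k i j))) * (x $ k * real (u j)))"
      by (rule sum.swap)
    also have "\<dots> = (\<Sum>k<udim C 3. real_of_int (row_B C u i k) * x $ k)"
      using e by (simp add: row_B_def sum_distrib_left sum_distrib_right ac_simps)
    finally show "real ?L * (B_of (inst_of C) x *\<^sub>v ?u) $ i = (\<Sum>k<udim C 3. real_of_int (row_B C u i k) * x $ k)" .
    show "real ?L * real_vec (vec_b (inst_of C)) $ i = real_of_int (coef (item2 C 9 i))"
      using ok i by (auto simp: inst_of_def inst_ok_def intro: entry_ok_ratio(2))
  qed
  then show ?thesis using x
    by (auto simp: U_d_def box_def int_vecs_def sys_U_def less_eq_vec_def inst_of_def B_of_def lin_mat_def)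
qed

lemma Y_d_iff:
  assumes ok: "inst_ok C" and x: "x \<in> carrier_vec (udim C 3)"
  shows "vec (udim C 5) (\<lambda>j. real (y j)) \<in> Y_d (inst_of C) x (vec (udim C 4) (\<lambda>j. real (u j))) \<longleftrightarrow>
    sys_Y C u y (real_sat (udim C 3) x)"
proof -
  let ?L = "val (item C 7)" and ?u = "vec (udim C 4) (\<lambda>j. real (u j))" and ?y = "vec (udim C 5) (\<lambda>j. real (y j))"
  let ?T = "T_of (inst_of C) ?u *\<^sub>v x" and ?W = "real_mat (mat_W (inst_of C)) *\<^sub>v ?y"
  have L: "?L > 0" using ok by (simp add: inst_ok_def)
  have dims: "dim_vec ?T = udim C 2" "dim_vec ?W = udim C 2"
    by (simp_all add: T_of_def lin_mat_def inst_of_def)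
  have "(?T + ?W) $ i \<le> 0\<^sub>v (udim C 2) $ i \<longleftrightarrow>
      real_sat (udim C 3) x (row_T C u i) (rhs_Y C y i)" if i: "i < udim C 2" for i
  proof -
    have e: "real ?L * real_of_rat (ratio (item4 C 13 k i j)) = real_of_int (coef (item4 C 13 k i j))"
      if "k < udim C 4" "j < udim C 3" for k j
      using ok i that by (intro entry_ok_ratio(2)) (auto simp: inst_ok_def)
    have e': "real ?L * real_of_rat (ratio (item3 C 11 i k)) = real_of_int (coef (item3 C 11 i k))"
      if "k < udim C 5" for k
      using ok i that by (intro entry_ok_ratio(2)) (auto simp: inst_ok_def)
    have "real ?L * ?T $ i =
        (\<Sum>k<udim C 3. \<Sum>j<udim C 4. (real ?L * real_of_rat (ratio (item4 C 13 j i k))) * (x $ k * real (u j)))"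
      using i x by (simp add: T_of_def lin_mat_def inst_of_def scalar_prod_def sum_distrib_left sum_distrib_right
          atLeast0LessThan ac_simps)
    also have "\<dots> = (\<Sum>k<udim C 3. real_of_int (row_T C u i k) * x $ k)"
      using e by (simp add: row_T_def sum_distrib_left sum_distrib_right ac_simps)
    finally have T: "real ?L * ?T $ i = (\<Sum>k<udim C 3. real_of_int (row_T C u i k) * x $ k)" .
    have "real ?L * ?W $ i = (\<Sum>k<udim C 5. real ?L * real_of_rat (ratio (item3 C 11 i k)) * real (y k))"
      using i by (simp add: inst_of_def scalar_prod_def sum_distrib_left atLeast0LessThan mult.assoc)
    then have W: "real ?L * ?W $ i = - real_of_int (rhs_Y C y i)" using e' by (simp add: rhs_Y_def)
    have "?T $ i \<le> - ?W $ i \<longleftrightarrow> real_sat (udim C 3) x (row_T C u i) (rhs_Y C y i)"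
      unfolding real_sat_def by (rule scaled_le[OF L T]) (use W in simp)
    moreover have "(?T + ?W) $ i = ?T $ i + ?W $ i" using i dims by simp
    ultimately show ?thesis using i by auto
  qed
  then show ?thesis using dims
    by (auto simp: Y_d_def box_def int_vecs_def sys_Y_def less_eq_vec_def inst_of_def)
qed

section \<open>The verifier\<close>

text \<open>\<open>X\<close> lists a denominator \<open>q\<close> and the numerators \<open>p\<^sub>k\<close> of \<open>x\<close>, \<open>Y\<close> lists \<open>u\<close>, and \<open>Z\<close> consists of
  a certificate for the instance and a list of the \<open>y\<^sub>j\<close>. As every word can be read as a list of
  numbers, no check of the format is needed.\<close>

definition verify :: "bool list \<Rightarrow> bool list \<Rightarrow> bool list \<Rightarrow> bool list \<Rightarrow> bool" where
  "verify I X Y Z \<longleftrightarrow>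
    (let C = item Z 0; n = udim C 3; q = val (item X 0); p = \<lambda>k. val (item2 X 1 k);
       u = \<lambda>j. val (item Y j); y = \<lambda>j. val (item2 Z 1 j)
     in inst_ok C \<and> I = inst_word C \<and> 0 < q \<and> (\<forall>k<n. p k \<le> val (item C 6) * q) \<and>
       sys_X C (frac_sat n p q) \<and> (sys_U C u (frac_sat n p q) \<longrightarrow> sys_Y C u y (frac_sat n p q)))"

lemma FU_udim [fp_intros]: "FP c \<Longrightarrow> FU (\<lambda>x. udim (c x) k)"
  unfolding udim_def by (intro fp_intros)

lemma FB_inst_ok [fp_intros]: "FP c \<Longrightarrow> FB (\<lambda>x. inst_ok (c x))"
proof -
  have "FB inst_ok" unfolding inst_ok_def by (intro fp_intros)
  then show "FP c \<Longrightarrow> FB (\<lambda>x. inst_ok (c x))" by (rule FB_comp)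
qed

lemma FP_inst_word [fp_intros]: "FP c \<Longrightarrow> FP (\<lambda>x. inst_word (c x))"
proof -
  have "FP inst_word" unfolding inst_word_def by (intro fp_intros)
  then show "FP c \<Longrightarrow> FP (\<lambda>x. inst_word (c x))" by (rule FP_comp)
qed

lemma FB_verify: "FB (\<lambda>w. verify (item w 0) (item w 1) (item w 2) (item w 3))"
  unfolding verify_def Let_def sys_X_def sys_U_def sys_Y_def frac_sat_def row_B_def row_T_def rhs_Y_def
  by (intro fp_intros)

section \<open>Construction of short certificates\<close>

lemma code_tuple_Cons: "code_tuple (w # ws) = pr w (code_tuple ws)"
  by (simp add: code_tuple_def pr_def)

lemma item_code_tuple: "i < length ws \<Longrightarrow> item (code_tuple ws) i = ws ! i"
proof (induction ws arbitrary: i)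
  case (Cons w ws)
  then show ?case
    by (cases i) (auto simp: item_def code_tuple_Cons funpow_Suc_right simp del: funpow.simps(2))
qed simp

lemma length_code_tuple:
  assumes "\<And>w. w \<in> set ws \<Longrightarrow> length w \<le> B" "length ws \<le> n"
  shows "length (code_tuple ws) \<le> n * (2 * B + 1)"
proof -
  have "length (code_tuple ws) \<le> length ws * (2 * B + 1)"
    using assms(1)
  proof (induction ws)
    case (Cons w ws)
    have "length w \<le> B" "length (code_tuple ws) \<le> length ws * (2 * B + 1)"
      using Cons by simp_all
    then show ?case by (simp add: code_tuple_Cons)
  qed (simp add: code_tuple_def)
  also have "\<dots> \<le> n * (2 * B + 1)" using assms(2) by (rule mult_le_mono1)
  finally show ?thesis .
qed

lemma length_code_table:
  "(\<And>i. i < m \<Longrightarrow> length (f i) \<le> B) \<Longrightarrow> m \<le> n \<Longrightarrow>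
    length (code_tuple (map f [0..<m])) \<le> n * (2 * B + 1)"
  by (rule length_code_tuple) auto

lemma length_nat_bits: "n < 2 ^ k \<Longrightarrow> length (nat_bits n) \<le> k"
proof (induction k arbitrary: n)
  case (Suc k)
  then show ?case by (cases "n = 0") (auto simp: nat_bits_pos)
qed simp

lemma less_length_nat_bits: "n < 2 ^ length (nat_bits n)"
  using val_less[of "nat_bits n"] by simp

text \<open>Taking for \<open>s\<close> the residue of minus the inverse of \<open>a\<close> modulo
  \<open>b\<close> makes it smaller than \<open>b\<close>, and then \<open>t\<close> is bounded as
  well. So the witnesses are about as short as the fraction. The form of the identity avoids
  subtraction.\<close>

lemma small_bezout:
  fixes a b :: nat
  assumes "coprime a b" "0 < b"
  shows "\<exists>s t. s * a + 1 = t * b \<and> s < b \<and> t \<le> a + 1"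
proof -
  obtain x where x: "[int a * x = 1] (mod int b)"
    using cong_solve_coprime_int[of "int a" "int b"] assms(1) by auto
  define s where "s = nat ((- x) mod int b)"
  have s: "int s = (- x) mod int b" "s < b" using assms(2) by (simp_all add: s_def nat_less_iff)
  have "[int a * int s + 1 = int a * (- x) + 1] (mod int b)"
    unfolding s(1) by (intro cong_add cong_mult cong_refl) (simp add: cong_def)
  also have "[int a * (- x) + 1 = - 1 + 1] (mod int b)"
    using x by (intro cong_add cong_refl) (metis cong_minus_minus_iff mult_minus_right)
  finally have "int b dvd int (s * a + 1)" by (simp add: cong_0_iff mult.commute add.commute)
  then have "b dvd s * a + 1" unfolding int_dvd_int_iff .
  then obtain t where t: "s * a + 1 = t * b" by (metis dvd_def mult.commute)
  have "s * a + 1 \<le> b * a + b" using mult_le_mono1[of s b a] s(2) assms(2) by linarith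
  then have "t * b \<le> (a + 1) * b" using t by (simp add: algebra_simps)
  then have "t \<le> a + 1" using assms(2) unfolding mult_le_cancel2 by blast
  then show ?thesis using t s(2) by blast
qed

definition rat_num :: "rat \<Rightarrow> nat" where
  "rat_num r = nat \<bar>fst (quotient_of r)\<bar>"

definition rat_den :: "rat \<Rightarrow> nat" where
  "rat_den r = nat (snd (quotient_of r))"

definition bezout_pair :: "nat \<Rightarrow> nat \<Rightarrow> nat \<times> nat" where
  "bezout_pair a b = (SOME st. fst st * a + 1 = snd st * b \<and> fst st < b \<and> snd st \<le> a + 1)"

lemma rat_den_pos: "0 < rat_den r"
  using quotient_of_denom_pos'[of r] by (simp add: rat_den_def)

lemma coprime_rat_num_den: "coprime (rat_num r) (rat_den r)"
proof -
  have "coprime (fst (quotient_of r)) (snd (quotient_of r))"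
    by (metis prod.collapse quotient_of_coprime)
  then show ?thesis using quotient_of_denom_pos'[of r]
    by (simp add: rat_num_def rat_den_def coprime_nat_abs_left_iff flip: coprime_int_iff)
qed

lemma bezout_pair:
  "fst (bezout_pair (rat_num r) (rat_den r)) * rat_num r + 1 = snd (bezout_pair (rat_num r) (rat_den r)) * rat_den r"
  "fst (bezout_pair (rat_num r) (rat_den r)) < rat_den r"
  "snd (bezout_pair (rat_num r) (rat_den r)) \<le> rat_num r + 1"
proof -
  have "\<exists>st. fst st * rat_num r + 1 = snd st * rat_den r \<and> fst st < rat_den r \<and> snd st \<le> rat_num r + 1"
    using small_bezout[OF coprime_rat_num_den rat_den_pos] by auto
  from someI_ex[OF this] show
    "fst (bezout_pair (rat_num r) (rat_den r)) * rat_num r + 1 = snd (bezout_pair (rat_num r) (rat_den r)) * rat_den r"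
    "fst (bezout_pair (rat_num r) (rat_den r)) < rat_den r"
    "snd (bezout_pair (rat_num r) (rat_den r)) \<le> rat_num r + 1"
    by (auto simp: bezout_pair_def)
qed

text \<open>The division is exact when the denominator divides \<open>L\<close>. It happens only
  here, outside the verifier, which confirms the result by multiplication.\<close>

definition entry :: "nat \<Rightarrow> rat \<Rightarrow> bool list" where
  "entry L r = code_tuple [[r < 0], nat_bits (rat_num r), nat_bits (rat_den r),
     nat_bits (rat_num r * (L div rat_den r)),
     nat_bits (fst (bezout_pair (rat_num r) (rat_den r))),
     nat_bits (snd (bezout_pair (rat_num r) (rat_den r)))]"

lemma item_entry:
  "item (entry L r) 0 = [r < 0]" "item (entry L r) (Suc 0) = nat_bits (rat_num r)"
  "item (entry L r) 2 = nat_bits (rat_den r)" "item (entry L r) 3 = nat_bits (rat_num r * (L div rat_den r))"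
  "item (entry L r) 4 = nat_bits (fst (bezout_pair (rat_num r) (rat_den r)))"
  "item (entry L r) 5 = nat_bits (snd (bezout_pair (rat_num r) (rat_den r)))"
  by (simp_all add: entry_def item_code_tuple)

lemma rat_eq_num_den: "r = Rat.Fract (if r < 0 then - int (rat_num r) else int (rat_num r)) (int (rat_den r))"
proof -
  obtain a b where q: "quotient_of r = (a, b)" by fastforce
  have b: "b > 0" using q by (rule quotient_of_denom_pos)
  have r: "r = Rat.Fract a b" using quotient_of_div[OF q] by (simp add: Rat.Fract_of_int_quotient)
  have "r < 0 \<longleftrightarrow> a < 0" unfolding r using b by (simp add: Rat.Fract_less_zero_iff)
  then have "(if r < 0 then - int (rat_num r) else int (rat_num r)) = a" "int (rat_den r) = b"
    using b q by (auto simp: rat_num_def rat_den_def)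
  then show ?thesis using r by simp
qed

lemma ratio_entry: "ratio (entry L r) = r"
proof -
  have "ratio (entry L r) = Rat.Fract (if r < 0 then - int (rat_num r) else int (rat_num r)) (int (rat_den r))"
    by (simp add: ratio_def item_entry)
  also have "\<dots> = r" by (rule rat_eq_num_den[symmetric])
  finally show ?thesis .
qed

lemma entry_ok_entry:
  assumes "rat_den r dvd L" shows "entry_ok L (entry L r)"
proof -
  have "r < 0 \<Longrightarrow> 0 < rat_num r"
    using rat_eq_num_den[of r] by (intro Nat.gr0I) (simp add: Zero_rat_def[symmetric] rat_number_collapse)
  then show ?thesis using assms bezout_pair(1)[of r] rat_den_pos[of r]
    by (auto simp: entry_ok_def item_entry canonical_nat_bits mult.assoc)
qed

text \<open>The six components have at most 1, N, N, 2N, N and N + 1 bits. The tuple code doubles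
  their sum 6N + 2 and adds six end markers.\<close>

lemma length_entry:
  assumes "rat_num r < 2 ^ N" "rat_den r < 2 ^ N" "L \<le> 2 ^ N"
  shows "length (entry L r) \<le> 12 * N + 10"
proof -
  let ?s = "fst (bezout_pair (rat_num r) (rat_den r))" and ?t = "snd (bezout_pair (rat_num r) (rat_den r))"
  have s: "?s < 2 ^ N" using bezout_pair(2)[of r] assms(2) by simp
  have "?t \<le> 2 ^ N" using bezout_pair(3)[of r] assms(1) by simp
  then have t: "?t < 2 ^ (N + 1)" by (rule le_less_trans) simp
  have "rat_num r * (L div rat_den r) \<le> rat_num r * L" by simp
  also have "\<dots> \<le> rat_num r * 2 ^ N" using assms(3) by simp
  also have "\<dots> < 2 ^ N * 2 ^ N" using assms(1) by simp
  finally have "rat_num r * (L div rat_den r) < 2 ^ (2 * N)" by (simp add: power_add mult_2)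
  then show ?thesis
    using length_nat_bits[OF assms(1)] length_nat_bits[OF assms(2)] length_nat_bits[OF s]
      length_nat_bits[OF t] length_nat_bits[of "rat_num r * (L div rat_den r)" "2 * N"]
    by (simp add: entry_def code_tuple_Cons) (simp add: code_tuple_def)
qed

lemma abs_coef_entry:
  assumes "rat_num r < 2 ^ N" "L \<le> 2 ^ N"
  shows "\<bar>coef (entry L r)\<bar> \<le> 2 ^ (2 * N)"
proof -
  have "rat_num r * (L div rat_den r) \<le> rat_num r * L" by simp
  also have "\<dots> \<le> 2 ^ N * 2 ^ N" using assms by (intro mult_mono) simp_all
  finally have "int (rat_num r * (L div rat_den r)) \<le> int (2 ^ N * 2 ^ N)" by (rule of_nat_mono)
  then show ?thesis by (auto simp: coef_def item_entry power_add mult_2)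
qed

definition inst_cert :: "nat \<Rightarrow> inst \<Rightarrow> bool list" where
  "inst_cert L J = code_tuple [un (dim_mx J), un (dim_mu J), un (dim_my J), un (dim_nx J),
     un (dim_nu J), un (dim_ny J), nat_bits (bnd_R J), nat_bits L,
     code_tuple (map (\<lambda>i. entry L (vec_a J $ i)) [0..<dim_mx J]),
     code_tuple (map (\<lambda>i. entry L (vec_b J $ i)) [0..<dim_mu J]),
     code_tuple (map (\<lambda>i. code_tuple (map (\<lambda>j. entry L (mat_A J $$ (i, j))) [0..<dim_nx J])) [0..<dim_mx J]),
     code_tuple (map (\<lambda>i. code_tuple (map (\<lambda>j. entry L (mat_W J $$ (i, j))) [0..<dim_ny J])) [0..<dim_my J]),
     code_tuple (map (\<lambda>k. code_tuple (map (\<lambda>i. code_tuple (map (\<lambda>j.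
       entry L ((mats_B J ! k) $$ (i, j))) [0..<dim_nu J])) [0..<dim_mu J])) [0..<dim_nx J]),
     code_tuple (map (\<lambda>k. code_tuple (map (\<lambda>i. code_tuple (map (\<lambda>j.
       entry L ((mats_T J ! k) $$ (i, j))) [0..<dim_nx J])) [0..<dim_my J])) [0..<dim_nu J])]"

lemma udim_inst_cert [simp]:
  "udim (inst_cert L J) 0 = dim_mx J" "udim (inst_cert L J) (Suc 0) = dim_mu J"
  "udim (inst_cert L J) 2 = dim_my J" "udim (inst_cert L J) 3 = dim_nx J"
  "udim (inst_cert L J) 4 = dim_nu J" "udim (inst_cert L J) 5 = dim_ny J"
  by (simp_all add: udim_def inst_cert_def item_code_tuple)

lemma item_inst_cert [simp]:
  "item (inst_cert L J) 6 = nat_bits (bnd_R J)" "item (inst_cert L J) 7 = nat_bits L"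
  "i < dim_mx J \<Longrightarrow> item2 (inst_cert L J) 8 i = entry L (vec_a J $ i)"
  "i < dim_mu J \<Longrightarrow> item2 (inst_cert L J) 9 i = entry L (vec_b J $ i)"
  "i < dim_mx J \<Longrightarrow> j < dim_nx J \<Longrightarrow> item3 (inst_cert L J) 10 i j = entry L (mat_A J $$ (i, j))"
  "i < dim_my J \<Longrightarrow> j < dim_ny J \<Longrightarrow> item3 (inst_cert L J) 11 i j = entry L (mat_W J $$ (i, j))"
  "k < dim_nx J \<Longrightarrow> i < dim_mu J \<Longrightarrow> j < dim_nu J \<Longrightarrow>
     item4 (inst_cert L J) 12 k i j = entry L ((mats_B J ! k) $$ (i, j))"
  "k < dim_nu J \<Longrightarrow> i < dim_my J \<Longrightarrow> j < dim_nx J \<Longrightarrow>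
     item4 (inst_cert L J) 13 k i j = entry L ((mats_T J ! k) $$ (i, j))"
  by (simp_all add: inst_cert_def item_code_tuple)

lemma inst_of_inst_cert:
  assumes "wf_inst J" shows "inst_of (inst_cert L J) = J"
proof -
  note wf = assms[unfolded wf_inst_def]
  have "mats_B J ! k \<in> carrier_mat (dim_mu J) (dim_nu J)" if "k < dim_nx J" for k
    using wf that nth_mem[of k "mats_B J"] by (metis subsetD)
  then have B: "dim_row (mats_B J ! k) = dim_mu J" "dim_col (mats_B J ! k) = dim_nu J" if "k < dim_nx J" for k
    using that by (metis carrier_matD)+
  have "mats_T J ! k \<in> carrier_mat (dim_my J) (dim_nx J)" if "k < dim_nu J" for k
    using wf that nth_mem[of k "mats_T J"] by (metis subsetD)
  then have T: "dim_row (mats_T J ! k) = dim_my J" "dim_col (mats_T J ! k) = dim_nx J" if "k < dim_nu J" for k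
    using that by (metis carrier_matD)+
  have "vec (dim_mx J) (\<lambda>i. ratio (item2 (inst_cert L J) 8 i)) = vec_a J"
    "vec (dim_mu J) (\<lambda>i. ratio (item2 (inst_cert L J) 9 i)) = vec_b J"
    "mat (dim_mx J) (dim_nx J) (\<lambda>(i, j). ratio (item3 (inst_cert L J) 10 i j)) = mat_A J"
    "mat (dim_my J) (dim_ny J) (\<lambda>(i, j). ratio (item3 (inst_cert L J) 11 i j)) = mat_W J"
    using wf by (auto simp: ratio_entry intro!: eq_vecI eq_matI)
  moreover have "map (\<lambda>k. mat (dim_mu J) (dim_nu J) (\<lambda>(i, j). ratio (item4 (inst_cert L J) 12 k i j))) [0..<dim_nx J] = mats_B J"
    using wf B by (auto simp: ratio_entry intro!: nth_equalityI eq_matI)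
  moreover have "map (\<lambda>k. mat (dim_my J) (dim_nx J) (\<lambda>(i, j). ratio (item4 (inst_cert L J) 13 k i j))) [0..<dim_nu J] = mats_T J"
    using wf T by (auto simp: ratio_entry intro!: nth_equalityI eq_matI)
  ultimately show ?thesis by (intro inst.equality) (simp_all add: inst_of_def)
qed

section \<open>Size of an instance and of its certificate\<close>

definition mat_entries :: "rat mat \<Rightarrow> rat list" where
  "mat_entries A = concat (map (\<lambda>i. list_of_vec (row A i)) [0..<dim_row A])"

definition entries :: "inst \<Rightarrow> rat list" where
  "entries J = list_of_vec (vec_a J) @ list_of_vec (vec_b J) @ mat_entries (mat_A J) @
     mat_entries (mat_W J) @ concat (map mat_entries (mats_B J)) @ concat (map mat_entries (mats_T J))"

lemma in_list_of_vec: "i < dim_vec v \<Longrightarrow> v $ i \<in> set (list_of_vec v)"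
  by (metis length_list_of_vec list_of_vec_index nth_mem)

lemma in_mat_entries: "i < dim_row A \<Longrightarrow> j < dim_col A \<Longrightarrow> A $$ (i, j) \<in> set (mat_entries A)"
  using in_list_of_vec[of j "row A i"] by (auto simp: mat_entries_def)

lemma in_entries:
  assumes "wf_inst J"
  shows "i < dim_mx J \<Longrightarrow> vec_a J $ i \<in> set (entries J)"
    "i < dim_mu J \<Longrightarrow> vec_b J $ i \<in> set (entries J)"
    "i < dim_mx J \<Longrightarrow> j < dim_nx J \<Longrightarrow> mat_A J $$ (i, j) \<in> set (entries J)"
    "i < dim_my J \<Longrightarrow> j < dim_ny J \<Longrightarrow> mat_W J $$ (i, j) \<in> set (entries J)"
    "k < dim_nx J \<Longrightarrow> i < dim_mu J \<Longrightarrow> j < dim_nu J \<Longrightarrow> (mats_B J ! k) $$ (i, j) \<in> set (entries J)"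
    "k < dim_nu J \<Longrightarrow> i < dim_my J \<Longrightarrow> j < dim_nx J \<Longrightarrow> (mats_T J ! k) $$ (i, j) \<in> set (entries J)"
proof -
  note wf = assms[unfolded wf_inst_def]
  show "i < dim_mx J \<Longrightarrow> vec_a J $ i \<in> set (entries J)"
    "i < dim_mu J \<Longrightarrow> vec_b J $ i \<in> set (entries J)"
    "i < dim_mx J \<Longrightarrow> j < dim_nx J \<Longrightarrow> mat_A J $$ (i, j) \<in> set (entries J)"
    "i < dim_my J \<Longrightarrow> j < dim_ny J \<Longrightarrow> mat_W J $$ (i, j) \<in> set (entries J)"
    using wf in_list_of_vec[of i "vec_a J"] in_list_of_vec[of i "vec_b J"]
      in_mat_entries[of i "mat_A J" j] in_mat_entries[of i "mat_W J" j]
    by (auto simp: entries_def)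
  show "k < dim_nx J \<Longrightarrow> i < dim_mu J \<Longrightarrow> j < dim_nu J \<Longrightarrow> (mats_B J ! k) $$ (i, j) \<in> set (entries J)"
  proof -
    assume k: "k < dim_nx J" "i < dim_mu J" "j < dim_nu J"
    then have "mats_B J ! k \<in> set (mats_B J)" using wf by simp
    moreover from this have "mats_B J ! k \<in> carrier_mat (dim_mu J) (dim_nu J)" using wf by blast
    then have "(mats_B J ! k) $$ (i, j) \<in> set (mat_entries (mats_B J ! k))"
      using k by (intro in_mat_entries) auto
    ultimately show ?thesis by (auto simp: entries_def)
  qed
  show "k < dim_nu J \<Longrightarrow> i < dim_my J \<Longrightarrow> j < dim_nx J \<Longrightarrow> (mats_T J ! k) $$ (i, j) \<in> set (entries J)"
  proof -
    assume k: "k < dim_nu J" "i < dim_my J" "j < dim_nx J"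
    then have "mats_T J ! k \<in> set (mats_T J)" using wf by simp
    moreover from this have "mats_T J ! k \<in> carrier_mat (dim_my J) (dim_nx J)" using wf by blast
    then have "(mats_T J ! k) $$ (i, j) \<in> set (mat_entries (mats_T J ! k))"
      using k by (intro in_mat_entries) auto
    ultimately show ?thesis by (auto simp: entries_def)
  qed
qed

lemma code_mat_entries: "code_mat A = concat (map code_rat (mat_entries A))"
proof -
  have "concat (map (\<lambda>i. concat (map f (g i))) is) = concat (map f (concat (map g is)))"
    for f :: "'a \<Rightarrow> 'b list" and g :: "'c \<Rightarrow> 'a list" and "is"
    by (induction "is") simp_all
  then show ?thesis by (simp add: code_mat_def mat_entries_def code_vec_def)
qed

text \<open>The source of all size estimates: dimensions, bit lengths of R and of every entry, and
  the sum of the latter are bounded by the length of the code.\<close>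

lemma length_code_inst:
  "length (code_inst J) = dim_mx J + dim_mu J + dim_my J + dim_nx J + dim_nu J + dim_ny J + 6 +
     (2 * length (nat_bits (bnd_R J)) + 1) + sum_list (map (\<lambda>r. length (code_rat r)) (entries J))"
proof -
  have w: "length (code_word w) = 2 * length w + 1" for w
    by (induction w) (simp_all add: code_word_simps)
  have m: "length (code_mat A) = sum_list (map (\<lambda>r. length (code_rat r)) (mat_entries A))" for A
    by (simp add: code_mat_entries length_concat comp_def)
  have ms: "(\<Sum>A\<leftarrow>As. \<Sum>r\<leftarrow>mat_entries A. length (code_rat r)) =
      (\<Sum>r\<leftarrow>concat (map mat_entries As). length (code_rat r))" for As
    by (induction As) simp_all
  show ?thesis
    by (simp add: code_inst_def entries_def code_dim_def code_nat_def code_vec_def w m ms length_concat comp_def)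
qed

lemma entry_size:
  "length (nat_bits (rat_num r)) \<le> length (code_rat r)" "length (nat_bits (rat_den r)) \<le> length (code_rat r)"
proof -
  have w: "length (code_word w) = 2 * length w + 1" for w
    by (induction w) (simp_all add: code_word_simps)
  show "length (nat_bits (rat_num r)) \<le> length (code_rat r)" "length (nat_bits (rat_den r)) \<le> length (code_rat r)"
    using quotient_of_denom_pos'[of r]
    by (simp_all add: code_rat_def code_int_def code_nat_def w rat_num_def rat_den_def)
qed

text \<open>The full product serves in place of the least common multiple: its bit length is at most
  the sum of those of the denominators, hence at most the code length.\<close>

definition common_den :: "inst \<Rightarrow> nat" where
  "common_den J = prod_list (map rat_den (entries J))"

lemma common_den_pos: "0 < common_den J"
proof -
  have "0 < prod_list (map rat_den rs)" for rs by (induction rs) (simp_all add: rat_den_pos)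
  then show ?thesis by (simp add: common_den_def)
qed

lemma common_den_le: "common_den J \<le> 2 ^ length (code_inst J)"
proof -
  have "prod_list (map rat_den rs) \<le> 2 ^ sum_list (map (\<lambda>r. length (code_rat r)) rs)" for rs
  proof (induction rs)
    case (Cons r rs)
    have "rat_den r \<le> 2 ^ length (nat_bits (rat_den r))" using less_length_nat_bits by (rule less_imp_le)
    also have "\<dots> \<le> 2 ^ length (code_rat r)" using entry_size(2) by (intro power_increasing) simp_all
    finally show ?case using Cons.IH by (simp add: power_add mult_mono)
  qed simp
  then have "common_den J \<le> 2 ^ sum_list (map (\<lambda>r. length (code_rat r)) (entries J))"
    by (simp add: common_den_def)
  also have "\<dots> \<le> 2 ^ length (code_inst J)" by (intro power_increasing) (simp_all add: length_code_inst)
  finally show ?thesis .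
qed

lemma entry_facts:
  assumes "r \<in> set (entries J)"
  shows "rat_den r dvd common_den J" "rat_num r < 2 ^ length (code_inst J)" "rat_den r < 2 ^ length (code_inst J)"
proof -
  show "rat_den r dvd common_den J" using assms by (simp add: common_den_def prod_list_dvd)
  have "length (code_rat r) \<le> sum_list (map (\<lambda>r. length (code_rat r)) (entries J))"
    using assms by (intro member_le_sum_list) auto
  then have "length (code_rat r) \<le> length (code_inst J)" by (simp add: length_code_inst)
  then have "length (nat_bits (rat_num r)) \<le> length (code_inst J)" "length (nat_bits (rat_den r)) \<le> length (code_inst J)"
    using entry_size[of r] by simp_all
  then show "rat_num r < 2 ^ length (code_inst J)" "rat_den r < 2 ^ length (code_inst J)"
    by (auto intro: less_le_trans[OF less_length_nat_bits] power_increasing)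
qed

lemma bnd_R_less: "bnd_R J < 2 ^ length (code_inst J)"
proof -
  have "length (nat_bits (bnd_R J)) \<le> length (code_inst J)" by (simp add: length_code_inst)
  then show ?thesis by (intro less_le_trans[OF less_length_nat_bits] power_increasing) simp_all
qed

abbreviation cert :: "inst \<Rightarrow> bool list" where
  "cert J \<equiv> inst_cert (common_den J) J"

lemma inst_ok_cert:
  assumes "wf_inst J" shows "inst_ok (cert J)"
  using in_entries[OF assms] common_den_pos[of J]
  by (auto simp: inst_ok_def canonical_nat_bits intro!: entry_ok_entry entry_facts(1))

lemma length_cert:
  assumes "wf_inst J" "N = length (code_inst J)"
  shows "length (cert J) \<le> 14 * (2 * (N + 1 + (12 * N + 10) + N * (2 * (12 * N + 10) + 1) +
    N * (2 * (N * (2 * (12 * N + 10) + 1)) + 1) +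
    N * (2 * (N * (2 * (N * (2 * (12 * N + 10) + 1)) + 1)) + 1)) + 1)"
proof -
  \<comment> \<open>Bounds for one entry and for tables nested once, twice and three times.\<close>
  define E where "E = 12 * N + 10"
  define V where "V = N * (2 * E + 1)"
  define M where "M = N * (2 * V + 1)"
  define T where "T = N * (2 * M + 1)"
  have e: "length (entry (common_den J) r) \<le> E" if "r \<in> set (entries J)" for r
    unfolding E_def assms(2) using entry_facts[OF that] common_den_le by (intro length_entry)
  note e' = in_entries[OF assms(1), THEN e]
  have d: "dim_mx J \<le> N" "dim_mu J \<le> N" "dim_my J \<le> N" "dim_nx J \<le> N" "dim_nu J \<le> N" "dim_ny J \<le> N"
    unfolding assms(2) length_code_inst by simp_all
  have R: "length (nat_bits (bnd_R J)) \<le> N" unfolding assms(2) length_code_inst by simp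
  have "common_den J < 2 ^ (N + 1)"
    using common_den_le[of J] unfolding assms(2) by (rule le_less_trans) simp
  then have L: "length (nat_bits (common_den J)) \<le> N + 1" by (rule length_nat_bits)
  have "length (cert J) \<le> 14 * (2 * (N + 1 + E + V + M + T) + 1)"
    unfolding inst_cert_def
  proof (rule length_code_tuple)
    fix w
    have v: "length (code_tuple (map (\<lambda>i. entry (common_den J) (vec_a J $ i)) [0..<dim_mx J])) \<le> V"
      "length (code_tuple (map (\<lambda>i. entry (common_den J) (vec_b J $ i)) [0..<dim_mu J])) \<le> V"
      unfolding V_def by (rule length_code_table; use d e' in simp)+
    have m: "length (code_tuple (map (\<lambda>i. code_tuple (map (\<lambda>j. entry (common_den J) (mat_A J $$ (i, j))) [0..<dim_nx J])) [0..<dim_mx J])) \<le> M"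
      "length (code_tuple (map (\<lambda>i. code_tuple (map (\<lambda>j. entry (common_den J) (mat_W J $$ (i, j))) [0..<dim_ny J])) [0..<dim_my J])) \<le> M"
      unfolding M_def V_def by (intro length_code_table e' d; assumption)+
    have t: "length (code_tuple (map (\<lambda>k. code_tuple (map (\<lambda>i. code_tuple (map (\<lambda>j.
        entry (common_den J) ((mats_B J ! k) $$ (i, j))) [0..<dim_nu J])) [0..<dim_mu J])) [0..<dim_nx J])) \<le> T"
      "length (code_tuple (map (\<lambda>k. code_tuple (map (\<lambda>i. code_tuple (map (\<lambda>j.
        entry (common_den J) ((mats_T J ! k) $$ (i, j))) [0..<dim_nx J])) [0..<dim_my J])) [0..<dim_nu J])) \<le> T"
      unfolding T_def M_def V_def by (intro length_code_table e' d; assumption)+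
    assume "w \<in> set [un (dim_mx J), un (dim_mu J), un (dim_my J), un (dim_nx J),
     un (dim_nu J), un (dim_ny J), nat_bits (bnd_R J), nat_bits (common_den J),
     code_tuple (map (\<lambda>i. entry (common_den J) (vec_a J $ i)) [0..<dim_mx J]),
     code_tuple (map (\<lambda>i. entry (common_den J) (vec_b J $ i)) [0..<dim_mu J]),
     code_tuple (map (\<lambda>i. code_tuple (map (\<lambda>j. entry (common_den J) (mat_A J $$ (i, j))) [0..<dim_nx J])) [0..<dim_mx J]),
     code_tuple (map (\<lambda>i. code_tuple (map (\<lambda>j. entry (common_den J) (mat_W J $$ (i, j))) [0..<dim_ny J])) [0..<dim_my J]),
     code_tuple (map (\<lambda>k. code_tuple (map (\<lambda>i. code_tuple (map (\<lambda>j.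
       entry (common_den J) ((mats_B J ! k) $$ (i, j))) [0..<dim_nu J])) [0..<dim_mu J])) [0..<dim_nx J]),
     code_tuple (map (\<lambda>k. code_tuple (map (\<lambda>i. code_tuple (map (\<lambda>j.
       entry (common_den J) ((mats_T J ! k) $$ (i, j))) [0..<dim_nx J])) [0..<dim_my J])) [0..<dim_nu J])]"
    then show "length w \<le> N + 1 + E + V + M + T"
      using v m t d R L unfolding set_simps
      by (elim insertE emptyE; hypsubst; (unfold length_replicate)?; linarith)
  qed simp
  then show ?thesis unfolding T_def M_def V_def E_def .
qed

section \<open>Membership in the third level of the polynomial hierarchy\<close>

lemma row_B_cong: "(\<And>j. j < udim C 4 \<Longrightarrow> u j = v j) \<Longrightarrow> row_B C u = row_B C v"
  by (simp add: row_B_def fun_eq_iff)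

lemma row_T_cong: "(\<And>j. j < udim C 4 \<Longrightarrow> u j = v j) \<Longrightarrow> row_T C u = row_T C v"
  by (simp add: row_T_def fun_eq_iff)

lemma sys_U_cong: "(\<And>j. j < udim C 4 \<Longrightarrow> u j = v j) \<Longrightarrow> sys_U C u S = sys_U C v S"
  using row_B_cong[of C u v] by (simp add: sys_U_def)

lemma sys_Y_cong:
  "(\<And>j. j < udim C 4 \<Longrightarrow> u j = v j) \<Longrightarrow> (\<And>j. j < udim C 5 \<Longrightarrow> y j = z j) \<Longrightarrow> sys_Y C u y S = sys_Y C v z S"
  using row_T_cong[of C u v] by (simp add: sys_Y_def rhs_Y_def)

lemma frac_sat_cong: "(\<And>k. k < n \<Longrightarrow> p k = p' k) \<Longrightarrow> frac_sat n p q = frac_sat n p' q"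
  by (simp add: frac_sat_def fun_eq_iff)

text \<open>At most \<open>2 ^ N\<close> terms, each a coefficient up to \<open>2 ^ (2 * N)\<close>
  times a value up to \<open>2 ^ N\<close>.\<close>

lemma abs_sum_le:
  fixes c :: "nat \<Rightarrow> int"
  assumes "\<And>j. j < m \<Longrightarrow> \<bar>c j\<bar> \<le> 2 ^ (2 * N)" "\<And>j. j < m \<Longrightarrow> v j \<le> R" "m \<le> N" "R < 2 ^ N"
  shows "\<bar>\<Sum>j<m. c j * int (v j)\<bar> \<le> 2 ^ (4 * N)"
proof -
  have R: "int R \<le> 2 ^ N" using assms(4) by (metis less_imp_le of_nat_le_iff of_nat_numeral of_nat_power)
  have "\<bar>\<Sum>j<m. c j * int (v j)\<bar> \<le> (\<Sum>j<m. \<bar>c j * int (v j)\<bar>)" by (rule sum_abs)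
  also have "\<dots> \<le> (\<Sum>j<m. 2 ^ (2 * N) * 2 ^ N)"
  proof (rule sum_mono)
    fix j assume "j \<in> {..<m}"
    then have "\<bar>c j\<bar> \<le> 2 ^ (2 * N)" "int (v j) \<le> 2 ^ N" using assms(1,2)[of j] R by auto
    then show "\<bar>c j * int (v j)\<bar> \<le> 2 ^ (2 * N) * 2 ^ N" by (simp add: abs_mult mult_mono)
  qed
  also have "\<dots> = int m * (2 ^ (2 * N) * 2 ^ N)" by simp
  also have "\<dots> \<le> 2 ^ N * (2 ^ (2 * N) * 2 ^ N)"
  proof (rule mult_right_mono)
    have "m < 2 ^ N" using assms(3) less_exp[of N] by linarith
    then show "int m \<le> 2 ^ N" by (metis less_imp_le of_nat_le_iff of_nat_numeral of_nat_power)
  qed simp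
  also have "\<dots> = 2 ^ (N + (2 * N + N))" by (simp only: power_add)
  also have "N + (2 * N + N) = 4 * N" by simp
  finally show ?thesis .
qed

lemma small_first_stage:
  assumes wf: "wf_inst J" and J: "bounded_two_stage J" and N: "N = length (code_inst J)"
  shows "\<exists>p q. 0 < q \<and> q < 2 ^ (5 * N * N + 1) \<and> (\<forall>k<dim_nx J. p k < 2 ^ (5 * N * N + 1)) \<and>
    (\<forall>k<dim_nx J. p k \<le> bnd_R J * q) \<and> sys_X (cert J) (frac_sat (dim_nx J) p q) \<and>
    (\<forall>u. sys_U (cert J) u (frac_sat (dim_nx J) p q) \<longrightarrow>
      (\<exists>y. (\<forall>j<dim_ny J. y j \<le> bnd_R J) \<and> sys_Y (cert J) u y (frac_sat (dim_nx J) p q)))"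
proof -
  define C where "C = cert J"
  define n where "n = dim_nx J"
  define R where "R = bnd_R J"
  have ok: "inst_ok C" and of: "inst_of C = J" using wf by (simp_all add: C_def inst_ok_cert inst_of_inst_cert)
  have d: "udim C 0 = dim_mx J" "udim C (Suc 0) = dim_mu J" "udim C 2 = dim_my J" "udim C 3 = n"
    "udim C 4 = dim_nu J" "udim C 5 = dim_ny J" "val (item C 6) = R"
    by (simp_all add: C_def n_def R_def)
  obtain x where x: "x \<in> X_c J" and stage2: "\<And>u. u \<in> U_d J x \<Longrightarrow> \<exists>y. y \<in> Y_d J x u"
    using J by (auto simp: bounded_two_stage_def)
  have xc: "x \<in> carrier_vec (udim C 3)" using x unfolding d n_def by (simp add: X_c_def box_def)
  have sx: "\<And>k. k < n \<Longrightarrow> 0 \<le> x $ k \<and> x $ k \<le> real R" "sys_X C (real_sat n x)"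
    using x X_c_iff[OF ok xc] unfolding of d by simp_all
  have "\<exists>y. sys_U C u (real_sat n x) \<longrightarrow> sys_Y C u y (real_sat n x)" for u
  proof (cases "sys_U C u (real_sat n x)")
    case True
    then have "vec (udim C 4) (\<lambda>j. real (u j)) \<in> U_d J x" using U_d_iff[OF ok xc, of u] unfolding of d by simp
    then obtain v where v: "v \<in> Y_d J x (vec (udim C 4) (\<lambda>j. real (u j)))" using stage2 by blast
    then have "v \<in> box (udim C 5) R \<inter> int_vecs (udim C 5)" unfolding d R_def by (simp add: Y_d_def)
    then obtain y where "v = vec (udim C 5) (\<lambda>j. real (y j))" by (rule box_int_vecsE) blast
    then show ?thesis using v Y_d_iff[OF ok xc, of y u] unfolding of d by auto
  qed simp
  \<comment> \<open>Fixing one response per \<open>u\<close> before x is changed makes its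
    constraints linear in x.\<close>
  then obtain ys where ys: "\<And>u. sys_U C u (real_sat n x) \<Longrightarrow> sys_Y C u (ys u) (real_sat n x)" by metis
  \<comment> \<open>Extensional functions, so that the box is a finite set.\<close>
  define U where "U = ({..<dim_nu J} \<rightarrow>\<^sub>E {..R})"
  define G where "G = {u \<in> U. sys_U C u (real_sat n x)}"
  \<comment> \<open>Every violated row is recorded, so that none has to be selected. Each
    \<open>u\<close> in the box outside the set at x violates some row, and one reversed strict
    inequality is enough to keep it out.\<close>
  define V where "V = {(u, i) \<in> U \<times> {..<dim_mu J}. \<not> real_sat n x (row_B C u i) (coef (item2 C 9 i))}"
  define NN where "NN = (\<lambda>i. (\<lambda>k. coef (item3 C 10 i k), coef (item2 C 8 i))) ` {..<dim_mx J} \<union>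
    (\<lambda>k. (\<lambda>j. if j = k then 1 else 0, int R)) ` {..<n} \<union>
    (\<lambda>(u, i). (row_T C u i, rhs_Y C (ys u) i)) ` (G \<times> {..<dim_my J})"
  define SS where "SS = (\<lambda>(u, i). (\<lambda>k. - row_B C u i k, - coef (item2 C 9 i))) ` V"
  have finU: "finite U" by (simp add: U_def finite_PiE)
  have fin: "finite NN" "finite SS"
    using finU finite_subset[of V "U \<times> {..<dim_mu J}"] by (auto simp: NN_def SS_def G_def V_def)
  \<comment> \<open>The end markers of the unary dimensions leave room for the homogenising
    variable: even \<open>n + 1\<close> is at most \<open>N\<close>.\<close>
  have dN: "dim_nu J \<le> N" "dim_ny J \<le> N" "n + 1 \<le> N" unfolding N length_code_inst n_def by simp_all
  have RN: "R < 2 ^ N" unfolding R_def N by (rule bnd_R_less)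
  have cN: "\<bar>coef (entry (common_den J) r)\<bar> \<le> 2 ^ (2 * N)" if "r \<in> set (entries J)" for r
    unfolding N by (rule abs_coef_entry[OF entry_facts(2)[OF that] common_den_le])
  have c: "i < dim_mx J \<Longrightarrow> \<bar>coef (item2 C 8 i)\<bar> \<le> 2 ^ (2 * N)"
    "i < dim_mu J \<Longrightarrow> \<bar>coef (item2 C 9 i)\<bar> \<le> 2 ^ (2 * N)"
    "i < dim_mx J \<Longrightarrow> j < n \<Longrightarrow> \<bar>coef (item3 C 10 i j)\<bar> \<le> 2 ^ (2 * N)"
    "i < dim_my J \<Longrightarrow> j < dim_ny J \<Longrightarrow> \<bar>coef (item3 C 11 i j)\<bar> \<le> 2 ^ (2 * N)"
    "k < n \<Longrightarrow> i < dim_mu J \<Longrightarrow> j < dim_nu J \<Longrightarrow> \<bar>coef (item4 C 12 k i j)\<bar> \<le> 2 ^ (2 * N)"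
    "k < dim_nu J \<Longrightarrow> i < dim_my J \<Longrightarrow> j < n \<Longrightarrow> \<bar>coef (item4 C 13 k i j)\<bar> \<le> 2 ^ (2 * N)" for i j k
    using in_entries[OF wf, THEN cN] by (simp_all add: C_def n_def)
  have mono: "(2 :: int) ^ (2 * N) \<le> 2 ^ (4 * N)" "(2 :: int) ^ N \<le> 2 ^ (4 * N)" "(1 :: int) \<le> 2 ^ (4 * N)"
    by (simp_all add: power_increasing)
  have mono': "a \<le> 2 ^ (2 * N) \<Longrightarrow> a \<le> 2 ^ (4 * N)" for a :: int
    using mono(1) by (rule order.trans[rotated])
  have RN': "int R \<le> 2 ^ (4 * N)"
    using RN mono(2) by (metis less_imp_le of_nat_le_iff of_nat_numeral of_nat_power order.trans)
  have uR: "u j \<le> R" if "u \<in> U" "j < dim_nu J" for u j using that by (auto simp: U_def)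
  have yR: "ys u j \<le> R" if "u \<in> G" "j < dim_ny J" for u j
    using ys[of u] that by (simp add: G_def sys_Y_def d)
  have bnd: "(\<forall>k<n. \<bar>a k\<bar> \<le> int (2 ^ (4 * N))) \<and> \<bar>b\<bar> \<le> int (2 ^ (4 * N))" if ab: "(a, b) \<in> NN \<union> SS" for a b
  proof -
    consider (X) i where "i < dim_mx J" "a = (\<lambda>k. coef (item3 C 10 i k))" "b = coef (item2 C 8 i)"
      | (R) k where "a = (\<lambda>j. if j = k then 1 else 0)" "b = int R"
      | (T) u i where "u \<in> G" "i < dim_my J" "a = row_T C u i" "b = rhs_Y C (ys u) i"
      | (B) u i where "u \<in> U" "i < dim_mu J" "a = (\<lambda>k. - row_B C u i k)" "b = - coef (item2 C 9 i)"
      using ab by (auto simp: NN_def SS_def V_def)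
    then show ?thesis
    proof cases
      case X
      then show ?thesis using c(1,3)[of i] by (auto intro!: mono')
    next
      case R
      then show ?thesis using RN' mono(3) by simp
    next
      case T
      have "u \<in> U" using T(1) by (simp add: G_def)
      then have "\<bar>row_T C u i k\<bar> \<le> 2 ^ (4 * N)" if "k < n" for k unfolding row_T_def d
        using that c(6) T(2) uR dN(1) RN by (intro abs_sum_le[where R = R]) auto
      moreover have "\<bar>rhs_Y C (ys u) i\<bar> \<le> 2 ^ (4 * N)" unfolding rhs_Y_def d abs_minus_cancel
        using c(4) T(2) yR[OF T(1)] dN(2) RN by (intro abs_sum_le[where R = R]) auto
      ultimately show ?thesis using T by simp
    next
      case B
      have "\<bar>row_B C u i k\<bar> \<le> 2 ^ (4 * N)" if "k < n" for k unfolding row_B_def d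
        using that c(5) B(2) uR[OF B(1)] dN(1) RN by (intro abs_sum_le[where R = R]) auto
      then show ?thesis using B c(2)[of i] by (auto intro!: mono')
    qed
  qed
  have "\<exists>(p :: nat \<Rightarrow> nat) q. 0 < q \<and> q \<le> fact (n + 1) * (2 ^ (4 * N)) ^ (n + 1) \<and>
    (\<forall>i<n. p i \<le> fact (n + 1) * (2 ^ (4 * N)) ^ (n + 1)) \<and>
    (\<forall>(a, b) \<in> NN. (\<Sum>i<n. a i * int (p i)) \<le> b * int q) \<and>
    (\<forall>(a, b) \<in> SS. (\<Sum>i<n. a i * int (p i)) < b * int q)"
  proof (rule small_solution[OF fin, where x = "\<lambda>k. x $ k"])
    fix a b assume "(a, b) \<in> NN"
    then consider (X) i where "i < dim_mx J" "a = (\<lambda>k. coef (item3 C 10 i k))" "b = coef (item2 C 8 i)"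
      | (R) k where "k < n" "a = (\<lambda>j. if j = k then 1 else 0)" "b = int R"
      | (T) u i where "u \<in> G" "i < dim_my J" "a = row_T C u i" "b = rhs_Y C (ys u) i"
      by (auto simp: NN_def)
    then show "(\<Sum>i<n. real_of_int (a i) * x $ i) \<le> real_of_int b"
    proof cases
      case X
      then show ?thesis using sx(2) by (simp add: sys_X_def real_sat_def d)
    next
      case R
      then have "(\<Sum>i<n. real_of_int (a i) * x $ i) = (\<Sum>i<n. if i = k then x $ i else 0)"
        by (intro sum.cong) auto
      then show ?thesis using R sx(1) by simp
    next
      case T
      then show ?thesis using ys[of u] by (simp add: G_def sys_Y_def real_sat_def d)
    qed
  next
    fix a b assume "(a, b) \<in> SS"
    then obtain u i where *: "\<not> real_sat n x (row_B C u i) (coef (item2 C 9 i))"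
      "a = (\<lambda>k. - row_B C u i k)" "b = - coef (item2 C 9 i)" by (auto simp: SS_def V_def)
    then show "(\<Sum>i<n. real_of_int (a i) * x $ i) < real_of_int b"
      by (simp add: real_sat_def sum_negf not_le)
  qed (use bnd sx(1) in auto)
  then obtain p :: "nat \<Rightarrow> nat" and q where q: "0 < q" "q \<le> fact (n + 1) * (2 ^ (4 * N)) ^ (n + 1)"
    and p: "\<forall>i<n. p i \<le> fact (n + 1) * (2 ^ (4 * N)) ^ (n + 1)"
    and pN: "\<And>a b. (a, b) \<in> NN \<Longrightarrow> frac_sat n p q a b"
    and pS: "\<And>a b. (a, b) \<in> SS \<Longrightarrow> (\<Sum>i<n. a i * int (p i)) < b * int q"
    unfolding frac_sat_def by blast
  \<comment> \<open>With \<open>n + 1 \<le> N\<close>, the factorial contributes at most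
    \<open>2 ^ (N * (n + 1))\<close> and the determinant entries
    \<open>2 ^ (4 * N * (n + 1))\<close>.\<close>
  have size: "fact (n + 1) * (2 ^ (4 * N)) ^ (n + 1) < (2 :: nat) ^ (5 * N * N + 1)"
  proof -
    have "fact (n + 1) \<le> (n + 1) ^ (n + 1)" using fact_le_power[where n = "n + 1" and 'a = nat] by (simp del: fact_Suc)
    also have "\<dots> \<le> (2 ^ N) ^ (n + 1)"
      using dN(3) less_exp[of N] by (intro power_mono) linarith+
    finally have "fact (n + 1) * (2 ^ (4 * N)) ^ (n + 1) \<le> (2 ^ N) ^ (n + 1) * (2 ^ (4 * N) :: nat) ^ (n + 1)"
      by (rule mult_le_mono1)
    also have "\<dots> = 2 ^ (5 * N * (n + 1))" by (simp only: power_mult[symmetric] power_add[symmetric]) (simp add: algebra_simps)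
    also have "\<dots> \<le> 2 ^ (5 * N * N)" using dN(3) by (intro power_increasing mult_le_mono2) simp_all
    also have "\<dots> < 2 ^ (5 * N * N + 1)" by simp
    finally show ?thesis .
  qed
  have stage: "\<exists>y. (\<forall>j<dim_ny J. y j \<le> R) \<and> sys_Y C u y (frac_sat n p q)" if u: "sys_U C u (frac_sat n p q)" for u
  proof -
    \<comment> \<open>An arbitrary \<open>u\<close> may take any values beyond its dimension;
      restriction puts it into the finite set \<open>U\<close> without affecting the
      constraints.\<close>
    define u' where "u' = restrict u {..<dim_nu J}"
    have e: "u j = u' j" if "j < udim C 4" for j using that by (simp add: u'_def d)
    have "sys_U C u' (frac_sat n p q)" using u sys_U_cong[of C u u', OF e] by blast
    then have sat: "\<And>j. j < dim_nu J \<Longrightarrow> u' j \<le> R" "\<And>i. i < dim_mu J \<Longrightarrow> frac_sat n p q (row_B C u' i) (coef (item2 C 9 i))"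
      by (auto simp: sys_U_def d)
    have U: "u' \<in> U" using sat(1) by (auto simp: U_def u'_def)
    have "real_sat n x (row_B C u' i) (coef (item2 C 9 i))" if i: "i < dim_mu J" for i
    proof (rule ccontr)
      assume "\<not> real_sat n x (row_B C u' i) (coef (item2 C 9 i))"
      then have "(\<lambda>k. - row_B C u' i k, - coef (item2 C 9 i)) \<in> SS" using U i by (force simp: SS_def V_def)
      from pS[OF this] sat(2)[OF i] show False by (simp add: frac_sat_def sum_negf)
    qed
    then have G: "u' \<in> G" using U sat(1) by (simp add: G_def sys_U_def d)
    have "sys_Y C u' (ys u') (frac_sat n p q)"
      using G yR[OF G] by (auto simp: sys_Y_def d NN_def intro!: pN)
    then show ?thesis using yR[OF G] sys_Y_cong[of C u u' "ys u'" "ys u'", OF e] by blast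
  qed
  have "p k \<le> R * q" if "k < n" for k
  proof -
    have "frac_sat n p q (\<lambda>j. if j = k then 1 else 0) (int R)" by (rule pN) (use that in \<open>auto simp: NN_def\<close>)
    moreover have "(\<Sum>j<n. (if j = k then 1 else 0) * int (p j)) = int (p k)"
    proof -
      have "(\<Sum>j<n. (if j = k then 1 else 0) * int (p j)) = (\<Sum>j<n. if j = k then int (p j) else 0)"
        by (intro sum.cong) auto
      then show ?thesis using that by simp
    qed
    ultimately have "int (p k) \<le> int (R * q)" by (simp add: frac_sat_def)
    then show ?thesis by (simp only: of_nat_le_iff)
  qed
  moreover have "sys_X C (frac_sat n p q)" by (auto simp: sys_X_def d NN_def intro!: pN)
  moreover have "q < 2 ^ (5 * N * N + 1)" using q(2) size by (rule le_less_trans)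
  moreover have "\<forall>k<n. p k < 2 ^ (5 * N * N + 1)" using p size le_less_trans by blast
  ultimately show ?thesis using q(1) stage unfolding C_def n_def R_def by blast
qed

text \<open>The summands bound the words for x, for u, and for the certificate together with y.
  Their sum serves all three quantifiers.\<close>

definition word_bound :: "nat \<Rightarrow> nat" where
  "word_bound N = 2 * (2 * ((5 * N * N + 1) + N * (2 * (5 * N * N + 1) + 1)) + 1) + N * (2 * N + 1) +
    2 * (2 * (14 * (2 * (N + 1 + (12 * N + 10) + N * (2 * (12 * N + 10) + 1) +
      N * (2 * (N * (2 * (12 * N + 10) + 1)) + 1) +
      N * (2 * (N * (2 * (N * (2 * (12 * N + 10) + 1)) + 1)) + 1)) + 1) + N * (2 * N + 1)) + 1)"

lemma poly_bounded_word_bound: "poly_bounded word_bound"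
  unfolding word_bound_def by (intro pb_intros)

section \<open>Completeness and soundness of the verifier\<close>

definition nat_table :: "nat \<Rightarrow> (nat \<Rightarrow> nat) \<Rightarrow> bool list" where
  "nat_table n f = code_tuple (map (\<lambda>k. nat_bits (f k)) [0..<n])"

lemma val_nat_table: "k < n \<Longrightarrow> val (item (nat_table n f) k) = f k"
  by (simp add: nat_table_def item_code_tuple)

lemma length_nat_table:
  "(\<And>k. k < n \<Longrightarrow> f k < 2 ^ b) \<Longrightarrow> n \<le> N \<Longrightarrow> length (nat_table n f) \<le> N * (2 * b + 1)"
  unfolding nat_table_def by (rule length_code_table) (auto intro: length_nat_bits)

lemma length_code_pair:
  "length v \<le> b \<Longrightarrow> length w \<le> c \<Longrightarrow> length (code_tuple [v, w]) \<le> 2 * (2 * (b + c) + 1)"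
  by (rule length_code_tuple) auto

text \<open>\<open>Y\<close> is unrestricted in length, since any word denotes some vector; this
  leaves freedom to enlarge the bound of the quantifiers later.\<close>

lemma verify_complete:
  assumes wf: "wf_inst J" and J: "bounded_two_stage J" and N: "N = length (code_inst J)"
  shows "\<exists>X. length X \<le> word_bound N \<and> (\<forall>Y. \<exists>Z. length Z \<le> word_bound N \<and> verify (code_inst J) X Y Z)"
proof -
  define n where "n = dim_nx J"
  define S where "S = 5 * N * N + 1"
  have dN: "n \<le> N" "dim_ny J \<le> N" unfolding N length_code_inst n_def by simp_all
  have RN: "bnd_R J < 2 ^ N" unfolding N by (rule bnd_R_less)
  obtain p q where q: "0 < q" "q < 2 ^ S" and p: "\<And>k. k < n \<Longrightarrow> p k < 2 ^ S" "\<And>k. k < n \<Longrightarrow> p k \<le> bnd_R J * q"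
    and X: "sys_X (cert J) (frac_sat n p q)"
    and U: "\<And>u. sys_U (cert J) u (frac_sat n p q) \<Longrightarrow>
      \<exists>y. (\<forall>j<dim_ny J. y j \<le> bnd_R J) \<and> sys_Y (cert J) u y (frac_sat n p q)"
    using small_first_stage[OF wf J N] unfolding S_def n_def by blast
  define x where "x = code_tuple [nat_bits q, nat_table n p]"
  have ix: "val (item x 0) = q" "item x 1 = nat_table n p" by (simp_all add: x_def item_code_tuple)
  have fx: "frac_sat n (\<lambda>k. val (item2 x 1 k)) (val (item x 0)) = frac_sat n p q"
    unfolding ix by (rule frac_sat_cong) (rule val_nat_table)
  have lx: "length x \<le> word_bound N"
  proof -
    have "length x \<le> 2 * (2 * (S + N * (2 * S + 1)) + 1)" unfolding x_def
      by (rule length_code_pair[OF length_nat_bits[OF q(2)] length_nat_table[OF p(1) dN(1)]])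
    then show ?thesis unfolding word_bound_def S_def by linarith
  qed
  have "\<exists>Z. length Z \<le> word_bound N \<and> verify (code_inst J) x Y Z" for Y
  proof -
    define u where "u j = val (item Y j)" for j
    \<comment> \<open>When \<open>u\<close> is not admissible, the certificate is still demanded,
      and the zero vector fills the place of the response.\<close>
    have "\<exists>y. (\<forall>j<dim_ny J. y j \<le> bnd_R J) \<and> (sys_U (cert J) u (frac_sat n p q) \<longrightarrow> sys_Y (cert J) u y (frac_sat n p q))"
      using U[of u] by (cases "sys_U (cert J) u (frac_sat n p q)") (auto intro: exI[of _ "\<lambda>_. 0"])
    then obtain y where y: "\<And>j. j < dim_ny J \<Longrightarrow> y j \<le> bnd_R J"
      "sys_U (cert J) u (frac_sat n p q) \<Longrightarrow> sys_Y (cert J) u y (frac_sat n p q)" by blast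
    define Z where "Z = code_tuple [cert J, nat_table (dim_ny J) y]"
    have iZ: "item Z 0 = cert J" "item Z 1 = nat_table (dim_ny J) y" by (simp_all add: Z_def item_code_tuple)
    have "length (nat_table (dim_ny J) y) \<le> N * (2 * N + 1)"
      by (rule length_nat_table) (use y(1) RN dN(2) in \<open>auto intro: le_less_trans\<close>)
    from length_code_pair[OF length_cert[OF wf N] this]
    have lZ: "length Z \<le> word_bound N" unfolding Z_def[symmetric] word_bound_def by linarith
    have "sys_Y (cert J) u (\<lambda>j. val (item2 Z 1 j)) (frac_sat n p q) = sys_Y (cert J) u y (frac_sat n p q)"
      by (rule sys_Y_cong) (simp_all add: iZ val_nat_table del: One_nat_def)
    moreover have "code_inst J = inst_word (cert J)"
      using code_inst_of[OF inst_ok_cert[OF wf]] inst_of_inst_cert[OF wf] by simp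
    ultimately have "verify (code_inst J) x Y Z"
      using q(1) p(2) X y(2) inst_ok_cert[OF wf]
      unfolding verify_def Let_def iZ(1) u_def[symmetric] udim_inst_cert n_def[symmetric] fx
      by (simp add: ix val_nat_table u_def del: One_nat_def)
    then show ?thesis using lZ by blast
  qed
  then show ?thesis using lx by blast
qed

text \<open>Only short \<open>Y\<close> are needed, because vectors in the box have short tables,
  and the mere existence of \<open>Z\<close> suffices.\<close>

lemma verify_sound:
  assumes XZ: "\<And>Y. length Y \<le> word_bound (length I) \<Longrightarrow> \<exists>Z. verify I X Y Z"
  shows "\<exists>J. wf_inst J \<and> bounded_two_stage J \<and> I = code_inst J"
proof -
  \<comment> \<open>A single query reveals the instance, even if there are no second-stage vectors
    at all. The empty word serves because it meets every length bound.\<close>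
  obtain Z0 where Z0: "verify I X [] Z0" using XZ[of "[]"] by auto
  define J where "J = inst_of (item Z0 0)"
  have I: "I = code_inst J" and wf: "wf_inst J"
    using Z0 wf_inst_of code_inst_of by (auto simp: verify_def Let_def J_def)
  \<comment> \<open>The certificate may vary with \<open>Y\<close>, but injectivity of the encoding
    makes all of them describe the same instance.\<close>
  have J_unique: "inst_of C = J" if "inst_ok C" "I = inst_word C" for C
    using inj_onD[OF code_inst_inj, of "inst_of C" J] that code_inst_of wf wf_inst_of I by simp
  define n where "n = dim_nx J"
  define q where "q = val (item X 0)"
  define p where "p k = val (item2 X 1 k)" for k
  define x where "x = vec n (\<lambda>k. real (p k) / real q)"
  have dims: "udim C 3 = n" "udim C 4 = dim_nu J" "udim C 5 = dim_ny J" "val (item C 6) = bnd_R J"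
    if "inst_of C = J" for C
    using that by (auto simp: inst_of_def n_def)
  have xc: "x \<in> carrier_vec n" by (simp add: x_def)
  have v: "inst_ok (item Z 0) \<and> inst_of (item Z 0) = J \<and> 0 < q \<and> (\<forall>k<n. p k \<le> bnd_R J * q) \<and>
      sys_X (item Z 0) (frac_sat n p q) \<and>
      (sys_U (item Z 0) (\<lambda>j. val (item Y j)) (frac_sat n p q) \<longrightarrow>
       sys_Y (item Z 0) (\<lambda>j. val (item Y j)) (\<lambda>j. val (item2 Z 1 j)) (frac_sat n p q))"
    if V: "verify I X Y Z" for Y Z
  proof -
    have "inst_of (item Z 0) = J" using V J_unique by (simp add: verify_def Let_def)
    then show ?thesis using V dims[of "item Z 0"]
      unfolding verify_def Let_def q_def[symmetric] p_def[symmetric] by simp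
  qed
  have q: "0 < q" using v[OF Z0] by blast
  have sat: "real_sat n x = frac_sat n p q"
    unfolding x_def using real_sat_frac[OF q] by (simp add: fun_eq_iff)
  have "x \<in> X_c J"
  proof -
    let ?C = "item Z0 0"
    note vC = v[OF Z0]
    have C: "inst_of ?C = J" using vC by blast
    have "0 \<le> x $ k \<and> x $ k \<le> real (bnd_R J)" if k: "k < n" for k
    proof -
      have "real (p k) \<le> real (bnd_R J * q)" using vC k by (intro of_nat_mono) blast
      then show ?thesis using q k by (simp add: x_def divide_le_eq)
    qed
    then show ?thesis using X_c_iff[of ?C x] vC xc unfolding C dims[OF C] sat by blast
  qed
  moreover have "\<exists>y. y \<in> Y_d J x u'" if u': "u' \<in> U_d J x" for u'
  proof -
    have "u' \<in> box (dim_nu J) (bnd_R J) \<inter> int_vecs (dim_nu J)" using u' by (simp add: U_d_def)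
    then obtain u where u: "u' = vec (dim_nu J) (\<lambda>j. real (u j))" "\<And>j. j < dim_nu J \<Longrightarrow> u j \<le> bnd_R J"
      by (rule box_int_vecsE) blast
    let ?Y = "nat_table (dim_nu J) u"
    have "length ?Y \<le> length I * (2 * length I + 1)"
    proof (rule length_nat_table)
      show "u k < 2 ^ length I" if "k < dim_nu J" for k
        using u(2)[OF that] bnd_R_less[of J] by (simp add: I)
      show "dim_nu J \<le> length I" unfolding I length_code_inst by simp
    qed
    then have "length ?Y \<le> word_bound (length I)" unfolding word_bound_def by linarith
    then obtain Z where "verify I X ?Y Z" using XZ by blast
    note vC = v[OF this]
    let ?C = "item Z 0" and ?y = "\<lambda>j. val (item2 Z 1 j)"
    have C: "inst_of ?C = J" and ok: "inst_ok ?C" using vC by simp_all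
    have e: "val (item ?Y j) = u j" if "j < udim ?C 4" for j
      using that by (simp add: dims[OF C] val_nat_table)
    have "sys_U ?C u (frac_sat n p q)"
      using U_d_iff[OF ok, of x u] u' xc unfolding C dims[OF C] sat u(1) by blast
    then have "sys_U ?C (\<lambda>j. val (item ?Y j)) (frac_sat n p q)"
      using sys_U_cong[of ?C "\<lambda>j. val (item ?Y j)" u] e by blast
    then have "sys_Y ?C (\<lambda>j. val (item ?Y j)) ?y (frac_sat n p q)" using vC by blast
    then have "sys_Y ?C u ?y (frac_sat n p q)"
      using sys_Y_cong[of ?C "\<lambda>j. val (item ?Y j)" u ?y ?y] e by blast
    then have "vec (dim_ny J) (\<lambda>j. real (?y j)) \<in> Y_d J x u'"
      using Y_d_iff[OF ok, of x ?y u] xc unfolding C dims[OF C] sat u(1) by blast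
    then show ?thesis by blast
  qed
  ultimately have "bounded_two_stage J" unfolding bounded_two_stage_def by blast
  then show ?thesis using wf I by blast
qed

theorem theorem17:
  shows "Bounded_Two_Stage \<in> Sigma3p"
proof -
  define P where "P = {w. starts_True [verify (item w 0) (item w 1) (item w 2) (item w 3)]}"
  have P: "P \<in> ptime" unfolding P_def
    by (rule ptime_if_FP) (use FB_verify in \<open>simp add: FB_def\<close>)
  have inP: "code_tuple [I, X, Y, Z] \<in> P \<longleftrightarrow> verify I X Y Z" for I X Y Z
    by (simp add: P_def item_code_tuple)
  \<comment> \<open>Replacing \<open>word_bound\<close> by a larger polynomial is harmless:
    completeness answers every \<open>Y\<close>, and soundness queries only short ones.\<close>
  obtain p :: "nat poly" where p: "\<And>n. word_bound n \<le> poly p n"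
    using poly_bounded_word_bound by (auto simp: poly_bounded_def)
  have "I \<in> Bounded_Two_Stage \<longleftrightarrow> (\<exists>X. length X \<le> poly p (length I) \<and>
       (\<forall>Y. length Y \<le> poly p (length I) \<longrightarrow>
         (\<exists>Z. length Z \<le> poly p (length I) \<and> code_tuple [I, X, Y, Z] \<in> P)))" for I
  proof
    assume "I \<in> Bounded_Two_Stage"
    then obtain J where "wf_inst J" "bounded_two_stage J" and I: "I = code_inst J"
      by (auto simp: Bounded_Two_Stage_def)
    from verify_complete[OF this(1,2) refl] show "\<exists>X. length X \<le> poly p (length I) \<and>
       (\<forall>Y. length Y \<le> poly p (length I) \<longrightarrow>
         (\<exists>Z. length Z \<le> poly p (length I) \<and> code_tuple [I, X, Y, Z] \<in> P))"
      unfolding inP I[symmetric] using p le_trans by meson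
  next
    assume "\<exists>X. length X \<le> poly p (length I) \<and>
       (\<forall>Y. length Y \<le> poly p (length I) \<longrightarrow>
         (\<exists>Z. length Z \<le> poly p (length I) \<and> code_tuple [I, X, Y, Z] \<in> P))"
    then obtain X where "\<And>Y. length Y \<le> poly p (length I) \<Longrightarrow> \<exists>Z. verify I X Y Z"
      unfolding inP by blast
    then have "\<exists>J. wf_inst J \<and> bounded_two_stage J \<and> I = code_inst J"
      using p le_trans by (intro verify_sound[of I X]) blast
    then show "I \<in> Bounded_Two_Stage" by (auto simp: Bounded_Two_Stage_def)
  qed
  then show ?thesis unfolding Sigma3p_def using P by blast
qed

end
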